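(* Let $d\ge1$, $0<\alpha<1$, and let $u_0\in L^1(\mathbb R^d)\cap\mathcal C_b(\mathbb R^d)$ be radially symmetric with $u_0\ge0$. For $\varepsilon>0$ let $u_\varepsilon$ be the (radial) classical solution of $$\begin{cases}u_t=\nabla\cdot\bigl((\varepsilon+u_+)^\alpha\nabla v\bigr)+\varepsilon\Delta u&\text{in }(0,+\infty)\times\mathbb R^d,\\ -\Delta v=u&\text{in }(0,+\infty)\times\mathbb R^d,\\ u(t,x)\to0&\text{as }|x|\to+\infty,\ t>0,\\ u=u_0&\text{at }t=0,\end{cases}$$ with $v=\mathrm N(u)$ the Newtonian potential of $u(t,\cdot)$, and let $m_\varepsilon(t,\rho)=\int_{\omega_d|x|^d\le\rho}u_\varepsilon(t,x)\,dx$ be its mass. Then, as $\varepsilon\to0$, $m_\varepsilon\to m$ in $\mathcal C_{loc}([0,+\infty)\times[0,+\infty))$, where $m$ is the viscosity solution of $$\begin{cases}m_t+(m_\rho)_+^\alpha\,m=0,&t>0,\ \rho>0,\\ m(0,\rho)=m_0(\rho):=\int_{\omega_d|x|^d\le\rho}u_0(x)\,dx,\\ m(t,0)=0.\end{cases}$$ Furthermore, $m$ is Lipschitz continuous in the variable $\rho$.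
   Context: $s_+=\max(s,0)$; $\omega_d$ is the volume of the unit ball of $\mathbb R^d$; $\rho=\omega_d|x|^d$ is the volume variable. $\mathrm N(u)$ is the Newtonian potential (inverse of $-\Delta$ on $\mathbb R^d$); only its gradient enters, and for $u(t,\cdot)\in L^1\cap L^\infty$ it is $\nabla\mathrm N(u)(t,x)=-\dfrac1{d\omega_d}\int_{\mathbb R^d}\frac{x-z}{|x-z|^d}u(t,z)\,dz$. A classical solution is a function $u$, continuous on $[0,\infty)\times\mathbb R^d$, bounded on $[0,T]\times\mathbb R^d$ for each $T$, with $u\in\mathcal C([0,\infty);L^1(\mathbb R^d))$, once continuously differentiable in $t$ and twice in $x$ for $t>0$, which satisfies the equation pointwise and takes the initial datum. For continuous $f$ on $[0,\infty)^2$ and $X\in(0,\infty)^2$, $D^-f(X)=\{p:\liminf_{Y\to X}\frac{f(Y)-f(X)-p\cdot(Y-X)}{|Y-X|}\ge0\}$ and $D^+f(X)=\{p:\limsup_{Y\to X}\frac{f(Y)-f(X)-p\cdot(Y-X)}{|Y-X|}\le0\}$. A function $m\in\mathcal C([0,\infty)^2)$ is a viscosity subsolution (resp. supersolution) of the mass problem if $p_1+(p_2)_+^\alpha m(t,\rho)\le0$ for all $(t,\rho)\in(0,\infty)^2$, $(p_1,p_2)\in D^+m(t,\rho)$ (resp. $\ge0$ for all $(p_1,p_2)\in D^-m(t,\rho)$), and $m(0,\rho)\le m_0(\rho)$, $m(t,0)\le0$ (resp. $\ge$, $\ge$); a viscosity solution is both. "The" viscosity solution is the bounded and uniformly continuous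 one, which is unique. *)

theory Defs
  imports "HOL-Analysis.Analysis"
begin

text \<open>The space \<open>\<real>\<^sup>d\<close> is an arbitrary type \<open>'a :: euclidean_space\<close> with \<open>d = DIM('a) \<ge> 1\<close>;
  functions of time and space are curried, \<open>u t x\<close>.\<close>

subsection \<open>Pointwise differential operators\<close>

text \<open>Divergence and Laplacian are relations, so that asserting a value
  also asserts that the derivatives involved exist.\<close>

definition has_divergence :: "('a::euclidean_space \<Rightarrow> 'a) \<Rightarrow> real \<Rightarrow> 'a \<Rightarrow> bool" where
  "has_divergence F D x \<longleftrightarrow>
     (\<exists>F'. (F has_derivative F') (at x) \<and> D = (\<Sum>b\<in>Basis. F' b \<bullet> b))"

definition has_laplacian :: "('a::euclidean_space \<Rightarrow> real) \<Rightarrow> real \<Rightarrow> 'a \<Rightarrow> bool" where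
  "has_laplacian f L x \<longleftrightarrow>
     (\<exists>G. (\<forall>\<^sub>F y in nhds x. GDERIV f y :> G y) \<and> has_divergence G L x)"

subsection \<open>Volume variable, mass and Newtonian potential\<close>

definition radial :: "('a::euclidean_space \<Rightarrow> real) \<Rightarrow> bool" where
  "radial w \<longleftrightarrow> (\<forall>x y. norm x = norm y \<longrightarrow> w x = w y)"

definition omega :: "'a::euclidean_space itself \<Rightarrow> real" where
  "omega _ = measure lborel (ball (0::'a) 1)"

definition mass :: "('a::euclidean_space \<Rightarrow> real) \<Rightarrow> real \<Rightarrow> real" where
  "mass w \<rho> = (LINT x : {x. omega TYPE('a) * norm x ^ DIM('a) \<le> \<rho>} | lborel. w x)"

definition newton_grad :: "('a::euclidean_space \<Rightarrow> real) \<Rightarrow> 'a \<Rightarrow> 'a" where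
  "newton_grad w x =
     - (1 / (DIM('a) * omega TYPE('a))) *\<^sub>R
       (LINT z | lborel. (w z / norm (x - z) ^ DIM('a)) *\<^sub>R (x - z))"

text \<open>For \<open>w \<in> L\<^sup>1 \<inter> L\<^sup>\<infinity>\<close> the potential itself need not be given by a convergent
  integral when \<open>d \<le> 2\<close>, while its gradient is; the potential is therefore only
  determined up to an additive constant.\<close>

definition newtonian_potential :: "('a::euclidean_space \<Rightarrow> real) \<Rightarrow> ('a \<Rightarrow> real) \<Rightarrow> bool" where
  "newtonian_potential w V \<longleftrightarrow> (\<forall>x. GDERIV V x :> newton_grad w x)"

subsection \<open>Classical solutions of the regularised problem\<close>

definition continuous_in_L1 :: "(real \<Rightarrow> 'a::euclidean_space \<Rightarrow> real) \<Rightarrow> bool" where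
  "continuous_in_L1 u \<longleftrightarrow>
     (\<forall>t\<ge>0. integrable lborel (u t)) \<and>
     (\<forall>t\<ge>0. ((\<lambda>s. LINT x | lborel. \<bar>u s x - u t x\<bar>) \<longlongrightarrow> 0) (at t within {0..}))"

definition C1_in_time :: "(real \<Rightarrow> 'a::euclidean_space \<Rightarrow> real) \<Rightarrow> bool" where
  "C1_in_time u \<longleftrightarrow>
     (\<exists>u'. (\<forall>t>0. \<forall>x. ((\<lambda>s. u s x) has_real_derivative u' t x) (at t)) \<and>
           continuous_on ({0<..} \<times> UNIV) (\<lambda>(t, x). u' t x))"

definition C2_in_space :: "(real \<Rightarrow> 'a::euclidean_space \<Rightarrow> real) \<Rightarrow> bool" where
  "C2_in_space u \<longleftrightarrow>
     (\<exists>(G :: real \<Rightarrow> 'a \<Rightarrow> 'a) (H :: real \<Rightarrow> 'a \<Rightarrow> 'a \<Rightarrow>\<^sub>L 'a).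
        (\<forall>t>0. \<forall>x. GDERIV (u t) x :> G t x) \<and>
        (\<forall>t>0. \<forall>x. (G t has_derivative blinfun_apply (H t x)) (at x)) \<and>
        continuous_on ({0<..} \<times> UNIV) (\<lambda>(t, x). G t x) \<and>
        continuous_on ({0<..} \<times> UNIV) (\<lambda>(t, x). H t x))"

definition regularised_equation ::
    "real \<Rightarrow> real \<Rightarrow> (real \<Rightarrow> 'a::euclidean_space \<Rightarrow> real) \<Rightarrow> bool" where
  "regularised_equation \<alpha> \<epsilon> u \<longleftrightarrow>
     (\<exists>v. \<forall>t>0. newtonian_potential (u t) (v t) \<and>
        (\<forall>x. has_laplacian (v t) (- u t x) x \<and>
             (\<exists>D L. has_divergence
                      (\<lambda>y. (\<epsilon> + max (u t y) 0) powr \<alpha> *\<^sub>R newton_grad (u t) y) D x \<and>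
                    has_laplacian (u t) L x \<and>
                    ((\<lambda>s. u s x) has_real_derivative (D + \<epsilon> * L)) (at t))))"

definition classical_solution ::
    "real \<Rightarrow> real \<Rightarrow> ('a::euclidean_space \<Rightarrow> real) \<Rightarrow> (real \<Rightarrow> 'a \<Rightarrow> real) \<Rightarrow> bool" where
  "classical_solution \<alpha> \<epsilon> u\<^sub>0 u \<longleftrightarrow>
     continuous_on ({0..} \<times> UNIV) (\<lambda>(t, x). u t x) \<and>
     (\<forall>T. bounded ((\<lambda>(t, x). u t x) ` ({0..T} \<times> UNIV))) \<and>
     continuous_in_L1 u \<and> C1_in_time u \<and> C2_in_space u \<and>
     regularised_equation \<alpha> \<epsilon> u \<and>
     (\<forall>t>0. (u t \<longlongrightarrow> 0) at_infinity) \<and>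
     (\<forall>x. u 0 x = u\<^sub>0 x)"

subsection \<open>Viscosity solutions of the mass problem\<close>

abbreviation quadrant :: "(real \<times> real) set" where
  "quadrant \<equiv> {0..} \<times> {0..}"

abbreviation open_quadrant :: "(real \<times> real) set" where
  "open_quadrant \<equiv> {0<..} \<times> {0<..}"

text \<open>These are used only at interior points of the quadrant, so the values of \<open>f\<close>
  outside the quadrant play no role.\<close>

definition subdifferential :: "(real \<times> real \<Rightarrow> real) \<Rightarrow> real \<times> real \<Rightarrow> (real \<times> real) set" where
  "subdifferential f X =
     {p. Liminf (at X) (\<lambda>Y. ereal ((f Y - f X - p \<bullet> (Y - X)) / norm (Y - X))) \<ge> 0}"

definition superdifferential :: "(real \<times> real \<Rightarrow> real) \<Rightarrow> real \<times> real \<Rightarrow> (real \<times> real) set" where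
  "superdifferential f X =
     {p. Limsup (at X) (\<lambda>Y. ereal ((f Y - f X - p \<bullet> (Y - X)) / norm (Y - X))) \<le> 0}"

definition viscosity_subsolution ::
    "real \<Rightarrow> (real \<Rightarrow> real) \<Rightarrow> (real \<times> real \<Rightarrow> real) \<Rightarrow> bool" where
  "viscosity_subsolution \<alpha> m\<^sub>0 m \<longleftrightarrow>
     continuous_on quadrant m \<and>
     (\<forall>X\<in>open_quadrant. \<forall>(p\<^sub>1, p\<^sub>2)\<in>superdifferential m X.
        p\<^sub>1 + max p\<^sub>2 0 powr \<alpha> * m X \<le> 0) \<and>
     (\<forall>\<rho>\<ge>0. m (0, \<rho>) \<le> m\<^sub>0 \<rho>) \<and>
     (\<forall>t\<ge>0. m (t, 0) \<le> 0)"

definition viscosity_supersolution ::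
    "real \<Rightarrow> (real \<Rightarrow> real) \<Rightarrow> (real \<times> real \<Rightarrow> real) \<Rightarrow> bool" where
  "viscosity_supersolution \<alpha> m\<^sub>0 m \<longleftrightarrow>
     continuous_on quadrant m \<and>
     (\<forall>X\<in>open_quadrant. \<forall>(p\<^sub>1, p\<^sub>2)\<in>subdifferential m X.
        p\<^sub>1 + max p\<^sub>2 0 powr \<alpha> * m X \<ge> 0) \<and>
     (\<forall>\<rho>\<ge>0. m (0, \<rho>) \<ge> m\<^sub>0 \<rho>) \<and>
     (\<forall>t\<ge>0. m (t, 0) \<ge> 0)"

definition viscosity_solution ::
    "real \<Rightarrow> (real \<Rightarrow> real) \<Rightarrow> (real \<times> real \<Rightarrow> real) \<Rightarrow> bool" where
  "viscosity_solution \<alpha> m\<^sub>0 m \<longleftrightarrow>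
     viscosity_subsolution \<alpha> m\<^sub>0 m \<and> viscosity_supersolution \<alpha> m\<^sub>0 m"

definition BUC_viscosity_solution ::
    "real \<Rightarrow> (real \<Rightarrow> real) \<Rightarrow> (real \<times> real \<Rightarrow> real) \<Rightarrow> bool" where
  "BUC_viscosity_solution \<alpha> m\<^sub>0 m \<longleftrightarrow>
     viscosity_solution \<alpha> m\<^sub>0 m \<and> bounded (m ` quadrant) \<and> uniformly_continuous_on quadrant m"

end

theory Submission
  imports Defs
begin

text \<open>
  In the volume variable the mass \<open>m\<close> of a radial solution satisfies \<open>m\<^sub>\<rho> = u\<close> and
  \<open>m\<^sub>t + (\<epsilon> + (m\<^sub>\<rho>)\<^sub>+)\<^sup>\<alpha> m = \<epsilon> a(\<rho>) m\<^sub>\<rho>\<^sub>\<rho>\<close>, where \<open>a(\<rho>)\<close> is the square of the area of the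
  sphere bounding the ball of volume \<open>\<rho>\<close>. Since the zeroth order term is monotone in \<open>m\<close>, the maximum
  principle applied to \<open>m(t,r) - m(t,q) - L (r - q)\<^sub>+\<close> shows that \<open>m\<close> is nondecreasing and
  \<open>L\<close>-Lipschitz in \<open>\<rho>\<close> with \<open>L = sup u\<^sub>0\<close>, uniformly in \<open>\<epsilon>\<close>. Penalising with
  \<open>(r - q)\<^sup>2 / (2 \<theta>)\<close> instead, one compares a viscosity sub- or supersolution with a classical
  solution for a small parameter \<open>\<epsilon>\<close>, the second order terms contributing only \<open>O(\<epsilon> / \<theta>)\<close>. As one of
  the two functions is differentiable in time, the time variable need not be doubled, and two classical
  solutions need no theorem on sums. This one comparison gives the Cauchy property as \<open>\<epsilon> \<rightarrow> 0\<close>, the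
  Lipschitz bound in time and the uniqueness of the limit.
\<close>


subsection \<open>Doubling of the volume variable\<close>

text \<open>The map \<open>q \<mapsto> max q 0 powr \<alpha>\<close> has infinite slope at 0.
  Subadditivity of \<open>x powr \<alpha>\<close> is the substitute for a Lipschitz bound: slopes
  that differ by 2 \<beta> cost at most a multiple of (2 \<beta>)^\<alpha>, which the time penalty b
  / (T - t) pays for. At a maximum the two zeroth order terms combine, up to this cost, to a
  nonnegative coefficient times w1 + w2 > 0; this is how monotonicity enters. The coefficient a is
  unbounded for d \<ge> 2, so \<epsilon> a is small only on bounded sets of volumes. Hence the order
  of the constants: the accuracy e and the penalty width \<theta>, next \<beta>, which bounds the
  volumes where a maximum can sit, and last the threshold \<delta> for \<epsilon>. On the boundary a
  comparison of two masses needs L |r - q| \<le> e + (r - q)^2 / (2 \<theta>), a case of Young's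
  inequality, so the Lipschitz bound uniform in \<epsilon> must precede it. Uniqueness, too,
  compares a viscosity solution with regularised masses; two viscosity solutions are never compared
  with each other.\<close>

lemma abs_powr_diff_le:
  fixes x y \<alpha> :: real
  assumes "0 \<le> x" "0 \<le> y" "0 < \<alpha>" "\<alpha> \<le> 1"
  shows "\<bar>x powr \<alpha> - y powr \<alpha>\<bar> \<le> \<bar>x - y\<bar> powr \<alpha>"
proof -
  have *: "y powr \<alpha> \<le> x powr \<alpha> + (y - x) powr \<alpha>" if "0 \<le> x" "x \<le> y" for x y :: real
  proof (cases "y = 0")
    case False
    then have y: "y > 0" using that by simp
    \<comment> \<open>On [0, 1] a power with exponent at most 1 dominates the identity, and x / y
      and (y - x) / y add up to 1.\<close>
    have ge: "w / y \<le> (w / y) powr \<alpha>" if "0 \<le> w" "w \<le> y" for w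
      using powr_mono'[of \<alpha> 1 "w / y"] assms that y by simp
    have "1 = x / y + (y - x) / y" using y by (simp add: field_simps)
    also have "\<dots> \<le> (x / y) powr \<alpha> + ((y - x) / y) powr \<alpha>"
      using ge[of x] ge[of "y - x"] that by simp
    finally show ?thesis
      using y by (simp add: powr_divide add_divide_distrib[symmetric] le_divide_eq)
  qed (use that in simp)
  show ?thesis
  proof (cases "x \<le> y")
    case True
    then have "x powr \<alpha> \<le> y powr \<alpha>" using assms by (intro powr_mono2) auto
    then show ?thesis using *[of x y] assms True by (simp add: abs_minus_commute)
  next
    case False
    then have "y powr \<alpha> \<le> x powr \<alpha>" using assms by (intro powr_mono2) auto
    then show ?thesis using *[of y x] assms False by (simp add: abs_minus_commute)
  qed
qed

text \<open>The second derivative exists at the single point x only, so Taylor expansion is replaced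
  by the mean value theorem: \<open>A > 0\<close> would make \<open>k'\<close> positive just to the
  right of x, and \<open>k\<close> would exceed its maximum there.\<close>

lemma second_derivative_test:
  fixes k k' :: "real \<Rightarrow> real"
  assumes k: "\<forall>\<^sub>F r in nhds x. (k has_real_derivative k' r) (at r)"
    and k': "(k' has_real_derivative A) (at x)"
    and mx: "\<forall>\<^sub>F r in nhds x. k r \<le> k x"
  shows "k' x = 0" and "A \<le> 0"
proof -
  obtain d where d: "d > 0" "\<And>r. \<bar>r - x\<bar> < d \<Longrightarrow> (k has_real_derivative k' r) (at r) \<and> k r \<le> k x"
    using eventually_conj[OF k mx] by (auto simp: eventually_nhds_metric dist_real_def)
  show z: "k' x = 0"
    using d by (intro DERIV_local_max[of k "k' x" x d]) (auto simp: abs_minus_commute)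
  show "A \<le> 0"
  proof (rule ccontr)
    assume "\<not> A \<le> 0"
    then obtain d' where d': "d' > 0" "\<And>h. h > 0 \<Longrightarrow> h < d' \<Longrightarrow> k' x < k' (x + h)"
      using DERIV_pos_inc_right[OF k'] by force
    define h where "h = min d d' / 2"
    have h: "h > 0" "h < d" "h < d'" using d(1) d'(1) by (auto simp: h_def min_def)
    have "\<exists>z. x < z \<and> z < x + h \<and> k (x + h) - k x = (x + h - x) * k' z"
      using d(2) h by (intro MVT2) auto
    then obtain z where z': "x < z" "z < x + h" "k (x + h) - k x = h * k' z" by auto
    have "k' x < k' (x + (z - x))" by (rule d'(2)) (use z' h in linarith)+
    then have "h * k' z > 0" using z h(1) by simp
    then have "k (x + h) > k x" using z'(3) by linarith
    then show False using d(2)[of "x + h"] h by auto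
  qed
qed

text \<open>Subsolutions of \<open>w\<^sub>t + H(w\<^sub>\<rho>) w = \<epsilon> a(\<rho>) w\<^sub>\<rho>\<^sub>\<rho>\<close>. That \<open>m\<close> is a supersolution is expressed by
  \<open>- m\<close> being a subsolution for \<open>q \<mapsto> H(- q)\<close>. In \<open>viscosity_sub\<close> the test functions are separated,
  \<open>f(t) + g(\<rho>)\<close>, so that \<open>f\<close> may be the other solution at a fixed volume.\<close>

definition classical_sub :: "(real \<Rightarrow> real) \<Rightarrow> real \<Rightarrow> (real \<Rightarrow> real) \<Rightarrow> (real \<Rightarrow> real \<Rightarrow> real) \<Rightarrow> bool" where
  "classical_sub a \<epsilon> H w \<longleftrightarrow> (\<forall>t>0. \<forall>\<rho>>0. \<exists>p g A.
     ((\<lambda>s. w s \<rho>) has_real_derivative p) (at t) \<and>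
     (\<forall>\<^sub>F r in nhds \<rho>. (w t has_real_derivative g r) (at r)) \<and>
     (g has_real_derivative A) (at \<rho>) \<and>
     p + H (g \<rho>) * w t \<rho> \<le> \<epsilon> * a \<rho> * A)"

definition viscosity_sub :: "(real \<Rightarrow> real) \<Rightarrow> real \<Rightarrow> (real \<Rightarrow> real) \<Rightarrow> (real \<Rightarrow> real \<Rightarrow> real) \<Rightarrow> bool" where
  "viscosity_sub a \<epsilon> H w \<longleftrightarrow> (\<forall>t>0. \<forall>\<rho>>0. \<forall>f p g g' A.
     (f has_real_derivative p) (at t) \<longrightarrow>
     (\<forall>\<^sub>F r in nhds \<rho>. (g has_real_derivative g' r) (at r)) \<longrightarrow>
     (g' has_real_derivative A) (at \<rho>) \<longrightarrow>
     (\<forall>\<^sub>F (s, r) in nhds (t, \<rho>). w s r - f s - g r \<le> w t \<rho> - f t - g \<rho>) \<longrightarrow>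
     p + H (g' \<rho>) * w t \<rho> \<le> \<epsilon> * a \<rho> * A)"

text \<open>At a maximum of w - f - g the first derivatives agree in each variable separately and
  the second derivative of w is at most that of g; nonnegativity of \<epsilon> a turns this into an
  inequality of the diffusion terms.\<close>

lemma classical_sub_imp_viscosity_sub:
  assumes c: "classical_sub a \<epsilon> H w" and nn: "\<epsilon> \<ge> 0" "\<And>r. r > 0 \<Longrightarrow> a r \<ge> 0"
  shows "viscosity_sub a \<epsilon> H w"
  unfolding viscosity_sub_def
proof (intro allI impI)
  fix t \<rho> :: real and f p g g' A
  assume t: "t > 0" "\<rho> > 0" and f: "(f has_real_derivative p) (at t)"
    and g: "\<forall>\<^sub>F r in nhds \<rho>. (g has_real_derivative g' r) (at r)"
      "(g' has_real_derivative A) (at \<rho>)"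
    and mx: "\<forall>\<^sub>F (s, r) in nhds (t, \<rho>). w s r - f s - g r \<le> w t \<rho> - f t - g \<rho>"
  obtain p' h B where h: "((\<lambda>s. w s \<rho>) has_real_derivative p') (at t)"
     "\<forall>\<^sub>F r in nhds \<rho>. (w t has_real_derivative h r) (at r)"
     "(h has_real_derivative B) (at \<rho>)" "p' + H (h \<rho>) * w t \<rho> \<le> \<epsilon> * a \<rho> * B"
    using c t unfolding classical_sub_def by meson
  obtain P Q where PQ: "eventually P (nhds t)" "eventually Q (nhds \<rho>)"
      "\<And>s r. P s \<Longrightarrow> Q r \<Longrightarrow> w s r - f s - g r \<le> w t \<rho> - f t - g \<rho>"
    using mx unfolding nhds_prod eventually_prod_filter by auto
  note at = eventually_nhds_x_imp_x[OF PQ(1)] eventually_nhds_x_imp_x[OF PQ(2)]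
  have 1: "\<forall>\<^sub>F s in nhds t. w s \<rho> - f s \<le> w t \<rho> - f t"
    using PQ(1) by eventually_elim (use PQ(3)[of _ \<rho>] at in force)
  obtain d where d: "d > 0" "\<And>s. \<bar>t - s\<bar> < d \<Longrightarrow> w s \<rho> - f s \<le> w t \<rho> - f t"
    using 1 by (auto simp: eventually_nhds_metric dist_real_def abs_minus_commute)
  have "p' - p = 0"
    by (rule DERIV_local_max[where f = "\<lambda>s. w s \<rho> - f s" and d = d and x = t])
       (use d h(1) f in \<open>auto intro!: derivative_eq_intros\<close>)
  moreover have "\<forall>\<^sub>F r in nhds \<rho>. w t r - g r \<le> w t \<rho> - g \<rho>"
    using PQ(2) by eventually_elim (use PQ(3)[of t] at in force)
  moreover have "\<forall>\<^sub>F r in nhds \<rho>. ((\<lambda>r. w t r - g r) has_real_derivative (h r - g' r)) (at r)"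
    using h(2) g(1) by eventually_elim (auto intro!: derivative_eq_intros)
  moreover have "((\<lambda>r. h r - g' r) has_real_derivative (B - A)) (at \<rho>)"
    using h(3) g(2) by (auto intro!: derivative_eq_intros)
  ultimately have "h \<rho> = g' \<rho>" "B - A \<le> 0" "p' = p"
    using second_derivative_test[of "\<lambda>r. w t r - g r" "\<lambda>r. h r - g' r" \<rho> "B - A"] by auto
  moreover have "\<epsilon> * a \<rho> * B \<le> \<epsilon> * a \<rho> * A"
    using nn t calculation by (intro mult_left_mono mult_nonneg_nonneg) auto
  ultimately show "p + H (g' \<rho>) * w t \<rho> \<le> \<epsilon> * a \<rho> * A"
    using h(4) by simp
qed

text \<open>With the second volume frozen at \<sigma>, the function
  \<open>\<xi> s - w\<^sub>2 s \<sigma>\<close> is an admissible test function in time for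
  \<open>w\<^sub>1\<close>, because \<open>w\<^sub>2\<close> is classical. With time and the first
  volume frozen, the derivative test applies to \<open>w\<^sub>2\<close> at \<sigma>. The time
  derivative of \<open>w\<^sub>2\<close> cancels when the two inequalities are added.\<close>

lemma doubling_inequality:
  fixes w\<^sub>1 w\<^sub>2 :: "real \<Rightarrow> real \<Rightarrow> real" and \<Psi> :: "real \<Rightarrow> real \<Rightarrow> real"
  assumes v: "viscosity_sub a \<epsilon>\<^sub>1 H\<^sub>1 w\<^sub>1" and c: "classical_sub a \<epsilon>\<^sub>2 H\<^sub>2 w\<^sub>2"
    and nn: "\<epsilon>\<^sub>2 \<ge> 0" "a \<sigma> \<ge> 0"
    and pos: "0 < t" "t < T" "0 < \<rho>" "0 < \<sigma>"
    and \<xi>: "(\<xi> has_real_derivative x) (at t)"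
    and P: "\<forall>\<^sub>F r in nhds \<rho>. ((\<lambda>r. \<Psi> r \<sigma>) has_real_derivative P r) (at r)"
      "(P has_real_derivative A) (at \<rho>)"
    and Q: "\<forall>\<^sub>F r in nhds \<sigma>. (\<Psi> \<rho> has_real_derivative Q r) (at r)"
      "(Q has_real_derivative B) (at \<sigma>)"
    and mx: "\<And>s r q. s \<in> {0..<T} \<Longrightarrow> 0 \<le> r \<Longrightarrow> 0 \<le> q \<Longrightarrow>
       w\<^sub>1 s r + w\<^sub>2 s q - \<Psi> r q - \<xi> s \<le> w\<^sub>1 t \<rho> + w\<^sub>2 t \<sigma> - \<Psi> \<rho> \<sigma> - \<xi> t"
  shows "x + H\<^sub>1 (P \<rho>) * w\<^sub>1 t \<rho> + H\<^sub>2 (Q \<sigma>) * w\<^sub>2 t \<sigma> \<le> \<epsilon>\<^sub>1 * a \<rho> * A + \<epsilon>\<^sub>2 * a \<sigma> * B"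
proof -
  obtain p h C where h: "((\<lambda>s. w\<^sub>2 s \<sigma>) has_real_derivative p) (at t)"
     "\<forall>\<^sub>F r in nhds \<sigma>. (w\<^sub>2 t has_real_derivative h r) (at r)"
     "(h has_real_derivative C) (at \<sigma>)" "p + H\<^sub>2 (h \<sigma>) * w\<^sub>2 t \<sigma> \<le> \<epsilon>\<^sub>2 * a \<sigma> * C"
    using c pos unfolding classical_sub_def by meson
  have ev_t: "\<forall>\<^sub>F s in nhds t. s \<in> {0<..<T}" and ev_r: "\<forall>\<^sub>F r in nhds \<rho>. r \<in> {0<..}"
    and ev_q: "\<forall>\<^sub>F r in nhds \<sigma>. r \<in> {0<..}"
    using eventually_nhds_in_open[of "{0<..<T}" t] eventually_nhds_in_open[of "{0<..}" \<rho>]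
      eventually_nhds_in_open[of "{0<..}" \<sigma>] pos by auto
  have "\<forall>\<^sub>F (s, r) in nhds (t, \<rho>). s \<in> {0<..<T} \<and> r \<in> {0<..}"
    unfolding nhds_prod eventually_prod_filter using ev_t ev_r by blast
  then have "\<forall>\<^sub>F (s, r) in nhds (t, \<rho>). w\<^sub>1 s r - (\<xi> s - w\<^sub>2 s \<sigma>) - \<Psi> r \<sigma>
      \<le> w\<^sub>1 t \<rho> - (\<xi> t - w\<^sub>2 t \<sigma>) - \<Psi> \<rho> \<sigma>"
    by eventually_elim (use mx[of _ _ \<sigma>] pos in \<open>force simp: algebra_simps\<close>)
  moreover have "((\<lambda>s. \<xi> s - w\<^sub>2 s \<sigma>) has_real_derivative (x - p)) (at t)"
    using \<xi> h(1) by (auto intro!: derivative_eq_intros)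
  ultimately have 1: "x - p + H\<^sub>1 (P \<rho>) * w\<^sub>1 t \<rho> \<le> \<epsilon>\<^sub>1 * a \<rho> * A"
    using v[unfolded viscosity_sub_def, rule_format, OF pos(1) pos(3) _ P, of "\<lambda>s. \<xi> s - w\<^sub>2 s \<sigma>" "x - p"]
    by blast
  have "\<forall>\<^sub>F r in nhds \<sigma>. w\<^sub>2 t r - \<Psi> \<rho> r \<le> w\<^sub>2 t \<sigma> - \<Psi> \<rho> \<sigma>"
    using ev_q by eventually_elim (use mx[of t \<rho>] pos in force)
  moreover have "\<forall>\<^sub>F r in nhds \<sigma>. ((\<lambda>r. w\<^sub>2 t r - \<Psi> \<rho> r) has_real_derivative (h r - Q r)) (at r)"
    using h(2) Q(1) by eventually_elim (auto intro!: derivative_eq_intros)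
  moreover have "((\<lambda>r. h r - Q r) has_real_derivative (C - B)) (at \<sigma>)"
    using h(3) Q(2) by (auto intro!: derivative_eq_intros)
  ultimately have "h \<sigma> = Q \<sigma>" "C - B \<le> 0"
    using second_derivative_test[of "\<lambda>r. w\<^sub>2 t r - \<Psi> \<rho> r" "\<lambda>r. h r - Q r" \<sigma> "C - B"] by auto
  moreover have "\<epsilon>\<^sub>2 * a \<sigma> * C \<le> \<epsilon>\<^sub>2 * a \<sigma> * B"
    using nn calculation by (intro mult_left_mono mult_nonneg_nonneg) auto
  ultimately show ?thesis using h(4) 1 by simp
qed

text \<open>Where the penalised sum is positive, the bound 2 N on the two functions dominates each
  penalty, so time and both volumes lie in a compact box. The sum is positive at the given point,
  hence its maximum over the box is global.\<close>

lemma penalised_max_exists: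
  fixes w\<^sub>1 w\<^sub>2 :: "real \<Rightarrow> real \<Rightarrow> real" and \<Psi> :: "real \<Rightarrow> real \<Rightarrow> real"
  assumes c1: "continuous_on quadrant (\<lambda>(t, r). w\<^sub>1 t r)"
    and c2: "continuous_on quadrant (\<lambda>(t, r). w\<^sub>2 t r)"
    and c3: "continuous_on quadrant (\<lambda>(r, q). \<Psi> r q)"
    and bd: "\<forall>t\<in>{0..<T}. \<forall>r\<ge>0. w\<^sub>1 t r \<le> N"
      "\<forall>t\<in>{0..<T}. \<forall>r\<ge>0. w\<^sub>2 t r \<le> N" and N: "N > 0"
    and \<Psi>: "\<forall>r\<ge>0. \<forall>q\<ge>0. \<beta> * (r + q) \<le> \<Psi> r q"
    and pos: "c > 0" "\<beta> > 0"
    and pt: "t\<^sub>0 \<in> {0..<T}" "r\<^sub>0 \<ge> 0" "q\<^sub>0 \<ge> 0" "w\<^sub>1 t\<^sub>0 r\<^sub>0 + w\<^sub>2 t\<^sub>0 q\<^sub>0 > \<Psi> r\<^sub>0 q\<^sub>0 + c / (T - t\<^sub>0)"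
  shows "\<exists>t\<in>{0..<T}. \<exists>r\<ge>0. \<exists>q\<ge>0. r \<le> 2 * N / \<beta> \<and> q \<le> 2 * N / \<beta> \<and>
    w\<^sub>1 t r + w\<^sub>2 t q > \<Psi> r q + c / (T - t) \<and>
    (\<forall>s\<in>{0..<T}. \<forall>r'\<ge>0. \<forall>q'\<ge>0.
       w\<^sub>1 s r' + w\<^sub>2 s q' - \<Psi> r' q' - c / (T - s) \<le> w\<^sub>1 t r + w\<^sub>2 t q - \<Psi> r q - c / (T - t))"
proof -
  define W where "W = (\<lambda>(s, r, q). w\<^sub>1 s r + w\<^sub>2 s q - \<Psi> r q - c / (T - s))"
  define R where "R = 2 * N / \<beta>"
  \<comment> \<open>The time at which the penalty c / (T - s) reaches the bound 2 N of the
    sum.\<close>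
  define \<tau> where "\<tau> = T - c / (2 * N)"
  have \<tau>: "\<tau> < T" using pos N by (simp add: \<tau>_def)
  define K where "K = {0..\<tau>} \<times> {0..R} \<times> {0..R}"
  have "compact K" unfolding K_def by (intro compact_Times compact_Icc)
  have out: "s \<le> \<tau> \<and> r \<le> R \<and> q \<le> R" if "W (s, r, q) > 0" "s \<in> {0..<T}" "0 \<le> r" "0 \<le> q" for s r q
  proof -
    have T: "T - s > 0" using that by simp
    have "c / (T - s) > 0" using pos T by simp
    have "w\<^sub>1 s r \<le> N" "w\<^sub>2 s q \<le> N" using bd that by blast+
    then have *: "w\<^sub>1 s r + w\<^sub>2 s q \<le> 2 * N" by linarith
    have "0 \<le> \<beta> * (r + q)" using pos that by simp
    then have "c / (T - s) \<le> 2 * N"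
      using that(1) * \<Psi>[rule_format, OF that(3,4)] by (simp add: W_def)
    then have "s \<le> \<tau>"
      using N T by (simp add: \<tau>_def field_simps)
    moreover have "\<beta> * (r + q) \<le> 2 * N"
      using that(1) * \<Psi>[rule_format, OF that(3,4)] \<open>c / (T - s) > 0\<close> by (simp add: W_def)
    then have "r + q \<le> R" using pos by (simp add: R_def field_simps)
    ultimately show ?thesis using that by auto
  qed
  have cW: "continuous_on K W"
    unfolding W_def case_prod_beta
  proof (intro continuous_intros)
    show "continuous_on K (\<lambda>x. w\<^sub>1 (fst x) (fst (snd x)))"
      by (rule continuous_on_compose2[OF c1, of K "\<lambda>x. (fst x, fst (snd x))", simplified])
         (auto simp: K_def intro!: continuous_intros)
    show "continuous_on K (\<lambda>x. w\<^sub>2 (fst x) (snd (snd x)))"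
      by (rule continuous_on_compose2[OF c2, of K "\<lambda>x. (fst x, snd (snd x))", simplified])
         (auto simp: K_def intro!: continuous_intros)
    show "continuous_on K (\<lambda>x. \<Psi> (fst (snd x)) (snd (snd x)))"
      by (rule continuous_on_compose2[OF c3, of K "\<lambda>x. snd x", simplified case_prod_beta])
         (auto simp: K_def intro!: continuous_intros)
  qed (use \<tau> in \<open>auto simp: K_def\<close>)
  have W0: "W (t\<^sub>0, r\<^sub>0, q\<^sub>0) > 0" using pt by (simp add: W_def)
  have in0: "(t\<^sub>0, r\<^sub>0, q\<^sub>0) \<in> K" using out[OF W0 pt(1-3)] pt by (auto simp: K_def)
  obtain z where z: "z \<in> K" "\<And>y. y \<in> K \<Longrightarrow> W y \<le> W z"
    using continuous_attains_sup[OF \<open>compact K\<close> _ cW] in0 by blast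
  obtain t r q where zz: "z = (t, r, q)" by (cases z)
  have Wz: "W (t, r, q) > 0" using z(2)[OF in0] W0 zz by simp
  have glob: "W (s, r', q') \<le> W (t, r, q)" if "s \<in> {0..<T}" "0 \<le> r'" "0 \<le> q'" for s r' q'
  proof (cases "W (s, r', q') > 0")
    case True
    then have "(s, r', q') \<in> K" using out[OF True that] that by (auto simp: K_def)
    then show ?thesis using z(2) zz by simp
  next
    case False
    then show ?thesis using Wz by simp
  qed
  have "t \<in> {0..<T}" "0 \<le> r" "0 \<le> q" "r \<le> 2 * N / \<beta>" "q \<le> 2 * N / \<beta>"
    "w\<^sub>1 t r + w\<^sub>2 t q > \<Psi> r q + c / (T - t)"
    using z(1) zz \<tau> Wz by (auto simp: K_def W_def R_def)
  moreover have "\<forall>s\<in>{0..<T}. \<forall>r'\<ge>0. \<forall>q'\<ge>0.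
       w\<^sub>1 s r' + w\<^sub>2 s q' - \<Psi> r' q' - c / (T - s) \<le> w\<^sub>1 t r + w\<^sub>2 t q - \<Psi> r q - c / (T - t)"
    using glob by (simp add: W_def)
  ultimately show ?thesis by blast
qed

text \<open>The sign \<open>k = 1\<close> belongs to \<open>m\<close>, the sign \<open>k = - 1\<close> to \<open>- m\<close>.\<close>

definition hamiltonian :: "real \<Rightarrow> real \<Rightarrow> real \<Rightarrow> real \<Rightarrow> real" where
  "hamiltonian \<alpha> \<epsilon> k q = (\<epsilon> + max (k * q) 0) powr \<alpha>"

lemma hamiltonian_nonneg [simp]: "0 \<le> hamiltonian \<alpha> \<epsilon> k q"
  by (simp add: hamiltonian_def)

text \<open>The positive part is 1-Lipschitz, so only the Holder modulus of the power remains. The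
  two regularisation parameters enter that modulus because the compared Hamiltonians may differ in
  them.\<close>

lemma hamiltonian_diff_le:
  assumes "0 < \<alpha>" "\<alpha> \<le> 1" "0 \<le> \<epsilon>\<^sub>1" "0 \<le> \<epsilon>\<^sub>2" "\<bar>k\<bar> \<le> 1"
  shows "\<bar>hamiltonian \<alpha> \<epsilon>\<^sub>1 k x - hamiltonian \<alpha> \<epsilon>\<^sub>2 k y\<bar> \<le> (\<epsilon>\<^sub>1 + \<epsilon>\<^sub>2 + \<bar>x - y\<bar>) powr \<alpha>"
proof -
  have "\<bar>max (k * x) 0 - max (k * y) 0\<bar> \<le> \<bar>k * x - k * y\<bar>" by linarith
  also have "\<dots> = \<bar>k\<bar> * \<bar>x - y\<bar>" by (simp add: abs_mult right_diff_distrib[symmetric])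
  also have "\<dots> \<le> \<bar>x - y\<bar>" using assms mult_right_mono[of "\<bar>k\<bar>" 1 "\<bar>x - y\<bar>"] by simp
  finally have "\<bar>(\<epsilon>\<^sub>1 + max (k * x) 0) - (\<epsilon>\<^sub>2 + max (k * y) 0)\<bar> \<le> \<epsilon>\<^sub>1 + \<epsilon>\<^sub>2 + \<bar>x - y\<bar>"
    using assms by linarith
  then have "\<bar>(\<epsilon>\<^sub>1 + max (k * x) 0) - (\<epsilon>\<^sub>2 + max (k * y) 0)\<bar> powr \<alpha> \<le> (\<epsilon>\<^sub>1 + \<epsilon>\<^sub>2 + \<bar>x - y\<bar>) powr \<alpha>"
    using assms by (intro powr_mono2) auto
  then show ?thesis
    unfolding hamiltonian_def
    using abs_powr_diff_le[of "\<epsilon>\<^sub>1 + max (k * x) 0" "\<epsilon>\<^sub>2 + max (k * y) 0" \<alpha>] assms by linarith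
qed

lemma hamiltonian_minus: "hamiltonian \<alpha> \<epsilon> (- k) (- q) = hamiltonian \<alpha> \<epsilon> k q"
  by (simp add: hamiltonian_def)

lemma ex_small_powr:
  fixes N \<eta> b \<alpha> :: real
  assumes "0 < \<alpha>" "0 \<le> N" "0 < \<eta>" "0 < b"
  shows "\<exists>s>0. s \<le> b \<and> N * s powr \<alpha> < \<eta>"
proof -
  \<comment> \<open>Dividing by N + 1 instead of N gives a strict inequality and covers N =
    0.\<close>
  define s where "s = min b ((\<eta> / (N + 1)) powr (1 / \<alpha>))"
  have s: "s > 0" "s \<le> b" using assms by (auto simp: s_def)
  have "s powr \<alpha> \<le> ((\<eta> / (N + 1)) powr (1 / \<alpha>)) powr \<alpha>"
    using assms s by (intro powr_mono2) (auto simp: s_def)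
  also have "\<dots> = \<eta> / (N + 1)" using assms by (simp add: powr_powr)
  finally have "N * s powr \<alpha> \<le> N * (\<eta> / (N + 1))" using assms by (intro mult_left_mono) auto
  also have "\<dots> < \<eta>" using assms by (simp add: field_simps)
  finally show ?thesis using s by blast
qed

text \<open>The term \<open>\<beta> (r + q)\<close> confines the maximum to \<open>r, q \<le> 2 N / \<beta>\<close>, where \<open>a\<close> is bounded, and
  has no second derivatives; \<open>b / (T - t)\<close> keeps the maximum away from the final time.\<close>

lemma comparison_pointwise:
  fixes w\<^sub>1 w\<^sub>2 :: "real \<Rightarrow> real \<Rightarrow> real"
  assumes \<alpha>: "0 < \<alpha>" "\<alpha> \<le> 1" and \<epsilon>: "0 \<le> \<epsilon>\<^sub>1" "0 \<le> \<epsilon>\<^sub>2" and k: "\<bar>k\<bar> \<le> 1"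
    and v: "viscosity_sub a \<epsilon>\<^sub>1 (hamiltonian \<alpha> \<epsilon>\<^sub>1 k) w\<^sub>1" and c: "classical_sub a \<epsilon>\<^sub>2 (hamiltonian \<alpha> \<epsilon>\<^sub>2 (- k)) w\<^sub>2"
    and a: "\<And>r. 0 < r \<Longrightarrow> 0 \<le> a r" "\<And>r. 0 < r \<Longrightarrow> r \<le> 2 * N / \<beta> \<Longrightarrow> a r \<le> K"
    and cont: "continuous_on quadrant (\<lambda>(t, r). w\<^sub>1 t r)" "continuous_on quadrant (\<lambda>(t, r). w\<^sub>2 t r)"
    and bd: "\<And>t r. t \<in> {0..<T} \<Longrightarrow> 0 \<le> r \<Longrightarrow> \<bar>w\<^sub>1 t r\<bar> \<le> N"
      "\<And>t r. t \<in> {0..<T} \<Longrightarrow> 0 \<le> r \<Longrightarrow> \<bar>w\<^sub>2 t r\<bar> \<le> N" and N: "N > 0"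
    and bdry: "\<And>t r q. t \<in> {0..<T} \<Longrightarrow> 0 \<le> r \<Longrightarrow> 0 \<le> q \<Longrightarrow> t = 0 \<or> r = 0 \<or> q = 0 \<Longrightarrow>
      w\<^sub>1 t r + w\<^sub>2 t q \<le> e + (r - q)\<^sup>2 / (2 * \<theta>)"
    and pos: "e \<ge> 0" "\<theta> > 0" "\<beta> > 0" "b > 0"
    and small: "N * (\<epsilon>\<^sub>1 + \<epsilon>\<^sub>2 + 2 * \<beta>) powr \<alpha> + (\<epsilon>\<^sub>1 + \<epsilon>\<^sub>2) * (K / \<theta>) < b / T\<^sup>2"
    and pt: "t\<^sub>0 \<in> {0..<T}" "0 \<le> r\<^sub>0" "0 \<le> q\<^sub>0"
  shows "w\<^sub>1 t\<^sub>0 r\<^sub>0 + w\<^sub>2 t\<^sub>0 q\<^sub>0 \<le> e + (r\<^sub>0 - q\<^sub>0)\<^sup>2 / (2 * \<theta>) + \<beta> * (r\<^sub>0 + q\<^sub>0) + b / (T - t\<^sub>0)"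
proof (rule ccontr)
  define \<Psi> where "\<Psi> = (\<lambda>r q. e + (r - q)\<^sup>2 / (2 * \<theta>) + \<beta> * (r + q))"
  assume "\<not> ?thesis"
  then have c0: "w\<^sub>1 t\<^sub>0 r\<^sub>0 + w\<^sub>2 t\<^sub>0 q\<^sub>0 > \<Psi> r\<^sub>0 q\<^sub>0 + b / (T - t\<^sub>0)" by (simp add: \<Psi>_def)
  have c\<Psi>: "continuous_on quadrant (\<lambda>(r, q). \<Psi> r q)"
    unfolding \<Psi>_def case_prod_beta using pos by (intro continuous_intros) auto
  have \<Psi>ge: "\<forall>r\<ge>0. \<forall>q\<ge>0. \<beta> * (r + q) \<le> \<Psi> r q" using pos by (simp add: \<Psi>_def)
  have bd': "\<forall>t\<in>{0..<T}. \<forall>r\<ge>0. w\<^sub>1 t r \<le> N" "\<forall>t\<in>{0..<T}. \<forall>r\<ge>0. w\<^sub>2 t r \<le> N"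
    using bd by (meson abs_le_D1)+
  obtain t r q where m: "t \<in> {0..<T}" "r \<ge> 0" "q \<ge> 0" "r \<le> 2 * N / \<beta>" "q \<le> 2 * N / \<beta>"
    "w\<^sub>1 t r + w\<^sub>2 t q > \<Psi> r q + b / (T - t)"
    and mx: "\<And>s r' q'. s \<in> {0..<T} \<Longrightarrow> 0 \<le> r' \<Longrightarrow> 0 \<le> q' \<Longrightarrow>
       w\<^sub>1 s r' + w\<^sub>2 s q' - \<Psi> r' q' - b / (T - s) \<le> w\<^sub>1 t r + w\<^sub>2 t q - \<Psi> r q - b / (T - t)"
    using penalised_max_exists[OF cont c\<Psi> bd' N \<Psi>ge pos(4) pos(3) pt c0] by blast
  have Tt: "T - t > 0" "b / (T - t) > 0" using m pos by auto
  have "\<beta> * (r + q) \<ge> 0" using pos m by simp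
  then have "w\<^sub>1 t r + w\<^sub>2 t q > e + (r - q)\<^sup>2 / (2 * \<theta>)" using m(6) Tt by (simp add: \<Psi>_def)
  \<comment> \<open>The strict inequality just obtained contradicts \<open>bdry\<close> on the
    parabolic boundary, so the maximum is interior.\<close>
  then have tp: "t > 0" "r > 0" "q > 0" using bdry[OF m(1-3)] m(1-3) by force+
  have "0 \<le> (r - q)\<^sup>2 / (2 * \<theta>)" using pos by simp
  then have sum_pos: "w\<^sub>1 t r + w\<^sub>2 t q > 0"
    using \<open>w\<^sub>1 t r + w\<^sub>2 t q > e + (r - q)\<^sup>2 / (2 * \<theta>)\<close> pos by linarith
  \<comment> \<open>The slope of the quadratic part. The confinement term breaks the symmetry: the
    first function is tested with z + \<beta>, the second, after reversing its sign, with z -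
    \<beta>.\<close>
  define z where "z = (r - q) / \<theta>"
  have 1: "((\<lambda>s. b / (T - s)) has_real_derivative b / (T - t)\<^sup>2) (at t)"
    using Tt by (auto intro!: derivative_eq_intros simp: power2_eq_square)
  have 2: "\<forall>\<^sub>F r' in nhds r. ((\<lambda>r. \<Psi> r q) has_real_derivative ((r' - q) / \<theta> + \<beta>)) (at r')"
    unfolding \<Psi>_def using pos by (auto intro!: derivative_eq_intros always_eventually simp: field_simps)
  have 3: "((\<lambda>r'. (r' - q) / \<theta> + \<beta>) has_real_derivative 1 / \<theta>) (at r)"
    using pos by (auto intro!: derivative_eq_intros)
  have 4: "\<forall>\<^sub>F q' in nhds q. (\<Psi> r has_real_derivative ((q' - r) / \<theta> + \<beta>)) (at q')"
    unfolding \<Psi>_def using pos by (auto intro!: derivative_eq_intros always_eventually simp: field_simps)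
  have 5: "((\<lambda>q'. (q' - r) / \<theta> + \<beta>) has_real_derivative 1 / \<theta>) (at q)"
    using pos by (auto intro!: derivative_eq_intros)
  have "b / (T - t)\<^sup>2 + hamiltonian \<alpha> \<epsilon>\<^sub>1 k ((r - q) / \<theta> + \<beta>) * w\<^sub>1 t r
     + hamiltonian \<alpha> \<epsilon>\<^sub>2 (- k) ((q - r) / \<theta> + \<beta>) * w\<^sub>2 t q \<le> \<epsilon>\<^sub>1 * a r * (1 / \<theta>) + \<epsilon>\<^sub>2 * a q * (1 / \<theta>)"
    by (rule doubling_inequality[OF v c \<epsilon>(2) a(1) tp(1) _ tp(2) tp(3) 1 2 3 4 5 mx]) (use tp m in auto)
  moreover have "(q - r) / \<theta> + \<beta> = - (z - \<beta>)" by (simp add: z_def minus_divide_left)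
  ultimately have main: "b / (T - t)\<^sup>2 + hamiltonian \<alpha> \<epsilon>\<^sub>1 k (z + \<beta>) * w\<^sub>1 t r + hamiltonian \<alpha> \<epsilon>\<^sub>2 k (z - \<beta>) * w\<^sub>2 t q
      \<le> \<epsilon>\<^sub>1 * a r * (1 / \<theta>) + \<epsilon>\<^sub>2 * a q * (1 / \<theta>)"
    by (simp add: z_def[symmetric] hamiltonian_minus del: minus_diff_eq)
  let ?h1 = "hamiltonian \<alpha> \<epsilon>\<^sub>1 k (z + \<beta>)" and ?h2 = "hamiltonian \<alpha> \<epsilon>\<^sub>2 k (z - \<beta>)"
  have "\<bar>?h1 - ?h2\<bar> \<le> (\<epsilon>\<^sub>1 + \<epsilon>\<^sub>2 + 2 * \<beta>) powr \<alpha>"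
    using hamiltonian_diff_le[OF \<alpha> \<epsilon> k, of "z + \<beta>" "z - \<beta>"] pos by simp
  then have "\<bar>?h1 - ?h2\<bar> * \<bar>w\<^sub>1 t r\<bar> \<le> (\<epsilon>\<^sub>1 + \<epsilon>\<^sub>2 + 2 * \<beta>) powr \<alpha> * N"
    using bd(1)[OF m(1,2)] by (intro mult_mono) auto
  then have "(?h1 - ?h2) * w\<^sub>1 t r \<ge> - (N * (\<epsilon>\<^sub>1 + \<epsilon>\<^sub>2 + 2 * \<beta>) powr \<alpha>)"
    by (simp add: abs_mult[symmetric] mult.commute)
  \<comment> \<open>With a common coefficient the zeroth order terms add up to a multiple of the
    positive gap; only the difference of the coefficients is an error.\<close>
  moreover have "?h2 * (w\<^sub>1 t r + w\<^sub>2 t q) \<ge> 0" using sum_pos by simp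
  moreover have "?h1 * w\<^sub>1 t r + ?h2 * w\<^sub>2 t q = (?h1 - ?h2) * w\<^sub>1 t r + ?h2 * (w\<^sub>1 t r + w\<^sub>2 t q)"
    by (simp add: algebra_simps)
  moreover have "\<epsilon>\<^sub>1 * a r * (1 / \<theta>) \<le> \<epsilon>\<^sub>1 * K * (1 / \<theta>)" "\<epsilon>\<^sub>2 * a q * (1 / \<theta>) \<le> \<epsilon>\<^sub>2 * K * (1 / \<theta>)"
    using a(2)[of r] a(2)[of q] tp m(4,5) \<epsilon> pos by (auto intro!: mult_right_mono mult_left_mono divide_right_mono)
  \<comment> \<open>The time penalty contributes at least b / T^2, more than all the errors together
    by \<open>small\<close>.\<close>
  moreover have "b / T\<^sup>2 \<le> b / (T - t)\<^sup>2"
    using Tt tp pos by (intro divide_left_mono power_mono) auto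
  ultimately show False using main small by (simp add: algebra_simps add_divide_distrib)
qed

section \<open>Comparison with a threshold for \<epsilon> that serves all pairs of solutions\<close>

text \<open>Bundling these conditions lets the threshold be chosen before the pair of functions. The
  boundary condition relates different volumes r and q, since the doubled maximum may reach the
  boundary off the diagonal.\<close>

definition comparable where
  "comparable \<alpha> a T N \<theta> e k \<epsilon>\<^sub>1 \<epsilon>\<^sub>2 w\<^sub>1 w\<^sub>2 \<longleftrightarrow>
     viscosity_sub a \<epsilon>\<^sub>1 (hamiltonian \<alpha> \<epsilon>\<^sub>1 k) w\<^sub>1 \<and> classical_sub a \<epsilon>\<^sub>2 (hamiltonian \<alpha> \<epsilon>\<^sub>2 (- k)) w\<^sub>2 \<and>
     continuous_on quadrant (\<lambda>(t, r). w\<^sub>1 t r) \<and> continuous_on quadrant (\<lambda>(t, r). w\<^sub>2 t r) \<and>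
     (\<forall>t\<in>{0..<T}. \<forall>r\<ge>0. \<bar>w\<^sub>1 t r\<bar> \<le> N \<and> \<bar>w\<^sub>2 t r\<bar> \<le> N) \<and>
     (\<forall>t\<in>{0..<T}. \<forall>r\<ge>0. \<forall>q\<ge>0. t = 0 \<or> r = 0 \<or> q = 0 \<longrightarrow>
        w\<^sub>1 t r + w\<^sub>2 t q \<le> e + (r - q)\<^sup>2 / (2 * \<theta>))"

text \<open>The three errors e come from the boundary gap, from the confinement term \<beta> (r + r)
  and from the time penalty. The comparison runs up to T + 1 so that the penalty e / (T + 1 - t) is
  at most e up to time T.\<close>

lemma comparison_uniform:
  fixes a :: "real \<Rightarrow> real"
  assumes \<alpha>: "0 < \<alpha>" "\<alpha> \<le> 1" and a: "\<forall>r\<ge>0. \<forall>s\<ge>r. 0 \<le> a r \<and> a r \<le> a s"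
    and pos: "T > 0" "R > 0" "N > 0" "\<theta> > 0" "e > 0"
  shows "\<exists>\<delta>>0. \<forall>k \<epsilon>\<^sub>1 \<epsilon>\<^sub>2 w\<^sub>1 w\<^sub>2. \<bar>k\<bar> \<le> 1 \<and> 0 \<le> \<epsilon>\<^sub>1 \<and> \<epsilon>\<^sub>1 < \<delta> \<and> 0 \<le> \<epsilon>\<^sub>2 \<and> \<epsilon>\<^sub>2 < \<delta> \<and>
      comparable \<alpha> a (T + 1) N \<theta> e k \<epsilon>\<^sub>1 \<epsilon>\<^sub>2 w\<^sub>1 w\<^sub>2 \<longrightarrow> (\<forall>t\<in>{0..T}. \<forall>r\<in>{0..R}. w\<^sub>1 t r + w\<^sub>2 t r \<le> 3 * e)"
proof -
  \<comment> \<open>Half of the contribution of the time penalty: one half is spent on the Holder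
    error, the other on diffusion.\<close>
  define \<eta> where "\<eta> = e / (T + 1)\<^sup>2 / 2"
  have \<eta>: "\<eta> > 0" using pos by (simp add: \<eta>_def)
  obtain s where s: "s > 0" "s \<le> 2 * e / R" "N * s powr \<alpha> < \<eta>"
    using ex_small_powr[OF \<alpha>(1), of N \<eta> "2 * e / R"] pos \<eta> by auto
  \<comment> \<open>Both regularisation parameters will be below \<beta>, so their sum plus 2
    \<beta> is at most 4 \<beta> = s. The bound s \<le> 2 e / R gives 2 \<beta> R \<le> e.\<close>
  define \<beta> where "\<beta> = s / 4"
  \<comment> \<open>Bounds a wherever a maximum can sit, by monotonicity of a; adding 1 makes K
    positive, as \<delta> divides by it.\<close>
  define K where "K = a (2 * N / \<beta>) + 1"
  have \<beta>: "\<beta> > 0" using s by (simp add: \<beta>_def)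
  have K: "K > 0" using a[rule_format, of "2 * N / \<beta>" "2 * N / \<beta>"] pos \<beta> by (auto simp: K_def)
  define \<delta> where "\<delta> = min \<beta> (\<eta> * \<theta> / (2 * K))"
  have \<delta>: "\<delta> > 0" using \<beta> \<eta> pos K by (simp add: \<delta>_def)
  show ?thesis
  proof (intro exI[of _ \<delta>] conjI \<delta> allI impI ballI; elim conjE)
    fix k \<epsilon>\<^sub>1 \<epsilon>\<^sub>2 :: real and w\<^sub>1 w\<^sub>2 :: "real \<Rightarrow> real \<Rightarrow> real" and t r :: real
    assume k: "\<bar>k\<bar> \<le> 1" and e1: "0 \<le> \<epsilon>\<^sub>1" "\<epsilon>\<^sub>1 < \<delta>" and e2: "0 \<le> \<epsilon>\<^sub>2" "\<epsilon>\<^sub>2 < \<delta>"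
      and cmp: "comparable \<alpha> a (T + 1) N \<theta> e k \<epsilon>\<^sub>1 \<epsilon>\<^sub>2 w\<^sub>1 w\<^sub>2" and t: "t \<in> {0..T}" and r: "r \<in> {0..R}"
    have "N * (\<epsilon>\<^sub>1 + \<epsilon>\<^sub>2 + 2 * \<beta>) powr \<alpha> \<le> N * s powr \<alpha>"
      using e1 e2 pos \<alpha> \<beta> by (intro mult_left_mono powr_mono2) (auto simp: \<delta>_def \<beta>_def)
    moreover have "(\<epsilon>\<^sub>1 + \<epsilon>\<^sub>2) * (K / \<theta>) \<le> (\<eta> * \<theta> / K) * (K / \<theta>)"
      using e1 e2 K pos by (intro mult_right_mono) (auto simp: \<delta>_def field_simps)
    moreover have "(\<eta> * \<theta> / K) * (K / \<theta>) = \<eta>" using K pos by simp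
    ultimately have small: "N * (\<epsilon>\<^sub>1 + \<epsilon>\<^sub>2 + 2 * \<beta>) powr \<alpha> + (\<epsilon>\<^sub>1 + \<epsilon>\<^sub>2) * (K / \<theta>) < e / (T + 1)\<^sup>2"
      using s(3) unfolding \<eta>_def by (simp add: field_simps)
    have c: "viscosity_sub a \<epsilon>\<^sub>1 (hamiltonian \<alpha> \<epsilon>\<^sub>1 k) w\<^sub>1" "classical_sub a \<epsilon>\<^sub>2 (hamiltonian \<alpha> \<epsilon>\<^sub>2 (- k)) w\<^sub>2"
      "continuous_on quadrant (\<lambda>(t, r). w\<^sub>1 t r)" "continuous_on quadrant (\<lambda>(t, r). w\<^sub>2 t r)"
      "\<And>t r. t \<in> {0..<T + 1} \<Longrightarrow> 0 \<le> r \<Longrightarrow> \<bar>w\<^sub>1 t r\<bar> \<le> N"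
      "\<And>t r. t \<in> {0..<T + 1} \<Longrightarrow> 0 \<le> r \<Longrightarrow> \<bar>w\<^sub>2 t r\<bar> \<le> N"
      "\<And>t r q. t \<in> {0..<T + 1} \<Longrightarrow> 0 \<le> r \<Longrightarrow> 0 \<le> q \<Longrightarrow> t = 0 \<or> r = 0 \<or> q = 0 \<Longrightarrow>
        w\<^sub>1 t r + w\<^sub>2 t q \<le> e + (r - q)\<^sup>2 / (2 * \<theta>)"
      using cmp unfolding comparable_def by blast+
    have a': "0 \<le> a r" if "0 < r" for r using a[rule_format, of r r] that by simp
    have a'': "a r \<le> K" if "0 < r" "r \<le> 2 * N / \<beta>" for r
      using a[rule_format, of r "2 * N / \<beta>"] that by (simp add: K_def)
    have "w\<^sub>1 t r + w\<^sub>2 t r \<le> e + (r - r)\<^sup>2 / (2 * \<theta>) + \<beta> * (r + r) + e / (T + 1 - t)"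
      by (rule comparison_pointwise[OF \<alpha> e1(1) e2(1) k c(1,2) a' a'' c(3-6) pos(3) c(7)
            less_imp_le[OF pos(5)] pos(4) \<beta> pos(5) small]) (use t r in auto)
    moreover have "e / (T + 1 - t) \<le> e / 1" using t pos by (intro divide_left_mono) auto
    moreover have "\<beta> * (r + r) \<le> e"
    proof -
      have "\<beta> * (r + r) \<le> (2 * e / R / 4) * (R + R)"
        using r s \<beta> by (intro mult_mono) (auto simp: \<beta>_def)
      also have "\<dots> = e" using pos by simp
      finally show ?thesis .
    qed
    ultimately show "w\<^sub>1 t r + w\<^sub>2 t r \<le> 3 * e" by simp
  qed
qed

subsection \<open>A priori bounds for the regularised masses\<close>

text \<open>Takes the place of the doubling inequality when one of the two volumes is 0, where no
  equation holds, and when a single function is bounded from above.\<close>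

lemma classical_sub_single_inequality:
  assumes c: "classical_sub a \<epsilon> H w" and nn: "\<epsilon> \<ge> 0" "\<And>r. r > 0 \<Longrightarrow> a r \<ge> 0"
    and pos: "0 < t" "t < T" "0 < \<rho>"
    and d: "(\<xi> has_real_derivative x) (at t)"
      "\<forall>\<^sub>F r in nhds \<rho>. (\<psi> has_real_derivative Q r) (at r)"
      "(Q has_real_derivative B) (at \<rho>)"
    and mx: "\<And>s r. s \<in> {0..<T} \<Longrightarrow> 0 \<le> r \<Longrightarrow> w s r - \<psi> r - \<xi> s \<le> w t \<rho> - \<psi> \<rho> - \<xi> t"
  shows "x + H (Q \<rho>) * w t \<rho> \<le> \<epsilon> * a \<rho> * B"
proof -
  have "\<forall>\<^sub>F s in nhds t. s \<in> {0<..<T}" "\<forall>\<^sub>F r in nhds \<rho>. r \<in> {0<..}"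
    using eventually_nhds_in_open[of "{0<..<T}" t] eventually_nhds_in_open[of "{0<..}" \<rho>] pos by auto
  then have "\<forall>\<^sub>F (s, r) in nhds (t, \<rho>). s \<in> {0<..<T} \<and> r \<in> {0<..}"
    unfolding nhds_prod eventually_prod_filter by blast
  then have "\<forall>\<^sub>F (s, r) in nhds (t, \<rho>). w s r - \<xi> s - \<psi> r \<le> w t \<rho> - \<xi> t - \<psi> \<rho>"
    by eventually_elim (use mx in \<open>force simp: algebra_simps\<close>)
  then show ?thesis
    using classical_sub_imp_viscosity_sub[OF c nn] pos d unfolding viscosity_sub_def by blast
qed

text \<open>What the a priori bounds use of the mass at one \<epsilon>, free of the space dimension:
  a is the squared area of a sphere, L bounds the initial datum and \<open>M\<^sub>0\<close> is its
  norm in L^1. The positive part in \<open>initial_incr\<close> encodes monotonicity and the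
  Lipschitz bound in one inequality. \<open>locally_bounded\<close> is qualitative; its constant
  does not survive in the results.\<close>

locale regularised_mass =
  fixes \<alpha> :: real and a :: "real \<Rightarrow> real" and L M\<^sub>0 \<epsilon> :: real and m :: "real \<Rightarrow> real \<Rightarrow> real"
  assumes \<alpha>: "0 < \<alpha>" "\<alpha> \<le> 1"
    and a_mono: "\<And>r s. 0 \<le> r \<Longrightarrow> r \<le> s \<Longrightarrow> 0 \<le> a r \<and> a r \<le> a s"
    and L: "0 \<le> L" and M0: "0 \<le> M\<^sub>0" and \<epsilon>: "0 < \<epsilon>"
    and cont: "continuous_on quadrant (\<lambda>(t, r). m t r)"
    and locally_bounded: "\<And>T. \<exists>N. \<forall>t\<in>{0..T}. \<forall>r\<ge>0. \<bar>m t r\<bar> \<le> N"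
    and sub: "classical_sub a \<epsilon> (hamiltonian \<alpha> \<epsilon> 1) m"
    and super: "classical_sub a \<epsilon> (hamiltonian \<alpha> \<epsilon> (- 1)) (\<lambda>t r. - m t r)"
    and m_zero: "\<And>t. 0 \<le> t \<Longrightarrow> m t 0 = 0"
    and initial_incr: "\<And>r q. 0 \<le> r \<Longrightarrow> 0 \<le> q \<Longrightarrow> m 0 r - m 0 q \<le> L * max (r - q) 0"
    and initial_le: "\<And>r. 0 \<le> r \<Longrightarrow> m 0 r \<le> M\<^sub>0"
begin

lemma a_nonneg: "0 < r \<Longrightarrow> 0 \<le> a r"
  using a_mono[of r r] by simp

lemma cont_uminus: "continuous_on quadrant (\<lambda>(t, r). - m t r)"
  using continuous_on_minus[OF cont] by (simp add: case_prod_beta)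

text \<open>The kink of (r - q)_+ is harmless: at the maximum m(t, r) > m(t, q), so r and q differ
  and the penalty is affine nearby. No second order term remains, which is why the bound holds for
  every \<epsilon>. The sign of m is not yet known; only that of the difference and the value 0 at
  volume 0 are used.\<close>

lemma increment_le:
  assumes "0 \<le> t\<^sub>0" "0 \<le> r\<^sub>0" "0 \<le> q\<^sub>0"
  shows "m t\<^sub>0 r\<^sub>0 - m t\<^sub>0 q\<^sub>0 \<le> L * max (r\<^sub>0 - q\<^sub>0) 0"
proof (rule ccontr)
  assume neg: "\<not> ?thesis"
  define g where "g = m t\<^sub>0 r\<^sub>0 - m t\<^sub>0 q\<^sub>0 - L * max (r\<^sub>0 - q\<^sub>0) 0"
  have g: "g > 0" using neg by (simp add: g_def)
  define T where "T = t\<^sub>0 + 1"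
  obtain N' where N': "\<And>t r. t \<in> {0..T} \<Longrightarrow> 0 \<le> r \<Longrightarrow> \<bar>m t r\<bar> \<le> N'"
    using locally_bounded[of T] by blast
  define N where "N = max N' 1"
  have N: "N > 0" "\<And>t r. t \<in> {0..<T} \<Longrightarrow> 0 \<le> r \<Longrightarrow> \<bar>m t r\<bar> \<le> N"
    using N' by (force simp: N_def)+
  \<comment> \<open>The gap g is split in three: the confinement term, the time penalty (T is one
    unit after the given time), and a rest that keeps the inequality strict.\<close>
  define b where "b = g / 3"
  have b: "b > 0" using g by (simp add: b_def)
  have T: "T > 0" using assms by (simp add: T_def)
  obtain s where s: "s > 0" "s \<le> b / (r\<^sub>0 + q\<^sub>0 + 1)" "N * s powr \<alpha> < b / T\<^sup>2"
    using ex_small_powr[of \<alpha> N "b / T\<^sup>2" "b / (r\<^sub>0 + q\<^sub>0 + 1)"] \<alpha> N b T assms by force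
  define \<beta> where "\<beta> = s / 2"
  have \<beta>: "\<beta> > 0" using s by (simp add: \<beta>_def)
  have \<beta>b: "\<beta> * (r\<^sub>0 + q\<^sub>0) \<le> b"
  proof -
    have "\<beta> \<le> b / (r\<^sub>0 + q\<^sub>0 + 1)" using s unfolding \<beta>_def by linarith
    then have "\<beta> * (r\<^sub>0 + q\<^sub>0) \<le> b / (r\<^sub>0 + q\<^sub>0 + 1) * (r\<^sub>0 + q\<^sub>0 + 1)"
      using b assms by (intro mult_mono) auto
    then show ?thesis using assms by simp
  qed
  define \<Psi> where "\<Psi> = (\<lambda>r q. L * max (r - q) 0 + \<beta> * (r + q))"
  have c0: "m t\<^sub>0 r\<^sub>0 + - m t\<^sub>0 q\<^sub>0 > \<Psi> r\<^sub>0 q\<^sub>0 + b / (T - t\<^sub>0)"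
  proof -
    have "m t\<^sub>0 r\<^sub>0 + - m t\<^sub>0 q\<^sub>0 = L * max (r\<^sub>0 - q\<^sub>0) 0 + g" "b / (T - t\<^sub>0) = b" "g = 3 * b"
      by (simp_all add: g_def T_def) (simp add: b_def g_def)
    then show ?thesis using \<beta>b b unfolding \<Psi>_def by linarith
  qed
  have c\<Psi>: "continuous_on quadrant (\<lambda>(r, q). \<Psi> r q)"
    unfolding \<Psi>_def case_prod_beta by (intro continuous_intros)
  have \<Psi>ge: "\<forall>r\<ge>0. \<forall>q\<ge>0. \<beta> * (r + q) \<le> \<Psi> r q" using L by (simp add: \<Psi>_def)
  have bd': "\<forall>t\<in>{0..<T}. \<forall>r\<ge>0. m t r \<le> N" "\<forall>t\<in>{0..<T}. \<forall>r\<ge>0. - m t r \<le> N"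
    using N(2) by (meson abs_le_D1 abs_le_D2)+
  have t0: "t\<^sub>0 \<in> {0..<T}" using assms by (simp add: T_def)
  obtain t r q where mm: "t \<in> {0..<T}" "r \<ge> 0" "q \<ge> 0"
    "m t r + - m t q > \<Psi> r q + b / (T - t)"
    and mx: "\<And>s r' q'. s \<in> {0..<T} \<Longrightarrow> 0 \<le> r' \<Longrightarrow> 0 \<le> q' \<Longrightarrow>
       m s r' + - m s q' - \<Psi> r' q' - b / (T - s) \<le> m t r + - m t q - \<Psi> r q - b / (T - t)"
    using penalised_max_exists[OF cont cont_uminus c\<Psi> bd' N(1) \<Psi>ge b \<beta> t0 assms(2,3) c0] by blast
  have Tt: "T - t > 0" "b / (T - t) > 0" "b / (T - t)\<^sup>2 > 0" using mm b by auto
  have "\<beta> * (r + q) \<ge> 0" "L * max (r - q) 0 \<ge> 0" using \<beta> mm L by auto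
  then have big: "m t r - m t q > L * max (r - q) 0" "m t r - m t q > 0"
    using mm(4) Tt unfolding \<Psi>_def by linarith+
  have tp: "t > 0" using mm(1) big initial_incr[OF mm(2,3)] by (cases "t = 0") auto
  have rq: "r \<noteq> q" using big by auto
  \<comment> \<open>The slope of the penalty on the side of the diagonal where the maximum
    lies.\<close>
  define p where "p = (if r > q then L else 0)"
  have 1: "((\<lambda>s. b / (T - s)) has_real_derivative b / (T - t)\<^sup>2) (at t)"
    using Tt by (auto intro!: derivative_eq_intros simp: power2_eq_square)
  define d where "d = \<bar>r - q\<bar>"
  have d: "d > 0" "\<And>x. \<bar>x - (r - q)\<bar> < d \<Longrightarrow> L * max x 0 = p * x"
    using rq by (auto simp: d_def p_def max_def abs_if split: if_splits)
  have 2: "\<forall>\<^sub>F r' in nhds r. ((\<lambda>r. \<Psi> r q) has_real_derivative p + \<beta>) (at r')"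
  proof -
    have "((\<lambda>r. \<Psi> r q) has_real_derivative p + \<beta>) (at r')" if "\<bar>r' - r\<bar> < d" for r'
    proof -
      have "((\<lambda>r. p * (r - q) + \<beta> * (r + q)) has_real_derivative p + \<beta>) (at r')"
        by (auto intro!: derivative_eq_intros)
      then show ?thesis
        by (rule has_field_derivative_transform_within_open[where S = "ball r d"])
           (use that in \<open>auto simp: \<Psi>_def dist_real_def intro!: d(2)[symmetric]\<close>)
    qed
    then show ?thesis using d(1) by (auto simp: eventually_nhds_metric dist_real_def)
  qed
  have 3: "((\<lambda>_. p + \<beta>) has_real_derivative 0) (at r)" by simp
  have 4: "\<forall>\<^sub>F q' in nhds q. (\<Psi> r has_real_derivative - p + \<beta>) (at q')"
  proof -
    have "(\<Psi> r has_real_derivative - p + \<beta>) (at q')" if "\<bar>q' - q\<bar> < d" for q'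
    proof -
      have "((\<lambda>q. p * (r - q) + \<beta> * (r + q)) has_real_derivative - p + \<beta>) (at q')"
        by (auto intro!: derivative_eq_intros)
      then show ?thesis
        by (rule has_field_derivative_transform_within_open[where S = "ball q d"])
           (use that in \<open>auto simp: \<Psi>_def dist_real_def intro!: d(2)[symmetric]\<close>)
    qed
    then show ?thesis using d(1) by (auto simp: eventually_nhds_metric dist_real_def)
  qed
  have 5: "((\<lambda>_. - p + \<beta>) has_real_derivative 0) (at q)" by simp
  consider "r = 0" "q > 0" | "q = 0" "r > 0" | "r > 0" "q > 0" using rq mm by linarith
  then show False
  proof cases
    \<comment> \<open>Here the gap forces m(t, q) < 0, so the zeroth order term of - m is
      nonnegative and the inequality at q alone is contradictory.\<close>
    assume c1': "r = 0" "q > 0"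
    have "b / (T - t)\<^sup>2 + hamiltonian \<alpha> \<epsilon> (- 1) (- p + \<beta>) * - m t q \<le> \<epsilon> * a q * 0"
      by (rule classical_sub_single_inequality[OF super less_imp_le[OF \<epsilon>] a_nonneg tp _ c1'(2) 1 4 5])
         (use mm mx[of _ 0] m_zero tp c1' in auto)
    moreover have "hamiltonian \<alpha> \<epsilon> (- 1) (- p + \<beta>) * - m t q \<ge> 0"
      using big c1' m_zero tp by (intro mult_nonneg_nonneg) auto
    ultimately show False using Tt by simp
  next
    assume c2': "q = 0" "r > 0"
    have "b / (T - t)\<^sup>2 + hamiltonian \<alpha> \<epsilon> 1 (p + \<beta>) * m t r \<le> \<epsilon> * a r * 0"
      by (rule classical_sub_single_inequality[OF sub less_imp_le[OF \<epsilon>] a_nonneg tp _ c2'(2) 1 2 3])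
         (use mm mx[of _ _ 0] m_zero tp c2' in auto)
    moreover have "hamiltonian \<alpha> \<epsilon> 1 (p + \<beta>) * m t r \<ge> 0"
      using big c2' m_zero tp by (intro mult_nonneg_nonneg) auto
    ultimately show False using Tt by simp
  next
    assume c3': "r > 0" "q > 0"
    have main: "b / (T - t)\<^sup>2 + hamiltonian \<alpha> \<epsilon> 1 (p + \<beta>) * m t r + hamiltonian \<alpha> \<epsilon> (- 1) (- p + \<beta>) * - m t q
        \<le> \<epsilon> * a r * 0 + \<epsilon> * a q * 0"
      by (rule doubling_inequality[OF classical_sub_imp_viscosity_sub[OF sub less_imp_le[OF \<epsilon>] a_nonneg] super
            less_imp_le[OF \<epsilon>] a_nonneg tp _ c3' 1 2 3 4 5 mx]) (use c3' mm in auto)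
    let ?h1 = "hamiltonian \<alpha> \<epsilon> 1 (p + \<beta>)" and ?h2 = "hamiltonian \<alpha> \<epsilon> 1 (p - \<beta>)"
    have h2: "hamiltonian \<alpha> \<epsilon> (- 1) (- p + \<beta>) = ?h2" by (simp add: hamiltonian_def)
    have "\<bar>max (p + \<beta>) 0 - max (p - \<beta>) 0\<bar> \<le> s" using s by (simp add: \<beta>_def)
    then have "\<bar>(\<epsilon> + max (p + \<beta>) 0) - (\<epsilon> + max (p - \<beta>) 0)\<bar> powr \<alpha> \<le> s powr \<alpha>"
      using \<alpha> by (intro powr_mono2) auto
    then have "\<bar>?h1 - ?h2\<bar> \<le> s powr \<alpha>"
      using abs_powr_diff_le[of "\<epsilon> + max (p + \<beta>) 0" "\<epsilon> + max (p - \<beta>) 0" \<alpha>] \<alpha> \<epsilon>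
      by (simp add: hamiltonian_def)
    then have "\<bar>?h1 - ?h2\<bar> * \<bar>m t r\<bar> \<le> s powr \<alpha> * N"
      using N(2)[OF mm(1,2)] by (intro mult_mono) auto
    then have "(?h1 - ?h2) * m t r \<ge> - (N * s powr \<alpha>)"
      by (simp add: abs_mult[symmetric] mult.commute)
    moreover have "?h2 * (m t r - m t q) \<ge> 0" using big by simp
    moreover have "?h1 * m t r + ?h2 * - m t q = (?h1 - ?h2) * m t r + ?h2 * (m t r - m t q)"
      by (simp add: algebra_simps)
    moreover have "b / T\<^sup>2 \<le> b / (T - t)\<^sup>2"
      using Tt tp b by (intro divide_left_mono power_mono) auto
    ultimately show False using main s(3) unfolding h2 by (simp only: mult_zero_right)
  qed
qed

lemma m_nonneg: "0 \<le> t \<Longrightarrow> 0 \<le> r \<Longrightarrow> 0 \<le> m t r"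
  using increment_le[of t 0 r] m_zero[of t] by simp

lemma m_le_linear: "0 \<le> t \<Longrightarrow> 0 \<le> r \<Longrightarrow> m t r \<le> L * r"
  using increment_le[of t r 0] m_zero[of t] by simp

text \<open>Where m exceeds \<open>M\<^sub>0\<close>, which is nonnegative, the zeroth order term
  has the favourable sign, and an affine penalty brings in no diffusion. The existence of a maximum
  is reused with 0 as second function and a dummy second volume. This bound, uniform in \<epsilon>
  and time, supplies N in the later comparisons.\<close>

lemma m_le:
  assumes "0 \<le> t\<^sub>0" "0 \<le> r\<^sub>0"
  shows "m t\<^sub>0 r\<^sub>0 \<le> M\<^sub>0"
proof (rule ccontr)
  assume neg: "\<not> ?thesis"
  define g where "g = m t\<^sub>0 r\<^sub>0 - M\<^sub>0"
  have g: "g > 0" using neg by (simp add: g_def)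
  define T where "T = t\<^sub>0 + 1"
  obtain N' where N': "\<And>t r. t \<in> {0..T} \<Longrightarrow> 0 \<le> r \<Longrightarrow> \<bar>m t r\<bar> \<le> N'"
    using locally_bounded[of T] by blast
  define N where "N = max N' 1"
  have N: "N > 0" "\<And>t r. t \<in> {0..<T} \<Longrightarrow> 0 \<le> r \<Longrightarrow> m t r \<le> N"
    using N' by (force simp: N_def)+
  define b where "b = g / 3"
  define \<beta> where "\<beta> = b / (r\<^sub>0 + 1)"
  have b: "b > 0" and \<beta>: "\<beta> > 0" "\<beta> * r\<^sub>0 \<le> b"
    using g assms by (auto simp: b_def \<beta>_def field_simps)
  define \<Psi> where "\<Psi> = (\<lambda>r q. M\<^sub>0 + \<beta> * (r + q))"
  have c0: "m t\<^sub>0 r\<^sub>0 + 0 > \<Psi> r\<^sub>0 0 + b / (T - t\<^sub>0)"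
  proof -
    have "m t\<^sub>0 r\<^sub>0 + 0 = M\<^sub>0 + g" "b / (T - t\<^sub>0) = b" "g = 3 * b"
      by (simp_all add: g_def T_def) (simp add: b_def g_def)
    then show ?thesis using \<beta> b unfolding \<Psi>_def by simp
  qed
  have c\<Psi>: "continuous_on quadrant (\<lambda>(r, q). \<Psi> r q)"
    unfolding \<Psi>_def case_prod_beta by (intro continuous_intros)
  have \<Psi>ge: "\<forall>r\<ge>0. \<forall>q\<ge>0. \<beta> * (r + q) \<le> \<Psi> r q" using M0 by (simp add: \<Psi>_def)
  have bd': "\<forall>t\<in>{0..<T}. \<forall>r\<ge>0. m t r \<le> N" "\<forall>t\<in>{0..<T}. \<forall>r::real\<ge>0. 0 \<le> N"
    using N by auto
  have t0: "t\<^sub>0 \<in> {0..<T}" using assms by (simp add: T_def)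
  have c2: "continuous_on quadrant (\<lambda>(t, r). 0 :: real)" by (simp add: case_prod_beta)
  obtain t r q where mm: "t \<in> {0..<T}" "r \<ge> 0" "q \<ge> 0"
    "m t r + 0 > \<Psi> r q + b / (T - t)"
    and mx: "\<And>s r' q'. s \<in> {0..<T} \<Longrightarrow> 0 \<le> r' \<Longrightarrow> 0 \<le> q' \<Longrightarrow>
       m s r' + 0 - \<Psi> r' q' - b / (T - s) \<le> m t r + 0 - \<Psi> r q - b / (T - t)"
    using penalised_max_exists[OF cont c2 c\<Psi> bd' N(1) \<Psi>ge b \<beta>(1) t0 assms(2) order_refl c0] by blast
  have Tt: "T - t > 0" "b / (T - t) > 0" "b / (T - t)\<^sup>2 > 0" using mm b by auto
  have "\<beta> * (r + q) \<ge> 0" using \<beta> mm by auto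
  then have big: "m t r > M\<^sub>0" using mm(4) Tt unfolding \<Psi>_def by linarith
  have tp: "t > 0" using mm(1) big initial_le[OF mm(2)] by (cases "t = 0") auto
  have rp: "r > 0" using mm(2) big m_zero[of t] tp M0 by (cases "r = 0") auto
  have "b / (T - t)\<^sup>2 + hamiltonian \<alpha> \<epsilon> 1 \<beta> * m t r \<le> \<epsilon> * a r * 0"
    by (rule classical_sub_single_inequality[OF sub less_imp_le[OF \<epsilon>] a_nonneg tp _ rp,
          where \<xi> = "\<lambda>s. b / (T - s)" and \<psi> = "\<lambda>r. \<Psi> r q" and Q = "\<lambda>_. \<beta>"])
       (use mm mx[of _ _ q] Tt in \<open>auto intro!: derivative_eq_intros always_eventually
          simp: \<Psi>_def power2_eq_square\<close>)
  moreover have "hamiltonian \<alpha> \<epsilon> 1 \<beta> * m t r \<ge> 0" using big M0 by simp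
  ultimately show False using Tt by simp
qed

end

text \<open>Trades a Lipschitz bound for the quadratic penalty, at the price of a small
  constant.\<close>

lemma young_le:
  fixes L x e \<theta> :: real
  assumes "\<theta> > 0" "L\<^sup>2 * \<theta> / 2 \<le> e"
  shows "L * x \<le> e + x\<^sup>2 / (2 * \<theta>)"
proof -
  have "0 \<le> (x - L * \<theta>)\<^sup>2 / (2 * \<theta>)" using assms by simp
  also have "\<dots> = x\<^sup>2 / (2 * \<theta>) - L * x + L\<^sup>2 * \<theta> / 2"
    using assms by (simp add: power2_eq_square field_simps)
  finally show ?thesis using assms by linarith
qed

subsection \<open>Stability of viscosity solutions\<close>

text \<open>Replaces the extended real limit superior by real slope estimates, the form in which the
  superdifferential is used below.\<close>

lemma superdifferential_iff:
  "p \<in> superdifferential f X \<longleftrightarrow>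
     (\<forall>\<kappa>>0. \<forall>\<^sub>F Y in at X. f Y - f X - p \<bullet> (Y - X) \<le> \<kappa> * norm (Y - X))"
proof -
  let ?q = "\<lambda>Y. (f Y - f X - p \<bullet> (Y - X)) / norm (Y - X)"
  have ne: "\<forall>\<^sub>F Y in at X. Y \<noteq> X" by (simp add: eventually_at_filter)
  show ?thesis
  proof safe
    fix \<kappa> :: real assume p: "p \<in> superdifferential f X" and \<kappa>: "\<kappa> > 0"
    have "\<forall>y>0. \<forall>\<^sub>F Y in at X. ereal (?q Y) < y"
      using p unfolding superdifferential_def Limsup_le_iff mem_Collect_eq .
    from this[rule_format, of "ereal \<kappa>"] have "\<forall>\<^sub>F Y in at X. ereal (?q Y) < ereal \<kappa>"
      using \<kappa> by simp
    then show "\<forall>\<^sub>F Y in at X. f Y - f X - p \<bullet> (Y - X) \<le> \<kappa> * norm (Y - X)"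
      using ne by eventually_elim (simp add: divide_less_eq)
  next
    assume *: "\<forall>\<kappa>>0. \<forall>\<^sub>F Y in at X. f Y - f X - p \<bullet> (Y - X) \<le> \<kappa> * norm (Y - X)"
    show "p \<in> superdifferential f X"
      unfolding superdifferential_def Limsup_le_iff mem_Collect_eq
    proof safe
      fix y :: ereal assume "0 < y"
      then obtain \<kappa> where \<kappa>: "0 < \<kappa>" "ereal \<kappa> < y" using ereal_dense2[of 0 y] by auto
      have "\<forall>\<^sub>F Y in at X. f Y - f X - p \<bullet> (Y - X) \<le> \<kappa> * norm (Y - X)" using * \<kappa> by blast
      then show "\<forall>\<^sub>F Y in at X. ereal (?q Y) < y"
        using ne
      proof eventually_elim
        case (elim Y)
        then have "?q Y \<le> \<kappa>" by (simp add: divide_le_eq)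
        then show ?case using \<kappa>(2) by (meson ereal_less_eq(3) le_less_trans)
      qed
    qed
  qed
qed

lemma subdifferential_uminus:
  "p \<in> subdifferential f X \<longleftrightarrow> - p \<in> superdifferential (\<lambda>Y. - f Y) X"
proof -
  have eq: "ereal ((- f Y - - f X - - p \<bullet> (Y - X)) / norm (Y - X))
      = - ereal ((f Y - f X - p \<bullet> (Y - X)) / norm (Y - X))" for Y
    by (simp add: minus_divide_left)
  show ?thesis
    unfolding subdifferential_def superdifferential_def mem_Collect_eq eq ereal_Limsup_uminus
    by simp
qed

text \<open>Where f(t) + g(\<rho>) touches w from above, its pair of derivatives is in the
  superdifferential; second derivatives disappear because the diffusion parameter is 0. This is the
  direction that uniqueness uses.\<close>

lemma viscosity_sub_if_superdifferential:
  assumes H: "\<And>t \<rho> p\<^sub>1 p\<^sub>2. \<lbrakk>0 < t; 0 < \<rho>; (p\<^sub>1, p\<^sub>2) \<in> superdifferential (\<lambda>(t, r). w t r) (t, \<rho>)\<rbrakk>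
      \<Longrightarrow> p\<^sub>1 + H p\<^sub>2 * w t \<rho> \<le> 0"
  shows "viscosity_sub a 0 H w"
  unfolding viscosity_sub_def
proof (intro allI impI)
  fix t \<rho> :: real and f p g g' A
  assume t: "t > 0" "\<rho> > 0" and f: "(f has_real_derivative p) (at t)"
    and g: "\<forall>\<^sub>F r in nhds \<rho>. (g has_real_derivative g' r) (at r)"
      "(g' has_real_derivative A) (at \<rho>)"
    and mx: "\<forall>\<^sub>F (s, r) in nhds (t, \<rho>). w s r - f s - g r \<le> w t \<rho> - f t - g \<rho>"
  have dg: "(g has_real_derivative g' \<rho>) (at \<rho>)" using eventually_nhds_x_imp_x[OF g(1)] .
  have "(p, g' \<rho>) \<in> superdifferential (\<lambda>(t, r). w t r) (t, \<rho>)"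
    unfolding superdifferential_iff
  proof (intro allI impI)
    fix \<kappa> :: real assume \<kappa>: "\<kappa> > 0"
    \<comment> \<open>Each of the two variables may spend half of the slope error \<kappa>.\<close>
    have lin: "\<forall>\<^sub>F y in nhds x. h y - h x - q * (y - x) \<le> \<kappa> / 2 * \<bar>y - x\<bar>"
      if "(h has_real_derivative q) (at x)" for h q and x :: real
    proof -
      from conjunct2[OF that[unfolded has_field_derivative_def has_derivative_at_alt],
          rule_format, OF half_gt_zero[OF \<kappa>]]
      obtain d where "d > 0" "\<forall>y. norm (y - x) < d \<longrightarrow>
          norm (h y - h x - q * (y - x)) \<le> \<kappa> / 2 * norm (y - x)" by blast
      then show ?thesis
        unfolding eventually_nhds_metric dist_real_def real_norm_def
        using abs_le_D1 by blast
    qed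
    have "\<forall>\<^sub>F (s, r) in nhds (t, \<rho>). f s - f t - p * (s - t) \<le> \<kappa> / 2 * \<bar>s - t\<bar> \<and>
        g r - g \<rho> - g' \<rho> * (r - \<rho>) \<le> \<kappa> / 2 * \<bar>r - \<rho>\<bar>"
      unfolding nhds_prod eventually_prod_filter using lin[OF f] lin[OF dg] by blast
    then have "\<forall>\<^sub>F Y in nhds (t, \<rho>). (case Y of (t, r) \<Rightarrow> w t r) - w t \<rho>
        - (p, g' \<rho>) \<bullet> (Y - (t, \<rho>)) \<le> \<kappa> * norm (Y - (t, \<rho>))"
      using mx
    proof eventually_elim
      case (elim Y)
      obtain s r where Y: "Y = (s, r)" by (cases Y)
      have "\<bar>s - t\<bar> \<le> norm (Y - (t, \<rho>))" "\<bar>r - \<rho>\<bar> \<le> norm (Y - (t, \<rho>))"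
        using norm_fst_le[of "s - t" "r - \<rho>"] norm_snd_le[of "r - \<rho>" "s - t"] by (simp_all add: Y)
      then have "\<kappa> / 2 * \<bar>s - t\<bar> + \<kappa> / 2 * \<bar>r - \<rho>\<bar> \<le> \<kappa> / 2 * norm (Y - (t, \<rho>)) + \<kappa> / 2 * norm (Y - (t, \<rho>))"
        using \<kappa> by (intro add_mono mult_left_mono) auto
      also have "\<dots> = \<kappa> * norm (Y - (t, \<rho>))" by simp
      finally show ?case using elim by (simp add: Y)
    qed
    then show "\<forall>\<^sub>F Y in at (t, \<rho>). (case Y of (t, r) \<Rightarrow> w t r) - (case (t, \<rho>) of (t, r) \<Rightarrow> w t r)
        - (p, g' \<rho>) \<bullet> (Y - (t, \<rho>)) \<le> \<kappa> * norm (Y - (t, \<rho>))"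
      by (simp add: eventually_at_filter eventually_mono)
  qed
  then show "p + H (g' \<rho>) * w t \<rho> \<le> 0 * a \<rho> * A" using H t by simp
qed

text \<open>A slope condition with error \<open>\<kappa> |Y - X|\<close> on the ball of radius \<open>r\<close> is turned into a strict
  maximum by adding \<open>(2 \<kappa> / r) |Y - X|\<^sup>2\<close>, so only quadratic test functions occur.\<close>

lemma viscosity_stability:
  fixes w :: "real \<Rightarrow> real \<Rightarrow> real" and wa :: "real \<Rightarrow> real \<Rightarrow> real \<Rightarrow> real"
  assumes \<alpha>: "0 < \<alpha>" "\<alpha> \<le> 1" and k: "\<bar>k\<bar> \<le> 1"
    and a: "\<And>r s. 0 \<le> r \<Longrightarrow> r \<le> s \<Longrightarrow> 0 \<le> a r \<and> a r \<le> a s"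
    and v: "\<And>\<epsilon>. \<epsilon> > 0 \<Longrightarrow> viscosity_sub a \<epsilon> (hamiltonian \<alpha> \<epsilon> k) (wa \<epsilon>)"
    and ca: "\<And>\<epsilon>. \<epsilon> > 0 \<Longrightarrow> continuous_on quadrant (\<lambda>(t, r). wa \<epsilon> t r)"
    and cw: "continuous_on quadrant (\<lambda>(t, r). w t r)"
    and lim: "\<And>e T R. e > 0 \<Longrightarrow> \<forall>\<^sub>F \<epsilon> in at_right 0. \<forall>t\<in>{0..T}. \<forall>r\<in>{0..R}. \<bar>wa \<epsilon> t r - w t r\<bar> \<le> e"
    and X: "0 < t" "0 < \<rho>" and p: "(p\<^sub>1, p\<^sub>2) \<in> superdifferential (\<lambda>(t, r). w t r) (t, \<rho>)"
  shows "p\<^sub>1 + hamiltonian \<alpha> 0 k p\<^sub>2 * w t \<rho> \<le> 0"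
proof -
  define X where "X = (t, \<rho>)"
  define P where "P = (p\<^sub>1, p\<^sub>2)"
  define W where "W = (\<lambda>(t, r). w t r)"
  define Wa where "Wa = (\<lambda>\<epsilon> (t, r). wa \<epsilon> t r)"
  have nn: "hamiltonian \<alpha> 0 k p\<^sub>2 \<ge> 0" by simp
  \<comment> \<open>Of 5 \<kappa>, the time slope accounts for 4 \<kappa> and diffusion for
    \<kappa>. The next term comes from moving the value of the function, the last from moving the
    slope by 4 \<kappa> and the regularisation by \<kappa>. All of them vanish as \<kappa>
    \<rightarrow> 0.\<close>
  have key: "p\<^sub>1 + hamiltonian \<alpha> 0 k p\<^sub>2 * W X \<le> 5 * \<kappa> + 2 * \<kappa> * hamiltonian \<alpha> 0 k p\<^sub>2 + (5 * \<kappa>) powr \<alpha> * (\<bar>W X\<bar> + 2 * \<kappa>)"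
    if \<kappa>: "0 < \<kappa>" "\<kappa> < 1" for \<kappa>
  proof -
    have "\<forall>\<^sub>F Y in at X. W Y - W X - P \<bullet> (Y - X) \<le> \<kappa> * norm (Y - X)"
      using p \<kappa> unfolding superdifferential_iff X_def P_def W_def by blast
    then obtain d1 where d1: "d1 > 0" "\<And>Y. dist Y X < d1 \<Longrightarrow> Y \<noteq> X \<Longrightarrow> W Y - W X - P \<bullet> (Y - X) \<le> \<kappa> * norm (Y - X)"
      unfolding eventually_at by blast
    have Xin: "X \<in> open_quadrant" using X by (simp add: X_def)
    have oq: "open open_quadrant" by (intro open_Times) auto
    have "continuous_on open_quadrant W" using cw unfolding W_def by (rule continuous_on_subset) auto
    then have "isCont W X" using Xin oq continuous_on_eq_continuous_at by blast
    then obtain d2 where d2: "d2 > 0" "\<And>Y. dist Y X < d2 \<Longrightarrow> dist (W Y) (W X) < \<kappa>"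
      unfolding continuous_at_eps_delta using \<kappa> by blast
    obtain d3 where d3: "d3 > 0" "ball X d3 \<subseteq> open_quadrant" using oq Xin open_contains_ball by blast
    define r where "r = min (min d1 d2) (min d3 1) / 2"
    have r: "r > 0" "r < d1" "r < d2" "r < d3" "r < 1" using d1 d2 d3 by (auto simp: r_def min_def)
    have sub: "cball X r \<subseteq> open_quadrant"
      by (rule order_trans[OF _ d3(2)]) (use r(4) in auto)
    have inR: "fst Y \<in> {0<..t + 1} \<and> snd Y \<in> {0<..\<rho> + 1}" if "Y \<in> cball X r" for Y
    proof -
      have "\<bar>fst X - fst Y\<bar> \<le> r" "\<bar>snd X - snd Y\<bar> \<le> r"
        using that dist_fst_le[of X Y] dist_snd_le[of X Y] by (auto simp: dist_real_def)
      moreover have "Y \<in> open_quadrant" using sub that by blast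
      ultimately show ?thesis using r by (auto simp: X_def mem_Times_iff)
    qed
    define \<eta> where "\<eta> = min \<kappa> (\<kappa> * r / 4)"
    have \<eta>: "\<eta> > 0" "\<eta> \<le> \<kappa>" "\<eta> \<le> \<kappa> * r / 4" using \<kappa> r by (auto simp: \<eta>_def)
    \<comment> \<open>Bounds a times the second derivative of the test function on the ball, so that
      \<epsilon> < \<kappa> / (B + 1) keeps the diffusion term at most \<kappa>.\<close>
    define B where "B = a (\<rho> + 1) * (4 * \<kappa> / r)"
    have B: "B \<ge> 0" using a[of "\<rho> + 1" "\<rho> + 1"] X \<kappa> r by (simp add: B_def)
    have "\<forall>\<^sub>F \<epsilon> in at_right 0. (\<forall>t\<in>{0..t + 1}. \<forall>r\<in>{0..\<rho> + 1}. \<bar>wa \<epsilon> t r - w t r\<bar> \<le> \<eta>) \<and>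
        \<epsilon> \<in> {0<..<min \<kappa> (\<kappa> / (B + 1))}"
      using \<kappa> B by (intro eventually_conj lim[OF \<eta>(1)] eventually_at_right_real) auto
    from eventually_happens'[OF _ this] obtain \<epsilon> where
      e1: "\<forall>t\<in>{0..t + 1}. \<forall>r\<in>{0..\<rho> + 1}. \<bar>wa \<epsilon> t r - w t r\<bar> \<le> \<eta>" and
      e2: "\<epsilon> \<in> {0<..<min \<kappa> (\<kappa> / (B + 1))}"
      by (metis (no_types, lifting) trivial_limit_at_right_real)
    have \<epsilon>: "\<And>s q. s \<in> {0..t + 1} \<Longrightarrow> q \<in> {0..\<rho> + 1} \<Longrightarrow> \<bar>wa \<epsilon> s q - w s q\<bar> \<le> \<eta>"
        "0 < \<epsilon>" "\<epsilon> < \<kappa>" "\<epsilon> < \<kappa> / (B + 1)"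
      using e1 e2 by auto
    have close: "\<bar>Wa \<epsilon> Y - W Y\<bar> \<le> \<eta>" if "Y \<in> cball X r" for Y
      using \<epsilon>(1)[of "fst Y" "snd Y"] inR[OF that] by (auto simp: Wa_def W_def case_prod_beta)
    define f where "f = (\<lambda>s. p\<^sub>1 * s + (2 * \<kappa> / r) * (s - t)\<^sup>2)"
    define g where "g = (\<lambda>q. p\<^sub>2 * q + (2 * \<kappa> / r) * (q - \<rho>)\<^sup>2)"
    define F where "F = (\<lambda>Y. Wa \<epsilon> Y - f (fst Y) - g (snd Y))"
    have Fd: "f (fst Y) + g (snd Y) - f t - g \<rho> = P \<bullet> (Y - X) + (2 * \<kappa> / r) * (norm (Y - X))\<^sup>2" for Y
    proof -
      have "(norm (Y - X))\<^sup>2 = (fst Y - t)\<^sup>2 + (snd Y - \<rho>)\<^sup>2"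
        by (cases Y) (simp add: X_def norm_Pair)
      then show ?thesis by (cases Y) (simp add: f_def g_def P_def X_def algebra_simps)
    qed
    have "continuous_on (cball X r) (Wa \<epsilon>)"
      using ca[OF \<epsilon>(2)] unfolding Wa_def by (rule continuous_on_subset) (use sub in auto)
    then have cF: "continuous_on (cball X r) F"
      unfolding F_def f_def g_def by (intro continuous_intros)
    obtain Z where Z: "Z \<in> cball X r" "\<And>Y. Y \<in> cball X r \<Longrightarrow> F Y \<le> F Z"
      using continuous_attains_sup[OF compact_cball _ cF] r by auto
    have Xc: "X \<in> cball X r" using r by simp
    \<comment> \<open>On the sphere the quadratic term costs 2 \<kappa> r against a slope error of
      \<kappa> r. The margin \<kappa> r exceeds the change 2 \<eta> \<le> \<kappa> r / 2 caused by
      passing to the approximation.\<close>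
    have "dist X Z \<noteq> r"
    proof
      assume eq: "dist X Z = r"
      then have nz: "norm (Z - X) = r" by (simp add: dist_norm norm_minus_commute)
      have "W Z - W X - P \<bullet> (Z - X) \<le> \<kappa> * r"
        using d1(2)[of Z] eq r nz by (auto simp: dist_commute)
      moreover have "f (fst Z) + g (snd Z) - f t - g \<rho> = P \<bullet> (Z - X) + 2 * (\<kappa> * r)"
        using Fd[of Z] r unfolding nz by (simp add: power2_eq_square)
      moreover have "F X \<le> F Z" by (rule Z(2)[OF Xc])
      moreover have "\<kappa> * r > 0" using \<kappa> r by simp
      ultimately show False
        using close[OF Z(1)] close[OF Xc] \<eta>(3) unfolding F_def by (simp add: X_def)
    qed
    then have Zb: "Z \<in> ball X r" using Z(1) by auto
    obtain s q where Zsq: "Z = (s, q)" by (cases Z)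
    have sq: "0 < s" "0 < q" "q \<le> \<rho> + 1" using inR[OF Z(1)] by (auto simp: Zsq)
    have "\<forall>\<^sub>F Y in nhds Z. Y \<in> ball X r" using Zb by (intro eventually_nhds_in_open) auto
    then have mx: "\<forall>\<^sub>F (s', q') in nhds (s, q). wa \<epsilon> s' q' - f s' - g q' \<le> wa \<epsilon> s q - f s - g q"
      unfolding Zsq[symmetric]
    proof eventually_elim
      case (elim Y)
      then have "F Y \<le> F Z" by (intro Z(2)) auto
      then show ?case by (cases Y) (simp add: F_def Wa_def Zsq)
    qed
    define fp where "fp = p\<^sub>1 + (4 * \<kappa> / r) * (s - t)"
    define gp where "gp = (\<lambda>q. p\<^sub>2 + (4 * \<kappa> / r) * (q - \<rho>))"
    have m1: "fp + hamiltonian \<alpha> \<epsilon> k (gp q) * wa \<epsilon> s q \<le> \<epsilon> * a q * (4 * \<kappa> / r)"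
      by (rule v[OF \<epsilon>(2), unfolded viscosity_sub_def, rule_format, OF sq(1,2) _ _ _ mx])
         (use r in \<open>auto simp: f_def g_def fp_def gp_def intro!: derivative_eq_intros always_eventually\<close>)
    have m2: "\<epsilon> * a q * (4 * \<kappa> / r) \<le> \<epsilon> * B"
      using a[of q "\<rho> + 1"] sq \<epsilon>(2) \<kappa> r unfolding B_def mult.assoc
      by (intro mult_left_mono mult_right_mono) auto
    have m3: "\<epsilon> * B \<le> \<kappa>"
    proof -
      have "\<epsilon> * (B + 1) \<le> \<kappa>" using \<epsilon>(4) B by (simp add: less_divide_eq)
      then show ?thesis using \<epsilon>(2) by (simp add: algebra_simps)
    qed
    have dst: "\<bar>s - t\<bar> \<le> r" "\<bar>q - \<rho>\<bar> \<le> r"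
      using Z(1) dist_fst_le[of X Z] dist_snd_le[of X Z] by (auto simp: dist_real_def X_def Zsq)
    have e4: "\<bar>(4 * \<kappa> / r) * y\<bar> \<le> 4 * \<kappa>" if "\<bar>y\<bar> \<le> r" for y
    proof -
      have "\<bar>(4 * \<kappa> / r) * y\<bar> = (4 * \<kappa> / r) * \<bar>y\<bar>" using \<kappa> r by (simp add: abs_mult)
      also have "\<dots> \<le> (4 * \<kappa> / r) * r" using \<kappa> r that by (intro mult_left_mono) auto
      finally show ?thesis using r by simp
    qed
    have "\<bar>hamiltonian \<alpha> \<epsilon> k (gp q) - hamiltonian \<alpha> 0 k p\<^sub>2\<bar> \<le> (\<epsilon> + 0 + \<bar>gp q - p\<^sub>2\<bar>) powr \<alpha>"
      using \<epsilon> by (intro hamiltonian_diff_le \<alpha> k) auto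
    also have "\<dots> \<le> (5 * \<kappa>) powr \<alpha>"
      using e4[OF dst(2)] \<epsilon> \<alpha> unfolding gp_def by (intro powr_mono2) auto
    finally have hd: "\<bar>hamiltonian \<alpha> \<epsilon> k (gp q) - hamiltonian \<alpha> 0 k p\<^sub>2\<bar> \<le> (5 * \<kappa>) powr \<alpha>" .
    have "\<bar>Wa \<epsilon> Z - W X\<bar> \<le> 2 * \<kappa>"
      using close[OF Z(1)] d2(2)[of Z] Zb r \<eta>(2) by (auto simp: dist_real_def dist_commute)
    then have wd: "\<bar>wa \<epsilon> s q - W X\<bar> \<le> 2 * \<kappa>" by (simp add: Wa_def Zsq)
    have m4: "\<bar>(hamiltonian \<alpha> \<epsilon> k (gp q) - hamiltonian \<alpha> 0 k p\<^sub>2) * wa \<epsilon> s q\<bar> \<le> (5 * \<kappa>) powr \<alpha> * (\<bar>W X\<bar> + 2 * \<kappa>)"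
      unfolding abs_mult using hd wd by (intro mult_mono) auto
    have m5: "\<bar>hamiltonian \<alpha> 0 k p\<^sub>2 * (wa \<epsilon> s q - W X)\<bar> \<le> 2 * \<kappa> * hamiltonian \<alpha> 0 k p\<^sub>2"
      unfolding abs_mult using mult_left_mono[OF wd nn] by (simp add: mult_ac)
    have m6: "hamiltonian \<alpha> 0 k p\<^sub>2 * W X = hamiltonian \<alpha> \<epsilon> k (gp q) * wa \<epsilon> s q
        - (hamiltonian \<alpha> \<epsilon> k (gp q) - hamiltonian \<alpha> 0 k p\<^sub>2) * wa \<epsilon> s q - hamiltonian \<alpha> 0 k p\<^sub>2 * (wa \<epsilon> s q - W X)"
      by (simp add: algebra_simps)
    have "p + x \<le> 5 * \<kappa> + G + E"
      if "p + z + y \<le> A" "A \<le> A'" "A' \<le> \<kappa>" "\<bar>z\<bar> \<le> 4 * \<kappa>" "\<bar>D\<bar> \<le> E" "\<bar>D'\<bar> \<le> G" "x = y - D - D'"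
      for p x z y A A' D D' E G :: real using that by linarith
    from this[OF m1[unfolded fp_def] m2 m3 e4[OF dst(1)] m4 m5 m6] show ?thesis .
  qed
  have "((\<lambda>\<kappa>. 5 * \<kappa> + 2 * \<kappa> * hamiltonian \<alpha> 0 k p\<^sub>2 + (5 * \<kappa>) powr \<alpha> * (\<bar>W X\<bar> + 2 * \<kappa>)) \<longlongrightarrow>
      5 * 0 + 2 * 0 * hamiltonian \<alpha> 0 k p\<^sub>2 + 0 * (\<bar>W X\<bar> + 2 * 0)) (at_right 0)"
  proof (intro tendsto_intros)
    show "((\<lambda>\<kappa>. (5 * \<kappa>) powr \<alpha>) \<longlongrightarrow> 0) (at_right 0)"
      by (rule tendsto_zero_powrI[OF _ tendsto_const])
         (use \<alpha> in \<open>auto intro!: tendsto_eq_intros simp: eventually_at_filter\<close>)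
  qed
  moreover have "\<forall>\<^sub>F \<kappa> in at_right 0. p\<^sub>1 + hamiltonian \<alpha> 0 k p\<^sub>2 * W X \<le>
      5 * \<kappa> + 2 * \<kappa> * hamiltonian \<alpha> 0 k p\<^sub>2 + (5 * \<kappa>) powr \<alpha> * (\<bar>W X\<bar> + 2 * \<kappa>)"
    using eventually_at_right_real[of 0 1] key by (auto elim!: eventually_mono)
  ultimately have "p\<^sub>1 + hamiltonian \<alpha> 0 k p\<^sub>2 * W X \<le> 5 * 0 + 2 * 0 * hamiltonian \<alpha> 0 k p\<^sub>2 + 0 * (\<bar>W X\<bar> + 2 * 0)"
    by (intro tendsto_lowerbound) auto
  then show ?thesis by (simp add: W_def X_def)
qed

subsection \<open>Time regularity and the Cauchy property\<close>

lemma classical_sub_shift: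
  assumes "classical_sub a \<epsilon> H w" "0 \<le> t\<^sub>1"
  shows "classical_sub a \<epsilon> H (\<lambda>t. w (t\<^sub>1 + t))"
  unfolding classical_sub_def
proof (intro allI impI)
  fix t \<rho> :: real assume t: "t > 0" "\<rho> > 0"
  then have "t\<^sub>1 + t > 0" using assms by simp
  then obtain p g A where *: "((\<lambda>s. w s \<rho>) has_real_derivative p) (at (t\<^sub>1 + t))"
     "\<forall>\<^sub>F r in nhds \<rho>. (w (t\<^sub>1 + t) has_real_derivative g r) (at r)"
     "(g has_real_derivative A) (at \<rho>)" "p + H (g \<rho>) * w (t\<^sub>1 + t) \<rho> \<le> \<epsilon> * a \<rho> * A"
    using assms(1) t(2) unfolding classical_sub_def by meson
  have "((\<lambda>s. w (t\<^sub>1 + s) \<rho>) has_real_derivative p) (at t)"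
    using DERIV_shift[of "\<lambda>s. w s \<rho>" p t t\<^sub>1] *(1)
    by (simp only: add.commute[of t t\<^sub>1] add.commute[of _ t\<^sub>1])
  with * show "\<exists>p g A. ((\<lambda>s. w (t\<^sub>1 + s) \<rho>) has_real_derivative p) (at t) \<and>
     (\<forall>\<^sub>F r in nhds \<rho>. (w (t\<^sub>1 + t) has_real_derivative g r) (at r)) \<and>
     (g has_real_derivative A) (at \<rho>) \<and> p + H (g \<rho>) * w (t\<^sub>1 + t) \<rho> \<le> \<epsilon> * a \<rho> * A"
    by blast
qed

text \<open>A criterion for barriers with constant speed in time: the test function must share that
  speed, so only slopes that touch the profile v from above remain to be checked.\<close>

lemma viscosity_sub_separated:
  assumes \<phi>: "\<And>t. 0 < t \<Longrightarrow> (\<phi> has_real_derivative c) (at t)"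
    and H: "\<And>t \<rho> g q. \<lbrakk>0 < t; 0 < \<rho>; (g has_real_derivative q) (at \<rho>);
        \<forall>\<^sub>F r in nhds \<rho>. v r - g r \<le> v \<rho> - g \<rho>\<rbrakk> \<Longrightarrow> c + H q * (v \<rho> + \<phi> t) \<le> 0"
  shows "viscosity_sub a 0 H (\<lambda>t r. v r + \<phi> t)"
  unfolding viscosity_sub_def
proof (intro allI impI)
  fix t \<rho> :: real and f p g g' A
  assume t: "t > 0" "\<rho> > 0" and f: "(f has_real_derivative p) (at t)"
    and g: "\<forall>\<^sub>F r in nhds \<rho>. (g has_real_derivative g' r) (at r)"
    and mx: "\<forall>\<^sub>F (s, r) in nhds (t, \<rho>). v r + \<phi> s - f s - g r \<le> v \<rho> + \<phi> t - f t - g \<rho>"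
  obtain P Q where PQ: "eventually P (nhds t)" "eventually Q (nhds \<rho>)"
      "\<And>s r. P s \<Longrightarrow> Q r \<Longrightarrow> v r + \<phi> s - f s - g r \<le> v \<rho> + \<phi> t - f t - g \<rho>"
    using mx unfolding nhds_prod eventually_prod_filter by auto
  note at = eventually_nhds_x_imp_x[OF PQ(1)] eventually_nhds_x_imp_x[OF PQ(2)]
  have "\<forall>\<^sub>F s in nhds t. \<phi> s - f s \<le> \<phi> t - f t"
    using PQ(1) by eventually_elim (use PQ(3)[of _ \<rho>] at in force)
  then obtain d where d: "d > 0" "\<And>s. \<bar>t - s\<bar> < d \<Longrightarrow> \<phi> s - f s \<le> \<phi> t - f t"
    by (auto simp: eventually_nhds_metric dist_real_def abs_minus_commute)
  have "c - p = 0"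
    by (rule DERIV_local_max[where f = "\<lambda>s. \<phi> s - f s" and d = d and x = t])
       (use d \<phi>[OF t(1)] f in \<open>auto intro!: derivative_eq_intros\<close>)
  moreover have "\<forall>\<^sub>F r in nhds \<rho>. v r - g r \<le> v \<rho> - g \<rho>"
    using PQ(2) by eventually_elim (use PQ(3)[of t] at in force)
  then have "c + H (g' \<rho>) * (v \<rho> + \<phi> t) \<le> 0"
    by (intro H[OF t eventually_nhds_x_imp_x[OF g]])
  ultimately show "p + H (g' \<rho>) * (v \<rho> + \<phi> t) \<le> 0 * a \<rho> * A" by simp
qed

text \<open>To the left of \<rho> the function v loses at most L per unit of volume; a steeper g
  would lose more and could not stay above.\<close>

lemma touching_slope_le:
  fixes v g :: "real \<Rightarrow> real"
  assumes lip: "\<And>r. 0 \<le> r \<Longrightarrow> r \<le> \<rho> \<Longrightarrow> v \<rho> - v r \<le> L * (\<rho> - r)" and "0 < \<rho>"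
    and g: "(g has_real_derivative q) (at \<rho>)"
    and mx: "\<forall>\<^sub>F r in nhds \<rho>. v r - g r \<le> v \<rho> - g \<rho>"
  shows "q \<le> L"
proof (rule ccontr)
  assume "\<not> q \<le> L"
  then have "((\<lambda>r. g r - L * r) has_real_derivative q - L) (at \<rho>)" "q - L > 0"
    using g by (auto intro!: derivative_eq_intros)
  then obtain d where d: "d > 0" "\<And>h. h > 0 \<Longrightarrow> h < d \<Longrightarrow> g (\<rho> - h) - L * (\<rho> - h) < g \<rho> - L * \<rho>"
    using DERIV_pos_inc_left by blast
  obtain d' where d': "d' > 0" "\<And>r. \<bar>r - \<rho>\<bar> < d' \<Longrightarrow> v r - g r \<le> v \<rho> - g \<rho>"
    using mx by (auto simp: eventually_nhds_metric dist_real_def)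
  define h where "h = min \<rho> (min d d') / 2"
  have h: "h > 0" "h < d" "h < d'" "h < \<rho>" using d d' \<open>0 < \<rho>\<close> by (auto simp: h_def)
  show False
    using d(2)[OF h(1,2)] d'(2)[of "\<rho> - h"] lip[of "\<rho> - h"] h by (auto simp: algebra_simps)
qed

section \<open>Estimates for the whole family, with constants independent of \<epsilon>\<close>

locale regularised_family =
  fixes \<alpha> :: real and a :: "real \<Rightarrow> real" and L M\<^sub>0 :: real and m\<^sub>0 :: "real \<Rightarrow> real"
    and m :: "real \<Rightarrow> real \<Rightarrow> real \<Rightarrow> real"
  assumes masses: "\<And>\<epsilon>. 0 < \<epsilon> \<Longrightarrow> regularised_mass \<alpha> a L M\<^sub>0 \<epsilon> (m \<epsilon>)"
    and initial: "\<And>\<epsilon> r. 0 < \<epsilon> \<Longrightarrow> 0 \<le> r \<Longrightarrow> m \<epsilon> 0 r = m\<^sub>0 r"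
begin

lemma \<alpha>: "0 < \<alpha>" "\<alpha> \<le> 1" and L: "0 \<le> L" and M0: "0 \<le> M\<^sub>0"
  using masses[of 1] by (auto simp: regularised_mass_def)

lemma a_mono: "\<forall>r\<ge>0. \<forall>s\<ge>r. 0 \<le> a r \<and> a r \<le> a s"
  using masses[of 1] by (auto simp: regularised_mass_def)

context
  fixes \<epsilon> :: real assumes \<epsilon>: "0 < \<epsilon>"
begin

interpretation regularised_mass \<alpha> a L M\<^sub>0 \<epsilon> "m \<epsilon>" by (rule masses[OF \<epsilon>])

lemma reg:
  "continuous_on quadrant (\<lambda>(t, r). m \<epsilon> t r)" "continuous_on quadrant (\<lambda>(t, r). - m \<epsilon> t r)"
  "classical_sub a \<epsilon> (hamiltonian \<alpha> \<epsilon> 1) (m \<epsilon>)" "classical_sub a \<epsilon> (hamiltonian \<alpha> \<epsilon> (- 1)) (\<lambda>t r. - m \<epsilon> t r)"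
  "viscosity_sub a \<epsilon> (hamiltonian \<alpha> \<epsilon> 1) (m \<epsilon>)" "viscosity_sub a \<epsilon> (hamiltonian \<alpha> \<epsilon> (- 1)) (\<lambda>t r. - m \<epsilon> t r)"
  using cont cont_uminus sub super classical_sub_imp_viscosity_sub[OF sub] classical_sub_imp_viscosity_sub[OF super] \<epsilon> a_nonneg
  by auto

lemma reg_bounds:
  assumes "0 \<le> t" "0 \<le> r"
  shows "0 \<le> m \<epsilon> t r" "m \<epsilon> t r \<le> M\<^sub>0" "\<bar>m \<epsilon> t r\<bar> \<le> M\<^sub>0" "m \<epsilon> t r \<le> L * r" "m \<epsilon> t 0 = 0"
  using m_nonneg[OF assms] m_le[OF assms] m_le_linear[OF assms] m_zero[OF assms(1)] by auto

lemma reg_increment: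
  assumes "0 \<le> t" "0 \<le> r" "0 \<le> q"
  shows "m \<epsilon> t r - m \<epsilon> t q \<le> L * max (r - q) 0" "m \<epsilon> t r - m \<epsilon> t q \<le> L * \<bar>r - q\<bar>"
proof -
  show 1: "m \<epsilon> t r - m \<epsilon> t q \<le> L * max (r - q) 0" by (rule increment_le[OF assms])
  show "m \<epsilon> t r - m \<epsilon> t q \<le> L * \<bar>r - q\<bar>"
    by (rule order_trans[OF 1 mult_left_mono[OF _ L]]) auto
qed

end

text \<open>A penalty parameter for which Young's inequality loses at most e: the loss is e L^2 /
  (L^2 + 1). The added 1 covers L = 0.\<close>

definition width :: "real \<Rightarrow> real" where
  "width e = 2 * e / (L\<^sup>2 + 1)"

lemma width:
  assumes "0 < e"
  shows "0 < width e" "L * \<bar>x\<bar> \<le> e + x\<^sup>2 / (2 * width e)"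
proof -
  have p: "0 < L\<^sup>2 + 1" by (simp add: add_nonneg_pos)
  then show w: "0 < width e" using assms by (simp add: width_def)
  have "L\<^sup>2 * (2 * e / K) / 2 = e * (L\<^sup>2 / K)" for K by simp
  then have "L\<^sup>2 * (2 * e / (L\<^sup>2 + 1)) / 2 = e * (L\<^sup>2 / (L\<^sup>2 + 1))" .
  also have "\<dots> \<le> e * 1" using assms p by (intro mult_left_mono) (auto simp: divide_le_eq)
  finally have "L\<^sup>2 * width e / 2 \<le> e" by (simp add: width_def)
  then show "L * \<bar>x\<bar> \<le> e + x\<^sup>2 / (2 * width e)" using young_le[OF w, of L e "\<bar>x\<bar>"] by simp
qed

text \<open>A one-sided bound suffices, as the two parameters may be exchanged. On the parabolic
  boundary the masses differ by at most L |r - q|: at time 0 they share a Lipschitz datum, and at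
  volume 0 one of them vanishes while the other lies between 0 and L times its volume.\<close>

lemma cauchy:
  assumes "0 < e" "0 < T" "0 < R"
  obtains \<delta> where "0 < \<delta>"
    "\<And>\<epsilon>\<^sub>1 \<epsilon>\<^sub>2 t r. \<lbrakk>0 < \<epsilon>\<^sub>1; \<epsilon>\<^sub>1 < \<delta>; 0 < \<epsilon>\<^sub>2; \<epsilon>\<^sub>2 < \<delta>; t \<in> {0..T}; r \<in> {0..R}\<rbrakk>
       \<Longrightarrow> m \<epsilon>\<^sub>1 t r - m \<epsilon>\<^sub>2 t r \<le> 3 * e"
proof -
  have N: "0 < M\<^sub>0 + 1" using M0 by simp
  obtain \<delta> where \<delta>: "\<delta> > 0"
    "\<And>k \<epsilon>\<^sub>1 \<epsilon>\<^sub>2 w\<^sub>1 w\<^sub>2 t r. \<lbrakk>\<bar>k\<bar> \<le> 1; 0 \<le> \<epsilon>\<^sub>1; \<epsilon>\<^sub>1 < \<delta>; 0 \<le> \<epsilon>\<^sub>2; \<epsilon>\<^sub>2 < \<delta>;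
       comparable \<alpha> a (T + 1) (M\<^sub>0 + 1) (width e) e k \<epsilon>\<^sub>1 \<epsilon>\<^sub>2 w\<^sub>1 w\<^sub>2; t \<in> {0..T}; r \<in> {0..R}\<rbrakk>
       \<Longrightarrow> w\<^sub>1 t r + w\<^sub>2 t r \<le> 3 * e"
    using comparison_uniform[OF \<alpha> a_mono assms(2,3) N width(1)[OF assms(1)] assms(1)] by metis
  show thesis
  proof (rule that[OF \<delta>(1)])
    fix \<epsilon>\<^sub>1 \<epsilon>\<^sub>2 t r :: real
    assume e1: "0 < \<epsilon>\<^sub>1" "\<epsilon>\<^sub>1 < \<delta>" and e2: "0 < \<epsilon>\<^sub>2" "\<epsilon>\<^sub>2 < \<delta>" and tr: "t \<in> {0..T}" "r \<in> {0..R}"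
    have "comparable \<alpha> a (T + 1) (M\<^sub>0 + 1) (width e) e 1 \<epsilon>\<^sub>1 \<epsilon>\<^sub>2 (m \<epsilon>\<^sub>1) (\<lambda>t r. - m \<epsilon>\<^sub>2 t r)"
      unfolding comparable_def
    proof (intro conjI ballI allI impI)
      fix t r q :: real assume h: "t \<in> {0..<T + 1}" "0 \<le> r" "0 \<le> q" "t = 0 \<or> r = 0 \<or> q = 0"
      then have "m \<epsilon>\<^sub>1 t r - m \<epsilon>\<^sub>2 t q \<le> L * \<bar>r - q\<bar>"
      proof (elim disjE)
        assume "t = 0"
        then show ?thesis
          using reg_increment(2)[OF e1(1), of 0 r q] h initial e1 e2 by simp
      next
        assume "r = 0"
        then show ?thesis
          using reg_bounds(5)[OF e1(1), of t 0] reg_bounds(1)[OF e2(1), of t q] h mult_nonneg_nonneg[OF L h(3)] by simp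
      next
        assume "q = 0"
        then show ?thesis using reg_bounds[OF e1(1), of t r] reg_bounds[OF e2(1), of t 0] h by simp
      qed
      then show "m \<epsilon>\<^sub>1 t r + - m \<epsilon>\<^sub>2 t q \<le> e + (r - q)\<^sup>2 / (2 * width e)"
        using width(2)[OF assms(1), of "r - q"] by linarith
    qed (use reg[OF e1(1)] reg[OF e2(1)] in \<open>auto intro!: order_trans[OF reg_bounds(3)] e1 e2\<close>)
    then show "m \<epsilon>\<^sub>1 t r - m \<epsilon>\<^sub>2 t r \<le> 3 * e"
      using \<delta>(2)[of 1 \<epsilon>\<^sub>1 \<epsilon>\<^sub>2 "m \<epsilon>\<^sub>1" "\<lambda>t r. - m \<epsilon>\<^sub>2 t r" t r] e1 e2 tr by simp
  qed
qed

text \<open>The barriers are \<open>m(t\<^sub>1, r) - L\<^sup>\<alpha> M\<^sub>0 t\<close> and \<open>m(t\<^sub>1, r)\<close>: being Lipschitz and nondecreasing in \<open>r\<close>,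
  they are a viscosity sub- and supersolution of the limit equation.\<close>

lemma time_regularity:
  assumes "0 < e" "0 < T" "0 < R"
  shows "\<exists>\<delta>>0. \<forall>\<epsilon> t\<^sub>1 t r. 0 < \<epsilon> \<and> \<epsilon> < \<delta> \<and> 0 \<le> t\<^sub>1 \<and> t \<in> {0..T} \<and> r \<in> {0..R} \<longrightarrow>
       m \<epsilon> (t\<^sub>1 + t) r \<le> m \<epsilon> t\<^sub>1 r + 3 * e \<and>
       m \<epsilon> t\<^sub>1 r \<le> m \<epsilon> (t\<^sub>1 + t) r + L powr \<alpha> * M\<^sub>0 * t + 3 * e"
proof -
  define C where "C = L powr \<alpha> * M\<^sub>0"
  \<comment> \<open>Includes the descent C t of the lower barrier up to the horizon T + 1.\<close>
  define N where "N = M\<^sub>0 + 1 + C * (T + 1)"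
  have C: "0 \<le> C" using M0 by (simp add: C_def)
  have "0 \<le> C * (T + 1)" using C assms by simp
  then have N: "0 < N" "M\<^sub>0 \<le> N" using M0 unfolding N_def by linarith+
  obtain \<delta> where \<delta>: "\<delta> > 0"
    "\<And>k \<epsilon>\<^sub>1 \<epsilon>\<^sub>2 w\<^sub>1 w\<^sub>2 t r. \<lbrakk>\<bar>k\<bar> \<le> 1; 0 \<le> \<epsilon>\<^sub>1; \<epsilon>\<^sub>1 < \<delta>; 0 \<le> \<epsilon>\<^sub>2; \<epsilon>\<^sub>2 < \<delta>;
       comparable \<alpha> a (T + 1) N (width e) e k \<epsilon>\<^sub>1 \<epsilon>\<^sub>2 w\<^sub>1 w\<^sub>2; t \<in> {0..T}; r \<in> {0..R}\<rbrakk>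
       \<Longrightarrow> w\<^sub>1 t r + w\<^sub>2 t r \<le> 3 * e"
    using comparison_uniform[OF \<alpha> a_mono assms(2,3) N(1) width(1)[OF assms(1)] assms(1)] by metis
  show ?thesis
  proof (intro exI[of _ \<delta>] conjI \<delta>(1) allI impI; elim conjE)
    fix \<epsilon> t\<^sub>1 t r :: real
    assume e: "0 < \<epsilon>" "\<epsilon> < \<delta>" and t1: "0 \<le> t\<^sub>1" and tr: "t \<in> {0..T}" "r \<in> {0..R}"
    have c1: "continuous_on quadrant (\<lambda>(t, r). m \<epsilon> t\<^sub>1 r)"
      unfolding case_prod_beta using t1
      by (intro continuous_on_compose2[OF reg(1)[OF e(1)], of quadrant "\<lambda>x. (t\<^sub>1, snd x)", simplified])
         (auto intro!: continuous_intros)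
    have c2: "continuous_on quadrant (\<lambda>(t, r). m \<epsilon> (t\<^sub>1 + t) r)"
      unfolding case_prod_beta using t1
      by (intro continuous_on_compose2[OF reg(1)[OF e(1)], of quadrant "\<lambda>x. (t\<^sub>1 + fst x, snd x)", simplified])
         (auto intro!: continuous_intros)
    note bnd = reg_bounds[OF e(1)] and inc = reg_increment(2)[OF e(1)]
    have bdry: "m \<epsilon> t\<^sub>1 r - m \<epsilon> (t\<^sub>1 + t) q \<le> e + (r - q)\<^sup>2 / (2 * width e)"
        "m \<epsilon> (t\<^sub>1 + t) q - m \<epsilon> t\<^sub>1 r \<le> e + (r - q)\<^sup>2 / (2 * width e)"
      if h: "0 \<le> t" "0 \<le> r" "0 \<le> q" "t = 0 \<or> r = 0 \<or> q = 0" for t r q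
    proof -
      have "m \<epsilon> t\<^sub>1 r - m \<epsilon> (t\<^sub>1 + t) q \<le> L * \<bar>r - q\<bar> \<and> m \<epsilon> (t\<^sub>1 + t) q - m \<epsilon> t\<^sub>1 r \<le> L * \<bar>r - q\<bar>"
        using h(4)
      proof (elim disjE)
        assume "t = 0"
        then show ?thesis using inc[OF t1, of r q] inc[OF t1, of q r] h by (simp add: abs_minus_commute)
      next
        assume "r = 0"
        then show ?thesis
          using bnd[OF t1, of 0] bnd(1,4)[of "t\<^sub>1 + t" q] h t1 L mult_nonneg_nonneg[OF L h(3)] by simp
      next
        assume "q = 0"
        then show ?thesis
          using bnd(1,4)[OF t1, of r] bnd[of "t\<^sub>1 + t" 0] h t1 L mult_nonneg_nonneg[OF L h(2)] by simp
      qed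
      then show "m \<epsilon> t\<^sub>1 r - m \<epsilon> (t\<^sub>1 + t) q \<le> e + (r - q)\<^sup>2 / (2 * width e)"
        "m \<epsilon> (t\<^sub>1 + t) q - m \<epsilon> t\<^sub>1 r \<le> e + (r - q)\<^sup>2 / (2 * width e)"
        using width(2)[OF assms(1), of "r - q"] by linarith+
    qed
    \<comment> \<open>The stationary barrier: the function is nonpositive, so its zeroth order term
      has the right sign for every slope.\<close>
    have v1: "viscosity_sub a 0 (hamiltonian \<alpha> 0 (- 1)) (\<lambda>t r. - m \<epsilon> t\<^sub>1 r + 0)"
      by (rule viscosity_sub_separated[where c = 0]) (use bnd(1)[OF t1] in auto)
    have "comparable \<alpha> a (T + 1) N (width e) e (- 1) 0 \<epsilon> (\<lambda>t r. - m \<epsilon> t\<^sub>1 r) (\<lambda>t r. m \<epsilon> (t\<^sub>1 + t) r)"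
      unfolding comparable_def
    proof (intro conjI ballI allI impI)
      show "viscosity_sub a 0 (hamiltonian \<alpha> 0 (- 1)) (\<lambda>t r. - m \<epsilon> t\<^sub>1 r)" using v1 by simp
      show "classical_sub a \<epsilon> (hamiltonian \<alpha> \<epsilon> (- (- 1))) (\<lambda>t. m \<epsilon> (t\<^sub>1 + t))"
        using classical_sub_shift[OF reg(3)[OF e(1)] t1] by simp
      show "continuous_on quadrant (\<lambda>(t, r). - m \<epsilon> t\<^sub>1 r)"
        using continuous_on_minus[OF c1] by (simp add: case_prod_beta)
      show "continuous_on quadrant (\<lambda>(t, r). m \<epsilon> (t\<^sub>1 + t) r)" by (rule c2)
    next
      fix t r :: real assume "t \<in> {0..<T + 1}" "0 \<le> r"
      then show "\<bar>- m \<epsilon> t\<^sub>1 r\<bar> \<le> N" "\<bar>m \<epsilon> (t\<^sub>1 + t) r\<bar> \<le> N"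
        using bnd(3)[of t\<^sub>1 r] bnd(3)[of "t\<^sub>1 + t" r] t1 N by auto
    next
      fix t r q :: real assume "t \<in> {0..<T + 1}" "0 \<le> r" "0 \<le> q" "t = 0 \<or> r = 0 \<or> q = 0"
      then show "- m \<epsilon> t\<^sub>1 r + m \<epsilon> (t\<^sub>1 + t) q \<le> e + (r - q)\<^sup>2 / (2 * width e)"
        using bdry(2)[of t r q] by simp
    qed
    then show "m \<epsilon> (t\<^sub>1 + t) r \<le> m \<epsilon> t\<^sub>1 r + 3 * e"
      using \<delta>(2)[of "- 1" 0 \<epsilon> _ _ t r] e tr by fastforce
    have v2: "viscosity_sub a 0 (hamiltonian \<alpha> 0 1) (\<lambda>t r. m \<epsilon> t\<^sub>1 r + - C * t)"
    proof (rule viscosity_sub_separated[where c = "- C"])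
      fix t \<rho> q :: real and g
      assume h: "0 < t" "0 < \<rho>" "(g has_real_derivative q) (at \<rho>)"
        "\<forall>\<^sub>F r in nhds \<rho>. m \<epsilon> t\<^sub>1 r - g r \<le> m \<epsilon> t\<^sub>1 \<rho> - g \<rho>"
      \<comment> \<open>The Lipschitz bound in volume caps the slope of touching functions, so the
        mass can be consumed at rate at most \<open>L powr \<alpha> * M\<^sub>0\<close>; hence the
        constant C.\<close>
      have "q \<le> L"
        using inc[OF t1, of \<rho>] h(2) by (intro touching_slope_le[OF _ h(2-4)]) force
      then have "hamiltonian \<alpha> 0 1 q \<le> L powr \<alpha>" using \<alpha> L by (auto simp: hamiltonian_def intro!: powr_mono2)
      moreover have "0 \<le> C * t" using C h by simp
      then have "m \<epsilon> t\<^sub>1 \<rho> + - C * t \<le> M\<^sub>0" using bnd(2)[OF t1, of \<rho>] h by simp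
      then have "hamiltonian \<alpha> 0 1 q * (m \<epsilon> t\<^sub>1 \<rho> + - C * t) \<le> hamiltonian \<alpha> 0 1 q * M\<^sub>0"
        by (intro mult_left_mono) auto
      moreover have "hamiltonian \<alpha> 0 1 q * M\<^sub>0 \<le> L powr \<alpha> * M\<^sub>0"
        using calculation(1) M0 by (intro mult_right_mono)
      ultimately have "hamiltonian \<alpha> 0 1 q * (m \<epsilon> t\<^sub>1 \<rho> + - C * t) \<le> L powr \<alpha> * M\<^sub>0" by linarith
      then show "- C + hamiltonian \<alpha> 0 1 q * (m \<epsilon> t\<^sub>1 \<rho> + - C * t) \<le> 0" by (simp add: C_def)
    qed (auto intro!: derivative_eq_intros)
    have "comparable \<alpha> a (T + 1) N (width e) e 1 0 \<epsilon> (\<lambda>t r. m \<epsilon> t\<^sub>1 r + - C * t) (\<lambda>t r. - m \<epsilon> (t\<^sub>1 + t) r)"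
      unfolding comparable_def
    proof (intro conjI ballI allI impI)
      show "viscosity_sub a 0 (hamiltonian \<alpha> 0 1) (\<lambda>t r. m \<epsilon> t\<^sub>1 r + - C * t)" by (rule v2)
      show "classical_sub a \<epsilon> (hamiltonian \<alpha> \<epsilon> (- 1)) (\<lambda>t r. - m \<epsilon> (t\<^sub>1 + t) r)"
        using classical_sub_shift[OF reg(4)[OF e(1)] t1] by simp
      show "continuous_on quadrant (\<lambda>(t, r). m \<epsilon> t\<^sub>1 r + - C * t)"
        using c1 unfolding case_prod_beta by (intro continuous_intros)
      show "continuous_on quadrant (\<lambda>(t, r). - m \<epsilon> (t\<^sub>1 + t) r)"
        using continuous_on_minus[OF c2] by (simp add: case_prod_beta)
    next
      fix t r :: real assume h: "t \<in> {0..<T + 1}" "0 \<le> r"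
      have "C * t \<le> C * (T + 1)" "0 \<le> C * t" using h C by (auto intro: mult_left_mono)
      then show "\<bar>m \<epsilon> t\<^sub>1 r + - C * t\<bar> \<le> N"
        using bnd(1,2)[OF t1 h(2)] unfolding N_def by auto
      show "\<bar>- m \<epsilon> (t\<^sub>1 + t) r\<bar> \<le> N"
        using bnd(3)[of "t\<^sub>1 + t" r] t1 N h by auto
    next
      fix t r q :: real assume h: "t \<in> {0..<T + 1}" "0 \<le> r" "0 \<le> q" "t = 0 \<or> r = 0 \<or> q = 0"
      have "0 \<le> C * t" using h C by simp
      then show "m \<epsilon> t\<^sub>1 r + - C * t + - m \<epsilon> (t\<^sub>1 + t) q \<le> e + (r - q)\<^sup>2 / (2 * width e)"
        using bdry(1)[of t r q] h by simp
    qed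
    then have "m \<epsilon> t\<^sub>1 r + - C * t + - m \<epsilon> (t\<^sub>1 + t) r \<le> 3 * e"
      using \<delta>(2)[of 1 0 \<epsilon> "\<lambda>t r. m \<epsilon> t\<^sub>1 r + - C * t" "\<lambda>t r. - m \<epsilon> (t\<^sub>1 + t) r" t r] e tr by simp
    then show "m \<epsilon> t\<^sub>1 r \<le> m \<epsilon> (t\<^sub>1 + t) r + L powr \<alpha> * M\<^sub>0 * t + 3 * e"
      by (simp add: C_def)
  qed
qed

end

subsection \<open>The limit of the regularised masses\<close>

context regularised_family
begin

text \<open>A limit along the parameters 1 / (n + 1), to have a definite value at each point;
  convergence of the full family is a consequence of the Cauchy property.\<close>

definition limit_mass :: "real \<Rightarrow> real \<Rightarrow> real" where
  "limit_mass t r = lim (\<lambda>n. m (inverse (real (Suc n))) t r)"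

lemma uniform_convergence:
  assumes "0 < e" "0 < T" "0 < R"
  shows "\<exists>\<delta>>0. \<forall>\<epsilon>. 0 < \<epsilon> \<and> \<epsilon> < \<delta> \<longrightarrow> (\<forall>t\<in>{0..T}. \<forall>r\<in>{0..R}. \<bar>m \<epsilon> t r - limit_mass t r\<bar> \<le> e)"
proof -
  have conv: "(\<lambda>n. m (inverse (real (Suc n))) t r) \<longlonglongrightarrow> limit_mass t r" if "t \<in> {0..T}" "r \<in> {0..R}" for t r
  proof -
    have "Cauchy (\<lambda>n. m (inverse (real (Suc n))) t r)"
    proof (rule metric_CauchyI)
      fix e' :: real assume "e' > 0"
      then obtain \<delta> where \<delta>: "0 < \<delta>" "\<And>\<epsilon>\<^sub>1 \<epsilon>\<^sub>2 t r. \<lbrakk>0 < \<epsilon>\<^sub>1; \<epsilon>\<^sub>1 < \<delta>; 0 < \<epsilon>\<^sub>2; \<epsilon>\<^sub>2 < \<delta>; t \<in> {0..T}; r \<in> {0..R}\<rbrakk>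
       \<Longrightarrow> m \<epsilon>\<^sub>1 t r - m \<epsilon>\<^sub>2 t r \<le> 3 * (e' / 4)"
        using cauchy[of "e' / 4" T R] assms by auto
      obtain n0 where n0: "inverse (real (Suc n0)) < \<delta>" using reals_Archimedean[OF \<delta>(1)] by blast
      have sm: "inverse (real (Suc n)) < \<delta>" if "n \<ge> n0" for n
        using that n0 by (intro le_less_trans[OF _ n0] le_imp_inverse_le) auto
      show "\<exists>n1. \<forall>k\<ge>n1. \<forall>n\<ge>n1. dist (m (inverse (real (Suc k))) t r) (m (inverse (real (Suc n))) t r) < e'"
      proof (intro exI[of _ n0] allI impI)
        fix k n assume "n0 \<le> k" "n0 \<le> n"
        then have "m (inverse (real (Suc k))) t r - m (inverse (real (Suc n))) t r \<le> 3 * (e' / 4)"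
          "m (inverse (real (Suc n))) t r - m (inverse (real (Suc k))) t r \<le> 3 * (e' / 4)"
          using that sm by (intro \<delta>(2); simp)+
        then have "\<bar>m (inverse (real (Suc k))) t r - m (inverse (real (Suc n))) t r\<bar> \<le> 3 * (e' / 4)"
          by linarith
        then show "dist (m (inverse (real (Suc k))) t r) (m (inverse (real (Suc n))) t r) < e'"
          using \<open>e' > 0\<close> by (simp add: dist_real_def)
      qed
    qed
    then show ?thesis unfolding limit_mass_def by (simp add: Cauchy_convergent_iff convergent_LIMSEQ_iff)
  qed
  obtain \<delta> where \<delta>: "0 < \<delta>" "\<And>\<epsilon>\<^sub>1 \<epsilon>\<^sub>2 t r. \<lbrakk>0 < \<epsilon>\<^sub>1; \<epsilon>\<^sub>1 < \<delta>; 0 < \<epsilon>\<^sub>2; \<epsilon>\<^sub>2 < \<delta>; t \<in> {0..T}; r \<in> {0..R}\<rbrakk>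
       \<Longrightarrow> m \<epsilon>\<^sub>1 t r - m \<epsilon>\<^sub>2 t r \<le> 3 * (e / 3)"
    using cauchy[of "e / 3" T R] assms by auto
  \<comment> \<open>Letting the second parameter tend to 0 along the sequence preserves the Cauchy
    bound, with one \<delta> for all points of the rectangle.\<close>
  have ev: "\<forall>\<^sub>F n in sequentially. inverse (real (Suc n)) < \<delta>"
    using order_tendstoD(2)[OF LIMSEQ_inverse_real_of_nat \<delta>(1)] .
  show ?thesis
  proof (intro exI[of _ \<delta>] conjI \<delta>(1) allI impI ballI; elim conjE)
    fix \<epsilon> t r assume h: "0 < \<epsilon>" "\<epsilon> < \<delta>" "t \<in> {0..T}" "r \<in> {0..R}"
    have l: "(\<lambda>n. \<bar>m \<epsilon> t r - m (inverse (real (Suc n))) t r\<bar>) \<longlonglongrightarrow> \<bar>m \<epsilon> t r - limit_mass t r\<bar>"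
      by (intro tendsto_intros conv h)
    have "\<forall>\<^sub>F n in sequentially. \<bar>m \<epsilon> t r - m (inverse (real (Suc n))) t r\<bar> \<le> e"
      using ev
    proof eventually_elim
      case (elim n)
      have "m \<epsilon> t r - m (inverse (real (Suc n))) t r \<le> 3 * (e / 3)"
        "m (inverse (real (Suc n))) t r - m \<epsilon> t r \<le> 3 * (e / 3)"
        using elim h by (intro \<delta>(2); simp)+
      then show ?case by linarith
    qed
    then show "\<bar>m \<epsilon> t r - limit_mass t r\<bar> \<le> e" by (intro tendsto_upperbound[OF l]) auto
  qed
qed

lemma eventually_close:
  assumes "0 < e"
  shows "\<forall>\<^sub>F \<epsilon> in at_right 0. 0 < \<epsilon> \<and> (\<forall>t\<in>{0..T}. \<forall>r\<in>{0..R}. \<bar>m \<epsilon> t r - limit_mass t r\<bar> \<le> e)"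
proof -
  have pos: "0 < max T 1" "0 < max R 1" by auto
  obtain \<delta> where \<delta>: "\<delta> > 0" "\<forall>\<epsilon>. 0 < \<epsilon> \<and> \<epsilon> < \<delta> \<longrightarrow>
      (\<forall>t\<in>{0..max T 1}. \<forall>r\<in>{0..max R 1}. \<bar>m \<epsilon> t r - limit_mass t r\<bar> \<le> e)"
    using uniform_convergence[OF assms pos] by blast
  have "\<forall>\<^sub>F \<epsilon> in at_right 0. \<epsilon> \<in> {0<..<\<delta>}" by (rule eventually_at_right_real[OF \<delta>(1)])
  then show ?thesis by eventually_elim (use \<delta>(2) in auto)
qed

lemma pointwise:
  assumes "0 \<le> t" "0 \<le> r"
  shows "((\<lambda>\<epsilon>. m \<epsilon> t r) \<longlongrightarrow> limit_mass t r) (at_right 0)"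
proof (rule tendstoI)
  fix e :: real assume "e > 0"
  then have "\<forall>\<^sub>F \<epsilon> in at_right 0. 0 < \<epsilon> \<and> (\<forall>t\<in>{0..t}. \<forall>r\<in>{0..r}. \<bar>m \<epsilon> t r - limit_mass t r\<bar> \<le> e / 2)"
    by (intro eventually_close) auto
  then show "\<forall>\<^sub>F \<epsilon> in at_right 0. dist (m \<epsilon> t r) (limit_mass t r) < e"
    by eventually_elim (use assms \<open>e > 0\<close> in \<open>force simp: dist_real_def\<close>)
qed

lemma pos_eventually: "\<forall>\<^sub>F \<epsilon>::real in at_right 0. 0 < \<epsilon>"
  by (simp add: eventually_at_filter)

lemma limit_mass_bounds:
  assumes "0 \<le> t" "0 \<le> r"
  shows "0 \<le> limit_mass t r" "limit_mass t r \<le> M\<^sub>0" "limit_mass t 0 = 0" "limit_mass 0 r = m\<^sub>0 r"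
proof -
  show "0 \<le> limit_mass t r"
    by (rule tendsto_lowerbound[OF pointwise[OF assms]])
       (use pos_eventually reg_bounds(1) assms in \<open>auto elim!: eventually_mono\<close>)
  show "limit_mass t r \<le> M\<^sub>0"
    by (rule tendsto_upperbound[OF pointwise[OF assms]])
       (use pos_eventually reg_bounds(2) assms in \<open>auto elim!: eventually_mono\<close>)
  have "((\<lambda>\<epsilon>. m \<epsilon> t 0) \<longlongrightarrow> 0) (at_right 0)"
    by (rule tendsto_eventually) (use pos_eventually reg_bounds(5) assms in \<open>auto elim!: eventually_mono\<close>)
  then show "limit_mass t 0 = 0" using tendsto_unique[OF _ pointwise[OF assms(1) order_refl]] by auto
  have "((\<lambda>\<epsilon>. m \<epsilon> 0 r) \<longlongrightarrow> m\<^sub>0 r) (at_right 0)"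
    by (rule tendsto_eventually) (use pos_eventually initial assms in \<open>auto elim!: eventually_mono\<close>)
  then show "limit_mass 0 r = m\<^sub>0 r" using tendsto_unique[OF _ pointwise[OF order_refl assms(2)]] by auto
qed

lemma limit_mass_lipschitz_volume:
  assumes "0 \<le> t" "0 \<le> r" "0 \<le> q"
  shows "\<bar>limit_mass t r - limit_mass t q\<bar> \<le> L * \<bar>r - q\<bar>"
proof -
  have *: "limit_mass t r - limit_mass t q \<le> L * \<bar>r - q\<bar>" if "0 \<le> r" "0 \<le> q" for r q
    by (rule tendsto_upperbound[OF tendsto_diff[OF pointwise[OF assms(1) that(1)] pointwise[OF assms(1) that(2)]]])
       (use pos_eventually reg_increment(2) assms that in \<open>auto elim!: eventually_mono\<close>)
  show ?thesis using *[of r q] *[of q r] assms by (simp add: abs_le_iff abs_minus_commute)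
qed

text \<open>The error 3 e of the regularised estimate disappears by letting \<epsilon> \<rightarrow>
  0 for fixed e and only afterwards e \<rightarrow> 0, since the threshold for \<epsilon> depends on
  e.\<close>

lemma limit_mass_lipschitz_time:
  assumes "0 \<le> s" "0 \<le> t" "0 \<le> r"
  shows "\<bar>limit_mass s r - limit_mass t r\<bar> \<le> L powr \<alpha> * M\<^sub>0 * \<bar>s - t\<bar>"
proof -
  have *: "limit_mass (s + h) r \<le> limit_mass s r + 3 * e \<and> limit_mass s r \<le> limit_mass (s + h) r + L powr \<alpha> * M\<^sub>0 * h + 3 * e"
    if h: "0 \<le> s" "0 \<le> h" "0 < e" for s h e
  proof -
    have pos: "0 < h + 1" "0 < r + 1" using h assms by auto
    obtain \<delta> where \<delta>: "0 < \<delta>"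
      "\<And>\<epsilon> t\<^sub>1 t r'. \<lbrakk>0 < \<epsilon>; \<epsilon> < \<delta>; 0 \<le> t\<^sub>1; t \<in> {0..h + 1}; r' \<in> {0..r + 1}\<rbrakk>
       \<Longrightarrow> m \<epsilon> (t\<^sub>1 + t) r' \<le> m \<epsilon> t\<^sub>1 r' + 3 * e \<and>
           m \<epsilon> t\<^sub>1 r' \<le> m \<epsilon> (t\<^sub>1 + t) r' + L powr \<alpha> * M\<^sub>0 * t + 3 * e"
      using time_regularity[OF h(3) pos] by metis
    have ev: "\<forall>\<^sub>F \<epsilon> in at_right 0. \<epsilon> \<in> {0<..<\<delta>}" by (rule eventually_at_right_real[OF \<delta>(1)])
    have p: "((\<lambda>\<epsilon>. m \<epsilon> s r) \<longlongrightarrow> limit_mass s r) (at_right 0)" "((\<lambda>\<epsilon>. m \<epsilon> (s + h) r) \<longlongrightarrow> limit_mass (s + h) r) (at_right 0)"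
      using h assms by (auto intro!: pointwise)
    have "limit_mass (s + h) r \<le> limit_mass s r + 3 * e"
      by (rule tendsto_le[OF _ tendsto_add[OF p(1) tendsto_const] p(2)])
         (use ev \<delta>(2)[of _ s h r] h assms in \<open>auto elim!: eventually_mono\<close>)
    moreover have "limit_mass s r \<le> limit_mass (s + h) r + (L powr \<alpha> * M\<^sub>0 * h + 3 * e)"
      by (rule tendsto_le[OF _ tendsto_add[OF p(2) tendsto_const] p(1)])
         (use ev \<delta>(2)[of _ s h r] h assms in \<open>auto elim!: eventually_mono simp: add.assoc\<close>)
    ultimately show ?thesis by simp
  qed
  have **: "\<bar>limit_mass (s + h) r - limit_mass s r\<bar> \<le> L powr \<alpha> * M\<^sub>0 * h" if "0 \<le> s" "0 \<le> h" for s h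
  proof (rule field_le_epsilon)
    fix e :: real assume "e > 0"
    have "0 \<le> L powr \<alpha> * M\<^sub>0 * h" using M0 that by simp
    then show "\<bar>limit_mass (s + h) r - limit_mass s r\<bar> \<le> L powr \<alpha> * M\<^sub>0 * h + e"
      using *[OF that, of "e / 3"] \<open>e > 0\<close> by (simp add: abs_le_iff)
  qed
  show ?thesis
    using **[of s "t - s"] **[of t "s - t"] assms by (cases "s \<le> t") (auto simp: abs_minus_commute)
qed

lemma limit_mass_lipschitz:
  assumes "X \<in> quadrant" "Y \<in> quadrant"
  shows "dist (case_prod limit_mass X) (case_prod limit_mass Y) \<le> (L + L powr \<alpha> * M\<^sub>0) * dist X Y"
proof -
  obtain t r s q where XY: "X = (t, r)" "Y = (s, q)" by (cases X, cases Y)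
  have nn: "0 \<le> t" "0 \<le> r" "0 \<le> s" "0 \<le> q" using assms XY by auto
  have d: "\<bar>t - s\<bar> \<le> dist X Y" "\<bar>r - q\<bar> \<le> dist X Y"
    using dist_fst_le[of X Y] dist_snd_le[of X Y] by (auto simp: XY dist_real_def)
  have "\<bar>limit_mass t r - limit_mass s q\<bar> \<le> \<bar>limit_mass t r - limit_mass t q\<bar> + \<bar>limit_mass t q - limit_mass s q\<bar>" by simp
  also have "\<dots> \<le> L * \<bar>r - q\<bar> + L powr \<alpha> * M\<^sub>0 * \<bar>t - s\<bar>"
    by (intro add_mono limit_mass_lipschitz_volume limit_mass_lipschitz_time nn)
  also have "\<dots> \<le> L * dist X Y + L powr \<alpha> * M\<^sub>0 * dist X Y"
    using d L M0 by (intro add_mono mult_left_mono) auto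
  finally show ?thesis by (simp add: XY dist_real_def distrib_right)
qed

lemma limit_mass_uniformly_continuous: "uniformly_continuous_on quadrant (case_prod limit_mass)"
proof -
  have "(L + L powr \<alpha> * M\<^sub>0)-lipschitz_on quadrant (case_prod limit_mass)"
    using L M0 by (intro lipschitz_onI limit_mass_lipschitz) auto
  then show ?thesis by (rule lipschitz_on_uniformly_continuous)
qed

text \<open>Stability is applied twice, to m and to - m; the second application turns
  subdifferentials into superdifferentials and yields the supersolution property.\<close>

lemma limit_mass_BUC: "BUC_viscosity_solution \<alpha> m\<^sub>0 (case_prod limit_mass)"
proof -
  have cont: "continuous_on quadrant (case_prod limit_mass)"
    by (rule uniformly_continuous_imp_continuous[OF limit_mass_uniformly_continuous])
  have cont': "continuous_on quadrant (\<lambda>(t, r). - limit_mass t r)"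
    using continuous_on_minus[OF cont] by (simp add: case_prod_beta)
  have ac: "0 \<le> a r \<and> a r \<le> a s" if "0 \<le> r" "r \<le> s" for r s using a_mono that by blast
  have 1: "p\<^sub>1 + max p\<^sub>2 0 powr \<alpha> * limit_mass t r \<le> 0"
    if h: "0 < t" "0 < r" "(p\<^sub>1, p\<^sub>2) \<in> superdifferential (case_prod limit_mass) (t, r)" for t r p\<^sub>1 p\<^sub>2
  proof -
    have "p\<^sub>1 + hamiltonian \<alpha> 0 1 p\<^sub>2 * limit_mass t r \<le> 0"
    proof (rule viscosity_stability[where a = a and wa = "\<lambda>\<epsilon> t r. m \<epsilon> t r" and w = "\<lambda>t r. limit_mass t r"])
      show "0 \<le> a r \<and> a r \<le> a s" if "0 \<le> r" "r \<le> s" for r s by (rule ac[OF that])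
      show "viscosity_sub a \<epsilon> (hamiltonian \<alpha> \<epsilon> 1) (\<lambda>t r. m \<epsilon> t r)" if "0 < \<epsilon>" for \<epsilon> by (rule reg(5)[OF that])
      show "continuous_on quadrant (\<lambda>(t, r). m \<epsilon> t r)" if "0 < \<epsilon>" for \<epsilon> by (rule reg(1)[OF that])
      show "\<forall>\<^sub>F \<epsilon> in at_right 0. \<forall>t\<in>{0..T}. \<forall>r\<in>{0..R}. \<bar>m \<epsilon> t r - limit_mass t r\<bar> \<le> e"
        if "0 < e" for e T R :: real
        using eventually_close[OF that, of T R] by eventually_elim (simp add: abs_minus_commute)
    qed (rule \<alpha> cont h(1,2) h(3) | simp)+
    then show ?thesis by (simp add: hamiltonian_def)
  qed
  have 2: "0 \<le> p\<^sub>1 + max p\<^sub>2 0 powr \<alpha> * limit_mass t r"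
    if h: "0 < t" "0 < r" "(p\<^sub>1, p\<^sub>2) \<in> subdifferential (case_prod limit_mass) (t, r)" for t r p\<^sub>1 p\<^sub>2
  proof -
    have sup': "(- p\<^sub>1, - p\<^sub>2) \<in> superdifferential (\<lambda>(t, r). - limit_mass t r) (t, r)"
      using h(3) unfolding subdifferential_uminus by (simp add: case_prod_beta')
    have "- p\<^sub>1 + hamiltonian \<alpha> 0 (- 1) (- p\<^sub>2) * - limit_mass t r \<le> 0"
    proof (rule viscosity_stability[where a = a and wa = "\<lambda>\<epsilon> t r. - m \<epsilon> t r" and w = "\<lambda>t r. - limit_mass t r"])
      show "0 \<le> a r \<and> a r \<le> a s" if "0 \<le> r" "r \<le> s" for r s by (rule ac[OF that])
      show "viscosity_sub a \<epsilon> (hamiltonian \<alpha> \<epsilon> (- 1)) (\<lambda>t r. - m \<epsilon> t r)" if "0 < \<epsilon>" for \<epsilon> by (rule reg(6)[OF that])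
      show "continuous_on quadrant (\<lambda>(t, r). - m \<epsilon> t r)" if "0 < \<epsilon>" for \<epsilon> by (rule reg(2)[OF that])
      show "\<forall>\<^sub>F \<epsilon> in at_right 0. \<forall>t\<in>{0..T}. \<forall>r\<in>{0..R}. \<bar>- m \<epsilon> t r - - limit_mass t r\<bar> \<le> e"
        if "0 < e" for e T R :: real
        using eventually_close[OF that, of T R] by eventually_elim (simp add: abs_minus_commute)
    qed (rule \<alpha> cont' h(1,2) sup' | simp)+
    then show ?thesis by (simp add: hamiltonian_def)
  qed
  have "bounded (case_prod limit_mass ` quadrant)"
    unfolding bounded_iff by (rule exI[of _ M\<^sub>0]) (auto simp: limit_mass_bounds)
  then show ?thesis
    unfolding BUC_viscosity_solution_def viscosity_solution_def
      viscosity_subsolution_def viscosity_supersolution_def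
    using 1 2 cont limit_mass_uniformly_continuous limit_mass_bounds by auto
qed

section \<open>Uniqueness among bounded uniformly continuous viscosity solutions\<close>

text \<open>An arbitrary solution comes without a Lipschitz bound at volume 0. For r < d uniform
  continuity, with d independent of time, gives the error e; beyond d the quadratic term exceeds the
  bound N, which dictates the choice of \<theta>.\<close>

lemma BUC_width:
  fixes f :: "real \<times> real \<Rightarrow> real"
  assumes "0 < e" and uc: "uniformly_continuous_on quadrant f" and bd: "\<And>X. X \<in> quadrant \<Longrightarrow> \<bar>f X\<bar> \<le> N"
    and z: "\<And>t. 0 \<le> t \<Longrightarrow> f (t, 0) = 0"
  obtains \<theta> where "0 < \<theta>" "\<theta> \<le> width e"
    "\<And>t r. 0 \<le> t \<Longrightarrow> 0 \<le> r \<Longrightarrow> \<bar>f (t, r)\<bar> \<le> e + r\<^sup>2 / (2 * \<theta>)"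
proof -
  obtain d where d: "d > 0" "\<And>X Y. X \<in> quadrant \<Longrightarrow> Y \<in> quadrant \<Longrightarrow> dist Y X < d \<Longrightarrow> dist (f Y) (f X) < e"
    using uc \<open>0 < e\<close> unfolding uniformly_continuous_on_def by metis
  define \<theta> where "\<theta> = min (width e) (d\<^sup>2 / (2 * (\<bar>N\<bar> + 1)))"
  have \<theta>: "\<theta> > 0" "\<theta> \<le> width e" "\<theta> \<le> d\<^sup>2 / (2 * (\<bar>N\<bar> + 1))"
    using d(1) width(1)[OF assms(1)] by (auto simp: \<theta>_def)
  show thesis
  proof (rule that[OF \<theta>(1,2)])
    fix t r :: real assume tr: "0 \<le> t" "0 \<le> r"
    show "\<bar>f (t, r)\<bar> \<le> e + r\<^sup>2 / (2 * \<theta>)"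
    proof (cases "r < d")
      case True
      then have "dist (f (t, r)) (f (t, 0)) < e"
        using tr by (intro d(2)) (auto simp: dist_Pair_Pair)
      moreover have "0 \<le> r\<^sup>2 / (2 * \<theta>)" using \<theta> by simp
      ultimately show ?thesis using z[OF tr(1)] unfolding dist_real_def by simp
    next
      case False
      have "N \<le> d\<^sup>2 / (2 * \<theta>)"
      proof -
        have "\<theta> * (2 * (\<bar>N\<bar> + 1)) \<le> d\<^sup>2" using \<theta>(3) by (simp add: le_divide_eq)
        moreover have "\<theta> * (2 * N) \<le> \<theta> * (2 * (\<bar>N\<bar> + 1))" using \<theta>(1) by (intro mult_left_mono) auto
        ultimately have "\<theta> * (2 * N) \<le> d\<^sup>2" by linarith
        then show ?thesis using \<theta>(1) by (simp add: le_divide_eq mult_ac)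
      qed
      also have "\<dots> \<le> r\<^sup>2 / (2 * \<theta>)" using False d(1) \<theta>(1) by (intro divide_right_mono power_mono) auto
      finally show ?thesis using bd[of "(t, r)"] tr assms(1) by auto
    qed
  qed
qed

text \<open>The solution f is compared with a regularised mass in both directions, which costs 3 e
  each; one further e is the distance of that mass to its limit.\<close>

lemma uniqueness:
  assumes "BUC_viscosity_solution \<alpha> m\<^sub>0 f" "X \<in> quadrant"
  shows "f X = case_prod limit_mass X"
proof -
  define w where "w = (\<lambda>t r. f (t, r))"
  have fw: "(\<lambda>(t, r). w t r) = f" by (auto simp: w_def)
  note D = assms(1)[unfolded BUC_viscosity_solution_def viscosity_solution_def
      viscosity_subsolution_def viscosity_supersolution_def]
  have uc: "uniformly_continuous_on quadrant f" and cf: "continuous_on quadrant f"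
    and bf: "bounded (f ` quadrant)" using D by blast+
  have "\<forall>X\<in>open_quadrant. \<forall>(p\<^sub>1, p\<^sub>2)\<in>superdifferential f X. p\<^sub>1 + max p\<^sub>2 0 powr \<alpha> * f X \<le> 0"
    using D by blast
  then have sub: "p\<^sub>1 + max p\<^sub>2 0 powr \<alpha> * f X \<le> 0"
    if "X \<in> open_quadrant" "(p\<^sub>1, p\<^sub>2) \<in> superdifferential f X" for X p\<^sub>1 p\<^sub>2
    using that by - ((drule (1) bspec)+, simp)
  have "\<forall>X\<in>open_quadrant. \<forall>(p\<^sub>1, p\<^sub>2)\<in>subdifferential f X. p\<^sub>1 + max p\<^sub>2 0 powr \<alpha> * f X \<ge> 0"
    using D by blast
  then have super: "p\<^sub>1 + max p\<^sub>2 0 powr \<alpha> * f X \<ge> 0"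
    if "X \<in> open_quadrant" "(p\<^sub>1, p\<^sub>2) \<in> subdifferential f X" for X p\<^sub>1 p\<^sub>2
    using that by - ((drule (1) bspec)+, simp)
  have f0: "f (0, r) = m\<^sub>0 r" if "0 \<le> r" for r
    using D that by (intro antisym) blast+
  have fz: "f (t, 0) = 0" if "0 \<le> t" for t
    using D that by (intro antisym) blast+
  obtain N' where N': "\<And>X. X \<in> quadrant \<Longrightarrow> \<bar>f X\<bar> \<le> N'"
    using bf unfolding bounded_iff by auto
  define N where "N = max N' (M\<^sub>0 + 1)"
  have N: "0 < N" "M\<^sub>0 \<le> N" "\<And>X. X \<in> quadrant \<Longrightarrow> \<bar>f X\<bar> \<le> N"
    using N' M0 by (force simp: N_def)+
  obtain t r where X: "X = (t, r)" "0 \<le> t" "0 \<le> r" using assms(2) by (cases X) auto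
  have v1: "viscosity_sub a 0 (hamiltonian \<alpha> 0 1) w"
    by (rule viscosity_sub_if_superdifferential) (use sub in \<open>auto simp: fw w_def hamiltonian_def\<close>)
  have v2: "viscosity_sub a 0 (hamiltonian \<alpha> 0 (- 1)) (\<lambda>t r. - w t r)"
  proof (rule viscosity_sub_if_superdifferential)
    fix t \<rho> p\<^sub>1 p\<^sub>2 assume h: "0 < t" "0 < \<rho>" "(p\<^sub>1, p\<^sub>2) \<in> superdifferential (\<lambda>(t, r). - w t r) (t, \<rho>)"
    have "(\<lambda>(t, r). - w t r) = (\<lambda>Y. - f Y)" by (auto simp: w_def)
    then have "(- p\<^sub>1, - p\<^sub>2) \<in> subdifferential f (t, \<rho>)" using h(3) by (simp add: subdifferential_uminus)
    from super[OF _ this] show "p\<^sub>1 + hamiltonian \<alpha> 0 (- 1) p\<^sub>2 * - w t \<rho> \<le> 0"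
      using h by (simp add: hamiltonian_def w_def)
  qed
  have main: "\<bar>w t r - limit_mass t r\<bar> \<le> 4 * e" if e: "e > 0" for e
  proof -
    obtain \<theta> where \<theta>: "0 < \<theta>" "\<theta> \<le> width e"
      "\<And>t r. 0 \<le> t \<Longrightarrow> 0 \<le> r \<Longrightarrow> \<bar>f (t, r)\<bar> \<le> e + r\<^sup>2 / (2 * \<theta>)"
      using BUC_width[OF e uc N(3) fz] by blast
    have wd: "L * \<bar>x\<bar> \<le> e + x\<^sup>2 / (2 * \<theta>)" for x
    proof -
      have "x\<^sup>2 / (2 * width e) \<le> x\<^sup>2 / (2 * \<theta>)" using \<theta> by (intro divide_left_mono) auto
      then show ?thesis using width(2)[OF e, of x] by linarith
    qed
    have pos: "0 < t + 1" "0 < r + 1" using X by auto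
    obtain \<delta> where \<delta>: "\<delta> > 0"
      "\<And>k \<epsilon>\<^sub>1 \<epsilon>\<^sub>2 w\<^sub>1 w\<^sub>2 s q. \<lbrakk>\<bar>k\<bar> \<le> 1; 0 \<le> \<epsilon>\<^sub>1; \<epsilon>\<^sub>1 < \<delta>; 0 \<le> \<epsilon>\<^sub>2; \<epsilon>\<^sub>2 < \<delta>;
       comparable \<alpha> a (t + 1 + 1) N \<theta> e k \<epsilon>\<^sub>1 \<epsilon>\<^sub>2 w\<^sub>1 w\<^sub>2; s \<in> {0..t + 1}; q \<in> {0..r + 1}\<rbrakk>
       \<Longrightarrow> w\<^sub>1 s q + w\<^sub>2 s q \<le> 3 * e"
      using comparison_uniform[OF \<alpha> a_mono pos N(1) \<theta>(1) e] by metis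
    have "\<forall>\<^sub>F \<epsilon> in at_right 0. (0 < \<epsilon> \<and> (\<forall>t\<in>{0..t}. \<forall>r\<in>{0..r}. \<bar>m \<epsilon> t r - limit_mass t r\<bar> \<le> e)) \<and> \<epsilon> \<in> {0<..<\<delta>}"
      by (intro eventually_conj eventually_close e eventually_at_right_real \<delta>(1))
    from eventually_happens'[OF _ this] obtain \<epsilon> where
      \<epsilon>: "0 < \<epsilon>" "\<epsilon> < \<delta>" and cl: "\<forall>t\<in>{0..t}. \<forall>r\<in>{0..r}. \<bar>m \<epsilon> t r - limit_mass t r\<bar> \<le> e"
      by (metis (no_types, lifting) trivial_limit_at_right_real greaterThanLessThan_iff)
    have close: "\<bar>m \<epsilon> t r - limit_mass t r\<bar> \<le> e" using cl X by auto
    note bnd = reg_bounds[OF \<epsilon>(1)] and inc = reg_increment(2)[OF \<epsilon>(1)]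
    have bdry: "w t r - m \<epsilon> t q \<le> e + (r - q)\<^sup>2 / (2 * \<theta>)"
        "- w t r + m \<epsilon> t q \<le> e + (r - q)\<^sup>2 / (2 * \<theta>)"
      if h: "0 \<le> t" "0 \<le> r" "0 \<le> q" "t = 0 \<or> r = 0 \<or> q = 0" for t r q
    proof -
      have "\<bar>w t r - m \<epsilon> t q\<bar> \<le> e + (r - q)\<^sup>2 / (2 * \<theta>)"
        using h(4)
      proof (elim disjE)
        assume "t = 0"
        then have "\<bar>w t r - m \<epsilon> t q\<bar> \<le> L * \<bar>r - q\<bar>"
          using inc[of 0 r q] inc[of 0 q r] h initial[OF \<epsilon>(1)] f0 by (simp add: w_def abs_le_iff abs_minus_commute)
        then show ?thesis using wd[of "r - q"] by linarith
      next
        assume r: "r = 0"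
        then have "\<bar>w t r - m \<epsilon> t q\<bar> \<le> L * \<bar>q\<bar>" using bnd(1,4)[of t q] h fz by (simp add: w_def)
        then show ?thesis using wd[of q] r by simp
      next
        \<comment> \<open>The only boundary piece where f itself must be small at positive volume;
          \<open>BUC_width\<close> stands in for the Lipschitz bound.\<close>
        assume q: "q = 0"
        then show ?thesis using \<theta>(3)[of t r] bnd(5)[of t] h by (simp add: w_def)
      qed
      then show "w t r - m \<epsilon> t q \<le> e + (r - q)\<^sup>2 / (2 * \<theta>)"
        "- w t r + m \<epsilon> t q \<le> e + (r - q)\<^sup>2 / (2 * \<theta>)" by linarith+
    qed
    have cw: "continuous_on quadrant (\<lambda>(t, r). w t r)" using cf fw by simp
    have bw: "\<bar>w t r\<bar> \<le> N" "\<bar>m \<epsilon> t r\<bar> \<le> N" if "0 \<le> t" "0 \<le> r" for t r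
      using N(3)[of "(t, r)"] bnd(3)[OF that] N(2) that by (auto simp: w_def)
    have "comparable \<alpha> a (t + 1 + 1) N \<theta> e 1 0 \<epsilon> w (\<lambda>t r. - m \<epsilon> t r)"
      unfolding comparable_def
    proof (intro conjI ballI allI impI)
      fix t' r q :: real assume "t' \<in> {0..<t + 1 + 1}" "0 \<le> r" "0 \<le> q" "t' = 0 \<or> r = 0 \<or> q = 0"
      then show "w t' r + - m \<epsilon> t' q \<le> e + (r - q)\<^sup>2 / (2 * \<theta>)" using bdry(1)[of t' r q] by simp
    qed (use v1 reg[OF \<epsilon>(1)] cw bw in auto)
    then have 1: "w t r + - m \<epsilon> t r \<le> 3 * e"
      using \<delta>(2)[of 1 0 \<epsilon> w "\<lambda>t r. - m \<epsilon> t r" t r] \<epsilon> X by simp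
    have "comparable \<alpha> a (t + 1 + 1) N \<theta> e (- 1) 0 \<epsilon> (\<lambda>t r. - w t r) (m \<epsilon>)"
      unfolding comparable_def
    proof (intro conjI ballI allI impI)
      show "continuous_on quadrant (\<lambda>(t, r). - w t r)"
        using continuous_on_minus[OF cw] by (simp add: case_prod_beta)
      fix t' r q :: real assume "t' \<in> {0..<t + 1 + 1}" "0 \<le> r" "0 \<le> q" "t' = 0 \<or> r = 0 \<or> q = 0"
      then show "- w t' r + m \<epsilon> t' q \<le> e + (r - q)\<^sup>2 / (2 * \<theta>)" using bdry(2)[of t' r q] by simp
    qed (use v2 reg[OF \<epsilon>(1)] bw in auto)
    then have 2: "- w t r + m \<epsilon> t r \<le> 3 * e"
      using \<delta>(2)[of "- 1" 0 \<epsilon> "\<lambda>t r. - w t r" "m \<epsilon>" t r] \<epsilon> X by simp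
    show ?thesis using 1 2 close by linarith
  qed
  have "\<bar>w t r - limit_mass t r\<bar> \<le> 0"
  proof (rule field_le_epsilon)
    fix e :: real assume "e > 0"
    then show "\<bar>w t r - limit_mass t r\<bar> \<le> 0 + e" using main[of "e / 4"] by simp
  qed
  then show ?thesis by (simp add: X(1) w_def)
qed

theorem convergence:
  "\<exists>f. BUC_viscosity_solution \<alpha> m\<^sub>0 f \<and>
       (\<forall>f'. BUC_viscosity_solution \<alpha> m\<^sub>0 f' \<longrightarrow> (\<forall>X\<in>quadrant. f' X = f X)) \<and>
       (\<forall>K. compact K \<and> K \<subseteq> quadrant \<longrightarrow> uniform_limit K (\<lambda>\<epsilon> (t, r). m \<epsilon> t r) f (at_right 0)) \<and>
       (\<exists>L. \<forall>t\<ge>0. L-lipschitz_on {0..} (\<lambda>r. f (t, r)))"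
proof (intro exI[of _ "case_prod limit_mass"] conjI allI impI ballI; (elim conjE)?)
  fix K :: "(real \<times> real) set" assume K: "compact K" "K \<subseteq> quadrant"
  obtain B where B: "\<And>X. X \<in> K \<Longrightarrow> norm X \<le> B"
    using compact_imp_bounded[OF K(1)] unfolding bounded_iff by blast
  show "uniform_limit K (\<lambda>\<epsilon> (t, r). m \<epsilon> t r) (case_prod limit_mass) (at_right 0)"
    unfolding uniform_limit_iff
  proof (intro allI impI)
    fix e :: real assume e: "e > 0"
    then have "\<forall>\<^sub>F \<epsilon> in at_right 0. 0 < \<epsilon> \<and> (\<forall>t\<in>{0..B}. \<forall>r\<in>{0..B}. \<bar>m \<epsilon> t r - limit_mass t r\<bar> \<le> e / 2)"
      by (intro eventually_close) auto
    then show "\<forall>\<^sub>F \<epsilon> in at_right 0. \<forall>X\<in>K. dist (case X of (t, r) \<Rightarrow> m \<epsilon> t r) (case_prod limit_mass X) < e"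
    proof eventually_elim
      case (elim \<epsilon>)
      show ?case
      proof
        fix X assume X: "X \<in> K"
        then have "fst X \<in> {0..B}" "snd X \<in> {0..B}"
          using K(2) B[OF X] norm_fst_le[of "fst X" "snd X"] norm_snd_le[of "snd X" "fst X"] by force+
        then have "\<bar>m \<epsilon> (fst X) (snd X) - limit_mass (fst X) (snd X)\<bar> \<le> e / 2" using elim by blast
        then show "dist (case X of (t, r) \<Rightarrow> m \<epsilon> t r) (case_prod limit_mass X) < e"
          using e by (simp add: dist_real_def case_prod_beta)
      qed
    qed
  qed
next
  show "\<exists>L. \<forall>t\<ge>0. L-lipschitz_on {0..} (\<lambda>r. case_prod limit_mass (t, r))"
    using limit_mass_lipschitz_volume L by (intro exI[of _ L]) (auto intro!: lipschitz_onI simp: dist_real_def)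
qed (use limit_mass_BUC uniqueness in auto)

end

subsection \<open>Radial vector fields\<close>

text \<open>Reflections and their negatives suffice to express radial symmetry. Being its own
  inverse, such a map turns preimages into images, and a one-sided measure estimate into an
  equality.\<close>

definition involutive_isometry :: "('a::euclidean_space \<Rightarrow> 'a) \<Rightarrow> bool" where
  "involutive_isometry R \<longleftrightarrow> linear R \<and> (\<forall>x. R (R x) = x) \<and> (\<forall>x. norm (R x) = norm x)"

lemma vimage_ball_involutive_isometry:
  assumes "involutive_isometry R"
  shows "R -` ball x r = ball (R x) r"
proof -
  have "dist x (R y) = dist (R x) y" for y
  proof -
    have "dist (R x) y = norm (R (x - R y))"
      using assms by (simp add: involutive_isometry_def dist_norm linear_diff)
    then show ?thesis using assms by (simp add: involutive_isometry_def dist_norm)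
  qed
  then show ?thesis by auto
qed

text \<open>Isometries map balls to balls of the same measure, and by Vitali's theorem an open set is a
  countable disjoint union of balls up to a null set.\<close>

lemma emeasure_vimage_involutive_isometry_le:
  fixes R :: "'a::euclidean_space \<Rightarrow> 'a"
  assumes R: "involutive_isometry R" and U: "open U"
  shows "emeasure lborel (R -` U) \<le> emeasure lborel U"
proof -
  have lin: "linear R" and inv: "\<And>x. R (R x) = x" and nrm: "\<And>x. norm (R x) = norm x"
    using R by (auto simp: involutive_isometry_def)
  have [measurable]: "R \<in> borel_measurable borel"
    using linear_continuous_on[OF linear_conv_bounded_linear[THEN iffD1, OF lin], of UNIV]
    by (rule borel_measurable_continuous_onI)
  define K where "K = {(x, r). 0 < r \<and> ball x r \<subseteq> U}"
  have cov: "\<exists>i. i \<in> K \<and> x \<in> ball (fst i) (snd i) \<and> snd i < d" if "x \<in> U" "0 < d" for x d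
  proof -
    obtain e where e: "e > 0" "ball x e \<subseteq> U" using U \<open>x \<in> U\<close> open_contains_ball by blast
    have "ball x (min e (d / 2)) \<subseteq> U" using e(2) by auto
    then show ?thesis using e that by (intro exI[of _ "(x, min e (d / 2))"]) (auto simp: K_def)
  qed
  have "\<exists>C. countable C \<and> C \<subseteq> K \<and>
      pairwise (\<lambda>i j. disjnt (ball (fst i) (snd i)) (ball (fst j) (snd j))) C \<and>
      negligible (U - (\<Union>i\<in>C. ball (fst i) (snd i)))"
    by (rule Vitali_covering_theorem_balls[of U K fst snd]) (use cov in blast)+
  then obtain C where
    C: "countable C" "C \<subseteq> K" "pairwise (\<lambda>i j. disjnt (ball (fst i) (snd i)) (ball (fst j) (snd j))) C"
    and neg: "negligible (U - (\<Union>i\<in>C. ball (fst i) (snd i)))" by blast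
  let ?B = "\<lambda>i. ball (fst i) (snd i)"
  define N where "N = U - (\<Union>i\<in>C. ?B i)"
  have Nb: "N \<in> sets borel"
    unfolding N_def using U by (intro sets.Diff borel_open open_UN ballI) auto
  have Neq: "R -` N = R ` N" 
  proof (intro equalityI subsetI)
    fix x assume "x \<in> R -` N"
    then show "x \<in> R ` N" by (intro image_eqI[of _ _ "R x"]) (auto simp: inv)
  qed (auto simp: inv)
  \<comment> \<open>The preimage of the null set is also its image, and Lipschitz images of null
    sets are null.\<close>
  have "negligible (R ` N)"
  proof (rule negligible_locally_Lipschitz_image)
    fix x show "\<exists>T B. open T \<and> x \<in> T \<and> (\<forall>y\<in>N \<inter> T. norm (R y - R x) \<le> B * norm (y - x))"
      using nrm by (intro exI[of _ UNIV] exI[of _ 1]) (simp add: linear_diff[OF lin, symmetric])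
  qed (use neg in \<open>auto simp: N_def\<close>)
  moreover have Nb': "R -` N \<in> sets borel"
    using measurable_sets_borel[OF \<open>R \<in> borel_measurable borel\<close> Nb] by simp
  ultimately have N0: "emeasure lborel (R -` N) = 0"
    by (simp add: Neq[symmetric] negligible_iff_emeasure0)
  have disj: "disjoint_family_on ?B C"
    using C(3) by (auto simp: disjoint_family_on_def pairwise_def disjnt_def)
  then have disj': "disjoint_family_on (\<lambda>i. R -` ?B i) C"
    unfolding disjoint_family_on_def by blast
  have ms: "R -` ?B i \<in> sets lborel" for i
    by (simp add: vimage_ball_involutive_isometry[OF R])
  have "R -` U \<subseteq> (\<Union>i\<in>C. R -` ?B i) \<union> R -` N" by (auto simp: N_def)
  then have "emeasure lborel (R -` U) \<le> emeasure lborel ((\<Union>i\<in>C. R -` ?B i) \<union> R -` N)"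
    by (intro emeasure_mono sets.Un sets.countable_UN' C ms) (use Nb' ms in auto)
  also have "\<dots> \<le> emeasure lborel (\<Union>i\<in>C. R -` ?B i) + emeasure lborel (R -` N)"
    by (intro emeasure_subadditive sets.countable_UN' C ms) (use Nb' ms in auto)
  also have "\<dots> = (\<integral>\<^sup>+ i. emeasure lborel (R -` ?B i) \<partial>count_space C)"
    by (simp add: N0 emeasure_UN_countable[OF ms C(1) disj'])
  also have "\<dots> = (\<integral>\<^sup>+ i. emeasure lborel (?B i) \<partial>count_space C)"
  proof (rule nn_integral_cong)
    fix i assume "i \<in> space (count_space C)"
    then have "0 \<le> snd i" using C(2) by (auto simp: K_def)
    then show "emeasure lborel (R -` ?B i) = emeasure lborel (?B i)"
      by (simp add: vimage_ball_involutive_isometry[OF R] emeasure_ball)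
  qed
  also have "\<dots> = emeasure lborel (\<Union>i\<in>C. ?B i)"
    by (rule emeasure_UN_countable[symmetric]) (use C disj in auto)
  also have "\<dots> \<le> emeasure lborel U"
  proof (intro emeasure_mono UN_least)
    fix i assume "i \<in> C"
    then have "i \<in> K" using C(2) by blast
    then show "?B i \<subseteq> U" by (simp add: K_def case_prod_beta)
  qed (use U in auto)
  finally show ?thesis .
qed

text \<open>The estimate for open sets, applied to a box and to its preimage, gives equality on
  boxes, and these determine Lebesgue measure.\<close>

lemma lborel_distr_involutive_isometry:
  fixes R :: "'a::euclidean_space \<Rightarrow> 'a"
  assumes R: "involutive_isometry R"
  shows "distr lborel borel R = lborel"
proof (rule lborel_eqI[symmetric])
  have lin: "linear R" and inv: "\<And>x. R (R x) = x" using R by (auto simp: involutive_isometry_def)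
  have cont: "continuous_on UNIV R"
    by (rule linear_continuous_on[OF linear_conv_bounded_linear[THEN iffD1, OF lin]])
  then have [measurable]: "R \<in> borel_measurable borel" by (rule borel_measurable_continuous_onI)
  fix l u :: 'a assume lu: "\<And>b. b \<in> Basis \<Longrightarrow> l \<bullet> b \<le> u \<bullet> b"
  have op: "open (R -` box l u)" using open_box cont by (rule open_vimage)
  have "R -` (R -` box l u) = box l u" using inv by auto
  then have "emeasure lborel (R -` box l u) = emeasure lborel (box l u)"
    using emeasure_vimage_involutive_isometry_le[OF R open_box, of l u]
      emeasure_vimage_involutive_isometry_le[OF R op] by (auto intro: antisym)
  then show "emeasure (distr lborel borel R) (box l u) = (\<Prod>b\<in>Basis. (u - l) \<bullet> b)"
    using lu by (simp add: emeasure_distr)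
qed simp

text \<open>Equivariance is chosen over the form f(|x|) x because it passes directly to the
  Newtonian field by a change of variables and to gradients by the chain rule;
  \<open>radial_field_eq\<close> recovers the explicit form.\<close>

definition radial_field :: "('a::euclidean_space \<Rightarrow> 'a) \<Rightarrow> bool" where
  "radial_field F \<longleftrightarrow> (\<forall>R x. involutive_isometry R \<longrightarrow> F (R x) = R (F x))"

lemma involutive_isometry_reflection:
  fixes n :: "'a::euclidean_space"
  assumes "norm n = 1"
  shows "involutive_isometry (\<lambda>x. x - (2 * (x \<bullet> n)) *\<^sub>R n)"
proof -
  have nn: "n \<bullet> n = 1" using assms by (simp add: dot_square_norm)
  have "(norm (x - (2 * (x \<bullet> n)) *\<^sub>R n))\<^sup>2 = (norm x)\<^sup>2" for x
    unfolding power2_norm_eq_inner by (simp add: inner_diff_left inner_diff_right nn inner_commute)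
  then have "norm (x - (2 * (x \<bullet> n)) *\<^sub>R n) = norm x" for x
    by (rule power2_eq_imp_eq) simp_all
  moreover have "linear (\<lambda>x. x - (2 * (x \<bullet> n)) *\<^sub>R n)"
    by (intro linearI) (auto simp: inner_add_left algebra_simps)
  moreover have "(x - (2 * (x \<bullet> n)) *\<^sub>R n) \<bullet> n = - (x \<bullet> n)" for x
    by (simp add: inner_diff_left nn)
  ultimately show ?thesis by (simp add: involutive_isometry_def)
qed

lemma involutive_isometry_uminus:
  "involutive_isometry R \<Longrightarrow> involutive_isometry (\<lambda>x. - R x)"
  by (auto simp: involutive_isometry_def linear_neg intro: linear_compose_neg)

lemma radial_field_zero:
  assumes "radial_field F"
  shows "F 0 = 0"
proof -
  have "involutive_isometry (\<lambda>x. - x)"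
    by (auto simp: involutive_isometry_def intro: linear_compose_neg linear_id[unfolded id_def])
  then have "F (- 0) = - F 0" using assms unfolding radial_field_def by blast
  then have h: "F 0 = - F 0" by simp
  have "F 0 + F 0 = 0" by (subst (2) h) simp
  then show ?thesis by (simp add: scaleR_2[symmetric])
qed

text \<open>The negated reflection along e fixes the line of e and reverses its orthogonal
  complement, so the field is parallel to e on that line. A further reflection carries the point on
  the axis of b to y.\<close>

lemma radial_field_eq:
  fixes F :: "'a::euclidean_space \<Rightarrow> 'a"
  assumes F: "radial_field F" and b: "norm b = 1" and y: "y \<noteq> 0"
  shows "F y = ((F (norm y *\<^sub>R b) \<bullet> b) / norm y) *\<^sub>R y"
proof -
  have along: "F z = (F z \<bullet> e) *\<^sub>R e" if "norm e = 1" "z = c *\<^sub>R e" for z e c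
  proof -
    let ?R = "\<lambda>x. - (x - (2 * (x \<bullet> e)) *\<^sub>R e)"
    have ee: "e \<bullet> e = 1" using that(1) by (simp add: dot_square_norm)
    have "?R z = z" by (simp add: that(2) ee scaleR_left_diff_distrib[symmetric])
    moreover have "F (?R z) = ?R (F z)"
      using F involutive_isometry_uminus[OF involutive_isometry_reflection[OF that(1)]]
      unfolding radial_field_def by blast
    ultimately have "F z + F z = (2 * (F z \<bullet> e)) *\<^sub>R e" by (simp add: algebra_simps)
    then have "2 *\<^sub>R F z = 2 *\<^sub>R ((F z \<bullet> e) *\<^sub>R e)" by (simp only: scaleR_2[of "F z"] scaleR_scaleR)
    then show ?thesis unfolding scaleR_cancel_left by simp
  qed
  define z where "z = norm y *\<^sub>R b"
  have Fz: "F z = (F z \<bullet> b) *\<^sub>R b" using along[OF b] z_def by blast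
  have nz: "norm z = norm y" using b by (simp add: z_def)
  show ?thesis
  proof (cases "y = z")
    case True
    have "(F z \<bullet> b / norm y) *\<^sub>R y = (F z \<bullet> b / norm y) *\<^sub>R z" by (rule arg_cong[OF True])
    also have "\<dots> = (F z \<bullet> b) *\<^sub>R b" using y by (simp add: z_def)
    also have "\<dots> = F z" by (rule Fz[symmetric])
    also have "\<dots> = F y" by (rule arg_cong[OF True[symmetric]])
    finally show ?thesis unfolding z_def by (rule sym)
  next
    case False
    \<comment> \<open>The normal of the hyperplane bisecting y and z, which have equal norms, so the
      reflection exchanges them.\<close>
    define n where "n = (y - z) /\<^sub>R norm (y - z)"
    let ?R = "\<lambda>x. x - (2 * (x \<bullet> n)) *\<^sub>R n"
    have n1: "norm n = 1" using False by (simp add: n_def)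
    have iso: "involutive_isometry ?R" by (rule involutive_isometry_reflection[OF n1])
    have "y \<bullet> y = z \<bullet> z" using nz by (simp add: power2_norm_eq_inner[symmetric])
    then have "2 * (z \<bullet> (y - z)) = - ((y - z) \<bullet> (y - z))"
      by (simp add: inner_diff_left inner_diff_right inner_commute)
    then have "2 * (z \<bullet> (y - z)) = - (norm (y - z))\<^sup>2" by (simp add: power2_norm_eq_inner)
    moreover have "(2 * (z \<bullet> n)) *\<^sub>R n = (2 * (z \<bullet> (y - z)) / (norm (y - z))\<^sup>2) *\<^sub>R (y - z)"
      by (simp add: n_def power2_eq_square divide_inverse mult_ac)
    ultimately have "(2 * (z \<bullet> n)) *\<^sub>R n = - (y - z)" using False by simp
    then have Rz: "?R z = y" by simp
    have lin: "linear ?R" using iso by (simp add: involutive_isometry_def)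
    have "?R z = norm y *\<^sub>R ?R b" unfolding z_def by (rule linear_scale[OF lin])
    then have e: "norm y *\<^sub>R ?R b = y" using Rz by (rule trans[OF sym])
    have "inverse (norm y) *\<^sub>R (norm y *\<^sub>R ?R b) = inverse (norm y) *\<^sub>R y" by (simp only: e)
    then have Rb: "?R b = y /\<^sub>R norm y" using y by simp
    have "F y = F (?R z)" using Rz by simp
    also have "\<dots> = ?R (F z)" using F iso unfolding radial_field_def by blast
    also have "\<dots> = ?R ((F z \<bullet> b) *\<^sub>R b)" using Fz by simp
    also have "\<dots> = (F z \<bullet> b) *\<^sub>R ?R b" by (rule linear_scale[OF lin])
    finally show ?thesis unfolding Rb z_def by (simp add: divide_inverse)
  qed
qed

lemma radial_involutive_isometry:
  "radial w \<Longrightarrow> involutive_isometry R \<Longrightarrow> w (R x) = w x"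
  unfolding radial_def involutive_isometry_def by blast

lemma radial_field_newton_grad:
  fixes w :: "'a::euclidean_space \<Rightarrow> real"
  assumes w: "radial w" and [measurable]: "w \<in> borel_measurable borel"
  shows "radial_field (newton_grad w)"
  unfolding radial_field_def
proof (intro allI impI)
  fix R :: "'a \<Rightarrow> 'a" and x :: 'a
  assume R: "involutive_isometry R"
  have lin: "linear R" and inv: "\<And>x. R (R x) = x" and nrm: "\<And>x. norm (R x) = norm x"
    using R by (auto simp: involutive_isometry_def)
  have bl: "bounded_linear R" using lin linear_conv_bounded_linear by blast
  have [measurable]: "R \<in> borel_measurable borel"
    by (intro borel_measurable_continuous_onI linear_continuous_on bl)
  let ?f = "\<lambda>z. (w z / norm (R x - z) ^ DIM('a)) *\<^sub>R (R x - z)"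
  let ?g = "\<lambda>z. (w z / norm (x - z) ^ DIM('a)) *\<^sub>R (x - z)"
  have fm: "?f \<in> borel_measurable borel" by measurable
  have "(LINT z|lborel. ?f z) = (LINT z|distr lborel borel R. ?f z)"
    by (simp only: lborel_distr_involutive_isometry[OF R])
  also have "\<dots> = (LINT z|lborel. ?f (R z))"
    by (rule integral_distr[OF _ fm]) simp
  also have "\<dots> = (LINT z|lborel. R (?g z))"
  proof (intro Bochner_Integration.integral_cong refl)
    fix z
    have "R x - R z = R (x - z)" by (rule linear_diff[OF lin, symmetric])
    then show "?f (R z) = R (?g z)"
      by (simp only: nrm radial_involutive_isometry[OF w R] linear_scale[OF lin])
  qed
  also have "\<dots> = R (LINT z|lborel. ?g z)"
    \<comment> \<open>Because R is its own inverse, it commutes with the integral without an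
      integrability argument.\<close>
    by (rule integral_bounded_linear'[OF bl bl]) (simp add: inv)
  finally have eq: "(LINT z|lborel. ?f z) = R (LINT z|lborel. ?g z)" .
  show "newton_grad w (R x) = R (newton_grad w x)"
    unfolding newton_grad_def eq by (rule linear_scale[OF lin, symmetric])
qed

text \<open>Differentiating w \<circ> R = w and using that R is orthogonal and its own
  inverse.\<close>

lemma radial_field_gradient:
  fixes w :: "'a::euclidean_space \<Rightarrow> real"
  assumes w: "radial w" and G: "\<And>x. GDERIV w x :> G x"
  shows "radial_field G"
  unfolding radial_field_def
proof (intro allI impI)
  fix R :: "'a \<Rightarrow> 'a" and x :: 'a
  assume R: "involutive_isometry R"
  have lin: "linear R" and inv: "\<And>x. R (R x) = x" and nrm: "\<And>x. norm (R x) = norm x"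
    using R by (auto simp: involutive_isometry_def)
  have bl: "bounded_linear R" using lin linear_conv_bounded_linear by blast
  have "orthogonal_transformation R" using lin nrm by (simp add: orthogonal_transformation)
  then have inner: "R p \<bullet> R q = p \<bullet> q" for p q by (simp add: orthogonal_transformation_def)
  have "((\<lambda>y. w (R y)) has_derivative (\<lambda>h. R h \<bullet> G (R x))) (at x)"
    using has_derivative_compose[OF bounded_linear_imp_has_derivative[OF bl] G[of "R x", unfolded gderiv_def]]
    by (simp add: inner_commute)
  then have "(w has_derivative (\<lambda>h. R h \<bullet> G (R x))) (at x)"
    by (simp add: radial_involutive_isometry[OF w R])
  note fun_cong[OF has_derivative_unique[OF this G[unfolded gderiv_def]]]
  then have "h \<bullet> R (G (R x)) = h \<bullet> G x" for h
    using inner[of h "R (G (R x))"] by (simp add: inv)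
  then have "R (G (R x)) = G x" by (intro iffD1[OF vector_eq_ldot]) simp
  then have "R (R (G (R x))) = R (G x)" by simp
  then show "G (R x) = R (G x)" by (simp only: inv)
qed

section \<open>The volume variable and fluxes through spheres\<close>

definition unit_vec :: "'a::euclidean_space" where
  "unit_vec = (SOME b. b \<in> Basis)"

lemma unit_vec: "(unit_vec :: 'a::euclidean_space) \<in> Basis" "norm (unit_vec :: 'a) = 1"
    "(unit_vec :: 'a) \<bullet> unit_vec = 1"
proof -
  show b: "(unit_vec :: 'a) \<in> Basis" unfolding unit_vec_def by (rule someI_ex) (use nonempty_Basis in blast)
  then show "norm (unit_vec :: 'a) = 1" "(unit_vec :: 'a) \<bullet> unit_vec = 1" by (auto simp: inner_Basis)
qed

text \<open>As functions of the enclosed volume \<open>\<rho>\<close>: the radius of the ball and the area of its boundary;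
  \<open>point \<rho>\<close> is a point of that sphere on a coordinate axis, and \<open>flux F \<rho>\<close> is the flux
  through the sphere only for radial fields \<open>F\<close>.\<close>

definition radius :: "'a::euclidean_space itself \<Rightarrow> real \<Rightarrow> real" where
  "radius T \<rho> = root DIM('a) (\<rho> / omega T)"

definition area :: "'a::euclidean_space itself \<Rightarrow> real \<Rightarrow> real" where
  "area T \<rho> = DIM('a) * omega T * radius T \<rho> ^ (DIM('a) - 1)"

definition point :: "real \<Rightarrow> 'a::euclidean_space" where
  "point \<rho> = radius TYPE('a) \<rho> *\<^sub>R unit_vec"

definition flux :: "('a::euclidean_space \<Rightarrow> 'a) \<Rightarrow> real \<Rightarrow> real" where
  "flux F \<rho> = area TYPE('a) \<rho> * (F (point \<rho>) \<bullet> unit_vec)"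

lemma omega_eq: "omega TYPE('a::euclidean_space) = unit_ball_vol (real DIM('a))"
  unfolding omega_def by (subst content_ball) auto

lemma omega_pos [simp]: "0 < omega TYPE('a::euclidean_space)"
  by (simp add: omega_eq)

lemma omega_nonzero [simp]: "omega TYPE('a::euclidean_space) \<noteq> 0"
  using omega_pos[where 'a='a] by (simp del: omega_pos)

lemma radius_nonneg: "0 \<le> \<rho> \<Longrightarrow> 0 \<le> radius TYPE('a::euclidean_space) \<rho>"
  by (simp add: radius_def less_imp_le[OF omega_pos])

lemma radius_pos: "0 < \<rho> \<Longrightarrow> 0 < radius TYPE('a::euclidean_space) \<rho>"
  by (simp add: radius_def)

lemma radius_zero [simp]: "radius TYPE('a::euclidean_space) 0 = 0"
  by (simp add: radius_def)

lemma radius_mono: "\<rho> \<le> \<sigma> \<Longrightarrow> radius TYPE('a::euclidean_space) \<rho> \<le> radius TYPE('a) \<sigma>"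
  by (simp add: radius_def divide_right_mono less_imp_le[OF omega_pos])

lemma radius_power:
  assumes "0 \<le> \<rho>"
  shows "omega TYPE('a::euclidean_space) * radius TYPE('a) \<rho> ^ DIM('a) = \<rho>"
proof -
  have "radius TYPE('a) \<rho> ^ DIM('a) = \<rho> / omega TYPE('a)"
    unfolding radius_def using assms by (intro real_root_pow_pos2) (auto simp: less_imp_le[OF omega_pos])
  then show ?thesis using omega_pos[where 'a='a] by (simp del: omega_pos)
qed

lemma radius_volume:
  assumes "0 \<le> r"
  shows "radius TYPE('a::euclidean_space) (omega TYPE('a) * r ^ DIM('a)) = r"
  using assms less_imp_neq[OF omega_pos[where 'a='a]] by (simp add: radius_def real_root_power_cancel)

lemma norm_point: "0 \<le> \<rho> \<Longrightarrow> norm (point \<rho> :: 'a::euclidean_space) = radius TYPE('a) \<rho>"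
  by (simp add: point_def unit_vec radius_nonneg)

lemma area_pos: "0 < \<rho> \<Longrightarrow> 0 < area TYPE('a::euclidean_space) \<rho>"
  by (simp add: area_def radius_pos)

lemma area_mono:
  assumes "0 \<le> \<rho>" "\<rho> \<le> \<sigma>"
  shows "0 \<le> area TYPE('a::euclidean_space) \<rho>" "area TYPE('a) \<rho> \<le> area TYPE('a) \<sigma>"
  using assms radius_nonneg[of \<rho>, where 'a='a] radius_mono[of \<rho> \<sigma>, where 'a='a]
  by (auto simp: area_def less_imp_le[OF omega_pos] intro!: mult_left_mono power_mono)

lemma continuous_on_radius: "continuous_on S (radius TYPE('a::euclidean_space))"
  unfolding radius_def by (intro continuous_intros) auto

lemma continuous_on_point: "continuous_on S (point :: real \<Rightarrow> 'a::euclidean_space)"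
  unfolding point_def by (intro continuous_intros continuous_on_radius)

text \<open>The derivative of the enclosed volume with respect to the radius is the area of the
  sphere.\<close>

lemma radius_has_derivative:
  assumes "0 < \<rho>"
  shows "(radius TYPE('a::euclidean_space) has_real_derivative 1 / area TYPE('a) \<rho>) (at \<rho>)"
proof -
  have o: "0 < omega TYPE('a)" by simp
  have "((\<lambda>\<rho>. root DIM('a) (\<rho> / omega TYPE('a))) has_real_derivative
      inverse (real DIM('a) * root DIM('a) (\<rho> / omega TYPE('a)) ^ (DIM('a) - Suc 0)) * (1 / omega TYPE('a))) (at \<rho>)"
    by (rule DERIV_chain2[OF DERIV_real_root]) (use assms o in \<open>auto intro!: derivative_eq_intros\<close>)
  then show ?thesis
    unfolding area_def radius_def[abs_def] by (simp add: field_simps)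
qed

text \<open>The polar formula for the divergence from differentiability at a single point: the
  coordinate direction b gives the radial derivative, and each of the other d - 1 directions
  contributes f / r.\<close>

lemma radial_field_divergence:
  fixes F :: "'a::euclidean_space \<Rightarrow> 'a"
  assumes F: "radial_field F" and D: "has_divergence F D (r *\<^sub>R b)" and b: "b \<in> Basis" and r: "0 < r"
  obtains f' where "((\<lambda>s. F (s *\<^sub>R b) \<bullet> b) has_real_derivative f') (at r)"
    "D = f' + (DIM('a) - 1) * (F (r *\<^sub>R b) \<bullet> b) / r"
proof -
  obtain F' where F': "(F has_derivative F') (at (r *\<^sub>R b))" and D: "D = (\<Sum>b\<in>Basis. F' b \<bullet> b)"
    using D unfolding has_divergence_def by blast
  have lin: "linear F'" using F' has_derivative_linear by blast
  have nb: "norm b = 1" using b by simp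
  define f where "f = F (r *\<^sub>R b) \<bullet> b"
  have "((\<lambda>s. s *\<^sub>R b) has_derivative (\<lambda>h. h *\<^sub>R b)) (at r)"
    by (auto intro!: derivative_eq_intros)
  from has_derivative_compose[OF this F']
  have "((\<lambda>s. F (s *\<^sub>R b)) has_derivative (\<lambda>h. F' (h *\<^sub>R b))) (at r)" .
  then have "((\<lambda>s. F (s *\<^sub>R b) \<bullet> b) has_derivative (\<lambda>h. F' (h *\<^sub>R b) \<bullet> b)) (at r)"
    by (auto intro!: derivative_eq_intros)
  moreover have "(\<lambda>h. F' (h *\<^sub>R b) \<bullet> b) = (*) (F' b \<bullet> b)"
    by (auto simp: linear_scale[OF lin] mult.commute)
  ultimately have 1: "((\<lambda>s. F (s *\<^sub>R b) \<bullet> b) has_real_derivative (F' b \<bullet> b)) (at r)"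
    by (simp add: has_field_derivative_def)
  have side: "F' c \<bullet> c = f / r" if c: "c \<in> Basis" "c \<noteq> b" for c
  proof -
    \<comment> \<open>A circle through the point, tangent there to c. On it the radial field is the
      constant f / r times the position, so its derivative in direction c is read off.\<close>
    define \<gamma> where "\<gamma> = (\<lambda>\<theta>. r *\<^sub>R (cos \<theta> *\<^sub>R b + sin \<theta> *\<^sub>R c))"
    have bc: "b \<bullet> c = 0" "c \<bullet> b = 0" "b \<bullet> b = 1" "c \<bullet> c = 1" using b c by (auto simp: inner_Basis)
    have "(norm (cos \<theta> *\<^sub>R b + sin \<theta> *\<^sub>R c))\<^sup>2 = (cos \<theta>)\<^sup>2 + (sin \<theta>)\<^sup>2" for \<theta>
      unfolding power2_norm_eq_inner by (simp add: inner_add_left inner_add_right bc power2_eq_square)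
    then have "norm (cos \<theta> *\<^sub>R b + sin \<theta> *\<^sub>R c) = 1" for \<theta> :: real
      by (intro power2_eq_imp_eq[of _ 1]) simp_all
    then have n: "norm (\<gamma> \<theta>) = r" for \<theta> using r by (simp add: \<gamma>_def)
    have "F (\<gamma> \<theta>) = (f / r) *\<^sub>R \<gamma> \<theta>" for \<theta>
      using radial_field_eq[OF F nb, of "\<gamma> \<theta>"] n[of \<theta>] r by (auto simp: f_def)
    then have eq: "(\<lambda>\<theta>. F (\<gamma> \<theta>)) = (\<lambda>\<theta>. (f / r) *\<^sub>R \<gamma> \<theta>)" by blast
    have d\<gamma>: "(\<gamma> has_derivative (\<lambda>h. h *\<^sub>R (r *\<^sub>R c))) (at 0)"
      unfolding \<gamma>_def by (auto intro!: derivative_eq_intros simp: mult_ac)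
    have "(F has_derivative F') (at (\<gamma> 0))" using F' by (simp add: \<gamma>_def)
    from has_derivative_compose[OF d\<gamma> this]
    have "((\<lambda>\<theta>. F (\<gamma> \<theta>)) has_derivative (\<lambda>h. F' (h *\<^sub>R (r *\<^sub>R c)))) (at 0)" .
    moreover have "((\<lambda>\<theta>. (f / r) *\<^sub>R \<gamma> \<theta>) has_derivative (\<lambda>h. (f / r) *\<^sub>R h *\<^sub>R (r *\<^sub>R c))) (at 0)"
      by (rule has_derivative_scaleR_right[OF d\<gamma>])
    ultimately have "(\<lambda>h. F' (h *\<^sub>R (r *\<^sub>R c))) = (\<lambda>h. (f / r) *\<^sub>R h *\<^sub>R (r *\<^sub>R c))"
      unfolding eq by (rule has_derivative_unique)
    from fun_cong[OF this, of "1 / r"] have "F' c = (f / r) *\<^sub>R c" using r by simp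
    then show ?thesis using bc by simp
  qed
  have "D = F' b \<bullet> b + (\<Sum>c\<in>Basis - {b}. F' c \<bullet> c)"
    unfolding D using b by (simp add: sum.remove)
  also have "(\<Sum>c\<in>Basis - {b}. F' c \<bullet> c) = (\<Sum>c\<in>Basis - {b}. f / r)"
    using side by (intro sum.cong) auto
  also have "\<dots> = real (DIM('a) - 1) * (f / r)" using b by (simp add: card_Diff_singleton)
  finally have "D = F' b \<bullet> b + (DIM('a) - 1) * f / r" by simp
  then show thesis using that[OF 1] by (simp add: f_def)
qed

text \<open>The divergence theorem in differential form: in the volume variable, the logarithmic
  derivative of the area supplies the term (d - 1) f / r, and the factor 1 / area from the radius
  cancels the area.\<close>

lemma flux_has_derivative:
  fixes F :: "'a::euclidean_space \<Rightarrow> 'a"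
  assumes F: "radial_field F" and D: "has_divergence F D (point \<rho>)" and \<rho>: "0 < \<rho>"
  shows "(flux F has_real_derivative D) (at \<rho>)"
proof -
  let ?r = "radius TYPE('a)" and ?A = "area TYPE('a)" and ?d = "DIM('a)"
  define f where "f = (\<lambda>s. F (s *\<^sub>R unit_vec) \<bullet> unit_vec)"
  have r: "0 < ?r \<rho>" by (rule radius_pos[OF \<rho>])
  have A: "0 < ?A \<rho>" by (rule area_pos[OF \<rho>])
  obtain f' where f': "(f has_real_derivative f') (at (?r \<rho>))" "D = f' + (?d - 1) * f (?r \<rho>) / ?r \<rho>"
    using radial_field_divergence[OF F D[unfolded point_def] unit_vec(1) r] unfolding f_def by blast
  note r' = radius_has_derivative[OF \<rho>, where 'a='a]
  have fr: "((\<lambda>\<rho>. f (?r \<rho>)) has_real_derivative f' * (1 / ?A \<rho>)) (at \<rho>)"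
    by (rule DERIV_chain2[OF f'(1) r'])
  \<comment> \<open>For d = 1 the natural subtraction in the exponent truncates; both sides are then
    0 because of the factor d - 1.\<close>
  have pow: "real (?d - 1) * ?r \<rho> ^ (?d - 1 - Suc 0) = real (?d - 1) * ?r \<rho> ^ (?d - 1) / ?r \<rho>"
    using r by (cases "?d - 1") auto
  have "((\<lambda>\<rho>. ?r \<rho> ^ (?d - 1)) has_real_derivative real (?d - 1) * (1 / ?A \<rho> * ?r \<rho> ^ (?d - 1 - Suc 0))) (at \<rho>)"
    by (rule DERIV_power[OF r'])
  then have Ad: "(?A has_real_derivative ?d * omega TYPE('a) * (real (?d - 1) * (1 / ?A \<rho> * ?r \<rho> ^ (?d - 1 - Suc 0)))) (at \<rho>)"
    unfolding area_def[abs_def] by (rule DERIV_cmult)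
  have "?d * omega TYPE('a) * (real (?d - 1) * (1 / ?A \<rho> * ?r \<rho> ^ (?d - 1 - Suc 0)))
      = (?d * omega TYPE('a) * (real (?d - 1) * ?r \<rho> ^ (?d - 1 - Suc 0))) / ?A \<rho>" by simp
  also have "\<dots> = real (?d - 1) / ?r \<rho> * (?A \<rho> / ?A \<rho>)"
    unfolding pow area_def by simp
  also have "\<dots> = real (?d - 1) / ?r \<rho>" using A by simp
  finally have Ad': "(?A has_real_derivative real (?d - 1) / ?r \<rho>) (at \<rho>)" using Ad by simp
  have "((\<lambda>\<rho>. ?A \<rho> * f (?r \<rho>)) has_real_derivative
      real (?d - 1) / ?r \<rho> * f (?r \<rho>) + f' * (1 / ?A \<rho>) * ?A \<rho>) (at \<rho>)"
    by (rule DERIV_mult[OF Ad' fr])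
  moreover have "real (?d - 1) / ?r \<rho> * f (?r \<rho>) + f' * (1 / ?A \<rho>) * ?A \<rho> = D"
    using A by (simp add: f'(2))
  moreover have "flux F = (\<lambda>\<rho>. ?A \<rho> * f (?r \<rho>))"
    by (auto simp: flux_def f_def point_def)
  ultimately show ?thesis by simp
qed

lemma continuous_on_flux:
  fixes F :: "'a::euclidean_space \<Rightarrow> 'a"
  assumes "continuous_on UNIV F"
  shows "continuous_on S (flux F)"
  unfolding flux_def area_def
  by (intro continuous_intros continuous_on_radius continuous_on_compose2[OF assms continuous_on_point]) auto

text \<open>For d = 1 the area does not vanish at volume 0, as it is a multiple of
  \<open>radius ^ 0\<close>; the flux vanishes because the field does.\<close>

lemma flux_zero: "radial_field F \<Longrightarrow> flux F 0 = 0"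
  by (simp add: flux_def point_def radial_field_zero)

subsection \<open>The mass of a radial function\<close>

lemma mass_region:
  assumes "0 \<le> \<rho>"
  shows "{x::'a::euclidean_space. omega TYPE('a) * norm x ^ DIM('a) \<le> \<rho>} = cball 0 (radius TYPE('a) \<rho>)"
proof -
  have "omega TYPE('a) * norm x ^ DIM('a) \<le> \<rho> \<longleftrightarrow> norm x \<le> radius TYPE('a) \<rho>" for x :: 'a
  proof
    assume "omega TYPE('a) * norm x ^ DIM('a) \<le> \<rho>"
    from radius_mono[OF this, where 'a='a] show "norm x \<le> radius TYPE('a) \<rho>"
      by (simp add: radius_volume)
  next
    assume "norm x \<le> radius TYPE('a) \<rho>"
    then have "omega TYPE('a) * norm x ^ DIM('a) \<le> omega TYPE('a) * radius TYPE('a) \<rho> ^ DIM('a)"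
      by (intro mult_left_mono power_mono) (auto simp: less_imp_le[OF omega_pos])
    then show "omega TYPE('a) * norm x ^ DIM('a) \<le> \<rho>" by (simp add: radius_power[OF assms])
  qed
  then show ?thesis by (simp add: set_eq_iff)
qed

lemma measure_mass_region:
  assumes "0 \<le> \<rho>"
  shows "measure lborel {x::'a::euclidean_space. omega TYPE('a) * norm x ^ DIM('a) \<le> \<rho>} = \<rho>"
  unfolding mass_region[OF assms]
  using content_cball[OF radius_nonneg[OF assms, where 'a='a], of "0::'a"] radius_power[OF assms, where 'a='a]
  by (simp add: omega_eq)

lemma norm_integral_le:
  fixes f :: "'a \<Rightarrow> real"
  assumes "integrable M f" "integrable M g" "\<And>x. norm (f x) \<le> g x"
  shows "norm (integral\<^sup>L M f) \<le> integral\<^sup>L M g"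
  by (rule order_trans[OF integral_norm_bound Bochner_Integration.integral_mono])
     (use assms in auto)

text \<open>The shell between the volumes \<rho> and \<sigma> has measure \<sigma> - \<rho>. The
  free constant c makes one estimate serve three ends: the derivative (c a value of w), the
  Lipschitz bound (c = 0) and monotonicity of the initial mass (c half the upper bound).\<close>

lemma mass_diff_le:
  fixes w :: "'a::euclidean_space \<Rightarrow> real"
  assumes w: "integrable lborel w" and \<rho>: "0 \<le> \<rho>" "\<rho> \<le> \<sigma>"
    and close: "\<And>x. \<lbrakk>\<rho> < omega TYPE('a) * norm x ^ DIM('a); omega TYPE('a) * norm x ^ DIM('a) \<le> \<sigma>\<rbrakk> \<Longrightarrow> \<bar>w x - c\<bar> \<le> e"
  shows "\<bar>mass w \<sigma> - mass w \<rho> - c * (\<sigma> - \<rho>)\<bar> \<le> e * (\<sigma> - \<rho>)"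
proof -
  define A where "A = (\<lambda>\<rho>. {x::'a. omega TYPE('a) * norm x ^ DIM('a) \<le> \<rho>})"
  define S where "S = A \<sigma> - A \<rho>"
  have A: "A s = cball 0 (radius TYPE('a) s)" if "0 \<le> s" for s using mass_region[OF that] by (simp add: A_def)
  have Aeq: "{x::'a. omega TYPE('a) * norm x ^ DIM('a) \<le> s} = A s" for s by (simp add: A_def)
  have sub: "A \<rho> \<subseteq> A \<sigma>" using \<rho> by (auto simp: A_def)
  have ms: "A \<rho> \<in> sets lborel" "A \<sigma> \<in> sets lborel" using \<rho> by (auto simp: A)
  have fin: "emeasure lborel (A \<sigma>) < \<infinity>" using \<rho> emeasure_lborel_cball_finite by (simp add: A less_top[symmetric])
  have S: "S \<in> sets lborel" "emeasure lborel S < \<infinity>" "measure lborel S = \<sigma> - \<rho>"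
  proof -
    show "S \<in> sets lborel" unfolding S_def using ms by blast
    show "emeasure lborel S < \<infinity>"
      by (rule le_less_trans[OF emeasure_mono fin]) (use ms in \<open>auto simp: S_def\<close>)
    have "measure lborel S = measure lborel (A \<sigma>) - measure lborel (A \<rho>)"
      unfolding S_def using fin ms sub by (intro measure_Diff) auto
    then show "measure lborel S = \<sigma> - \<rho>" using \<rho> by (simp add: A_def measure_mass_region)
  qed
  have i: "integrable lborel (\<lambda>x. indicator B x *\<^sub>R w x)" if "B \<in> sets lborel" for B
    by (rule integrable_mult_indicator[OF that w])
  have ic: "integrable lborel (\<lambda>x. indicator S x * k)" for k :: real
    using S by (intro integrable_mult_left integrable_real_indicator) auto
  have Sk: "(LINT x|lborel. indicator S x * k) = k * (\<sigma> - \<rho>)" for k :: real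
    using S by simp
  have "mass w \<sigma> - mass w \<rho> = (LINT x|lborel. indicator (A \<sigma>) x *\<^sub>R w x - indicator (A \<rho>) x *\<^sub>R w x)"
    unfolding mass_def set_lebesgue_integral_def Aeq
    by (rule Bochner_Integration.integral_diff[OF i i, symmetric]) (use ms in auto)
  also have "\<dots> = (LINT x|lborel. indicator S x *\<^sub>R w x)"
    by (intro Bochner_Integration.integral_cong refl) (use sub in \<open>auto simp: S_def indicator_def\<close>)
  finally have "mass w \<sigma> - mass w \<rho> - c * (\<sigma> - \<rho>) = (LINT x|lborel. indicator S x *\<^sub>R w x - indicator S x * c)"
    using Bochner_Integration.integral_diff[OF i[OF S(1)] ic[of c]] by (simp add: S(3) mult.commute)
  also have "\<bar>\<dots>\<bar> \<le> (LINT x|lborel. indicator S x * e)"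
  proof -
    have "norm (LINT x|lborel. indicator S x *\<^sub>R w x - indicator S x * c) \<le> (LINT x|lborel. indicator S x * e)"
    proof (rule norm_integral_le)
      fix x :: 'a
      show "norm (indicator S x *\<^sub>R w x - indicator S x * c) \<le> indicator S x * e"
        using close[of x] by (cases "x \<in> S") (auto simp: S_def A_def)
    qed (intro Bochner_Integration.integrable_diff i[OF S(1)] ic)+
    then show ?thesis by simp
  qed
  also have "\<dots> = e * (\<sigma> - \<rho>)" by (rule Sk)
  finally show ?thesis .
qed

lemma radial_eq_point:
  fixes w :: "'a::euclidean_space \<Rightarrow> real"
  assumes "radial w"
  shows "w x = w (point (omega TYPE('a) * norm x ^ DIM('a)))"
proof -
  have "norm (point (omega TYPE('a) * norm x ^ DIM('a)) :: 'a) = norm x"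
    by (subst norm_point) (auto simp: radius_volume less_imp_le[OF omega_pos])
  then show ?thesis using assms unfolding radial_def by metis
qed

text \<open>A continuous radial function is nearly constant on a thin shell, so the derivative
  follows from the shell estimate without polar coordinates.\<close>

lemma mass_has_derivative:
  fixes w :: "'a::euclidean_space \<Rightarrow> real"
  assumes w: "integrable lborel w" and rad: "radial w" and cont: "continuous_on UNIV w" and \<rho>: "0 < \<rho>"
  shows "(mass w has_real_derivative w (point \<rho>)) (at \<rho>)"
proof -
  have "\<exists>d>0. \<forall>\<sigma>. norm (\<sigma> - \<rho>) < d \<longrightarrow> norm (mass w \<sigma> - mass w \<rho> - w (point \<rho>) * (\<sigma> - \<rho>)) \<le> e * norm (\<sigma> - \<rho>)"
    if e: "e > 0" for e
  proof -
    have "continuous_on UNIV (\<lambda>s. w (point s))"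
      by (rule continuous_on_compose2[OF cont continuous_on_point]) auto
    then obtain d where d: "d > 0" "\<And>s. dist s \<rho> < d \<Longrightarrow> dist (w (point s)) (w (point \<rho>)) < e"
      using e unfolding continuous_on_iff by (metis UNIV_I)
    show ?thesis
    proof (intro exI[of _ "min d \<rho>"] conjI allI impI)
      show "0 < min d \<rho>" using d \<rho> by simp
      fix \<sigma> assume \<sigma>: "norm (\<sigma> - \<rho>) < min d \<rho>"
      have close: "\<bar>w x - w (point \<rho>)\<bar> \<le> e" if "\<bar>omega TYPE('a) * norm x ^ DIM('a) - \<rho>\<bar> \<le> \<bar>\<sigma> - \<rho>\<bar>" for x
        using d(2)[of "omega TYPE('a) * norm x ^ DIM('a)"] that \<sigma> radial_eq_point[OF rad, of x]
        by (simp add: dist_real_def)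
      show "norm (mass w \<sigma> - mass w \<rho> - w (point \<rho>) * (\<sigma> - \<rho>)) \<le> e * norm (\<sigma> - \<rho>)"
      proof (cases "\<rho> \<le> \<sigma>")
        case True
        then show ?thesis
          using mass_diff_le[OF w less_imp_le[OF \<rho>] True, of "w (point \<rho>)" e] close by simp
      next
        case False
        have eq: "mass w \<sigma> - mass w \<rho> - w (point \<rho>) * (\<sigma> - \<rho>) = - (mass w \<rho> - mass w \<sigma> - w (point \<rho>) * (\<rho> - \<sigma>))"
          by (simp add: algebra_simps)
        have "\<bar>mass w \<rho> - mass w \<sigma> - w (point \<rho>) * (\<rho> - \<sigma>)\<bar> \<le> e * (\<rho> - \<sigma>)"
          by (rule mass_diff_le[OF w]) (use False \<sigma> in \<open>auto intro!: close\<close>)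
        then show ?thesis using False unfolding eq by simp
      qed
    qed
  qed
  then show ?thesis
    unfolding has_field_derivative_def has_derivative_at_alt by (auto intro: bounded_linear_mult_right)
qed

lemma mass_zero: "mass (w :: 'a::euclidean_space \<Rightarrow> real) 0 = 0"
  unfolding mass_def set_lebesgue_integral_def
proof (rule integral_eq_zero_AE)
  show "AE x in lborel. indicator {x. omega TYPE('a) * norm x ^ DIM('a) \<le> 0} x *\<^sub>R w x = 0"
    using AE_lborel_singleton[of "0::'a"]
  proof eventually_elim
    case (elim x)
    then have "0 < omega TYPE('a) * norm x ^ DIM('a)" by simp
    then show ?case by (simp add: indicator_def)
  qed
qed

lemma mass_lipschitz:
  fixes w :: "'a::euclidean_space \<Rightarrow> real"
  assumes w: "integrable lborel w" and B: "\<And>x. \<bar>w x\<bar> \<le> B" and \<rho>: "0 \<le> \<rho>" "0 \<le> \<sigma>"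
  shows "\<bar>mass w \<sigma> - mass w \<rho>\<bar> \<le> B * \<bar>\<sigma> - \<rho>\<bar>"
proof (cases "\<rho> \<le> \<sigma>")
  case True
  then show ?thesis using mass_diff_le[OF w \<rho>(1) True, of 0 B] B by simp
next
  case False
  then show ?thesis using mass_diff_le[OF w \<rho>(2), of \<rho> 0 B] B by (simp add: abs_minus_commute)
qed

lemma mass_region_sets: "{x::'a::euclidean_space. omega TYPE('a) * norm x ^ DIM('a) \<le> \<rho>} \<in> sets lborel"
  by simp

lemma mass_abs_le:
  fixes w :: "'a::euclidean_space \<Rightarrow> real"
  assumes w: "integrable lborel w"
  shows "\<bar>mass w \<rho>\<bar> \<le> (LINT x|lborel. \<bar>w x\<bar>)"
proof -
  have "norm (LINT x|lborel. indicator {x. omega TYPE('a) * norm x ^ DIM('a) \<le> \<rho>} x *\<^sub>R w x) \<le> (LINT x|lborel. \<bar>w x\<bar>)"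
  proof (rule norm_integral_le)
    show "integrable lborel (\<lambda>x. indicator {x. omega TYPE('a) * norm x ^ DIM('a) \<le> \<rho>} x *\<^sub>R w x)"
      by (rule integrable_mult_indicator[OF mass_region_sets w])
    show "integrable lborel (\<lambda>x. \<bar>w x\<bar>)" using w by simp
  qed (simp add: indicator_def)
  then show ?thesis by (simp add: mass_def set_lebesgue_integral_def)
qed

lemma mass_diff:
  fixes w w' :: "'a::euclidean_space \<Rightarrow> real"
  assumes w: "integrable lborel w" "integrable lborel w'"
  shows "mass w \<rho> - mass w' \<rho> = mass (\<lambda>x. w x - w' x) \<rho>"
proof -
  have i: "integrable lborel (\<lambda>x. indicator {x::'a. omega TYPE('a) * norm x ^ DIM('a) \<le> \<rho>} x *\<^sub>R f x)"
    if "integrable lborel f" for f :: "'a \<Rightarrow> real"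
    by (rule integrable_mult_indicator[OF mass_region_sets that])
  show ?thesis
    unfolding mass_def set_lebesgue_integral_def
    using Bochner_Integration.integral_diff[OF i[OF w(1)] i[OF w(2)]] by (simp add: right_diff_distrib)
qed

lemma gderiv_unique:
  assumes "GDERIV f x :> D" "GDERIV f x :> D'"
  shows "D = D'"
  using fun_cong[OF has_derivative_unique[OF assms[unfolded gderiv_def]]] by (intro iffD1[OF vector_eq_ldot]) simp

text \<open>Moves the Laplacian from the local gradient hidden in its definition to a given global
  one, such as the Newtonian field; gradients are unique.\<close>

lemma has_laplacian_divergence:
  assumes "has_laplacian f L x" and G: "\<And>y. GDERIV f y :> G y"
  shows "has_divergence G L x"
proof -
  obtain G' where G': "\<forall>\<^sub>F y in nhds x. GDERIV f y :> G' y" "has_divergence G' L x"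
    using assms(1) unfolding has_laplacian_def by blast
  have ev: "\<forall>\<^sub>F y in nhds x. G' y = G y"
    using G'(1) by eventually_elim (rule gderiv_unique[OF _ G])
  obtain F' where F': "(G' has_derivative F') (at x)" "L = (\<Sum>b\<in>Basis. F' b \<bullet> b)"
    using G'(2) unfolding has_divergence_def by blast
  have "\<forall>\<^sub>F y in at x. G' y = G y" using ev unfolding eventually_nhds_conv_at by blast
  then have "(G has_derivative F') (at x)"
    by (rule has_derivative_transform_eventually[OF F'(1)]) (use eventually_nhds_x_imp_x[OF ev] in auto)
  then show ?thesis unfolding has_divergence_def using F'(2) by blast
qed

lemma has_divergence_isCont: "has_divergence F D x \<Longrightarrow> isCont F x"
  unfolding has_divergence_def by (auto intro: has_derivative_continuous)

subsection \<open>The equation of the regularised mass\<close>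

locale radial_classical_solution =
  fixes \<alpha> \<epsilon> :: real and u\<^sub>0 :: "'a::euclidean_space \<Rightarrow> real" and u :: "real \<Rightarrow> 'a \<Rightarrow> real"
  assumes \<epsilon>: "0 < \<epsilon>" and sol: "classical_solution \<alpha> \<epsilon> u\<^sub>0 u"
    and radial: "\<And>t. 0 \<le> t \<Longrightarrow> radial (u t)"
begin

lemma continuous_u: "continuous_on ({0..} \<times> UNIV) (\<lambda>(t, x). u t x)"
  using sol by (simp add: classical_solution_def)

lemma continuous_slice: "0 \<le> t \<Longrightarrow> continuous_on UNIV (u t)"
  using continuous_on_compose2[OF continuous_u, of UNIV "\<lambda>x. (t, x)"]
  by (simp add: continuous_on_Pair image_subset_iff)

lemma integrable_slice: "0 \<le> t \<Longrightarrow> integrable lborel (u t)"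
  using sol by (simp add: classical_solution_def continuous_in_L1_def)

lemma bounded_slice:
  assumes "0 \<le> t"
  obtains B where "\<And>x. \<bar>u t x\<bar> \<le> B"
proof -
  have "bounded ((\<lambda>(t, x). u t x) ` ({0..t} \<times> UNIV))"
    using sol unfolding classical_solution_def by blast
  then obtain B where "\<forall>y\<in>(\<lambda>(t, x). u t x) ` ({0..t} \<times> UNIV). norm y \<le> B"
    unfolding bounded_iff by blast
  then show thesis using that[of B] assms by force
qed

lemma continuous_on_mass:
  assumes "0 \<le> t"
  shows "continuous_on {0..\<rho>} (mass (u t))"
proof -
  obtain B where B: "\<And>x. \<bar>u t x\<bar> \<le> B" using bounded_slice[OF assms] by blast
  have "0 \<le> B" using B[of 0] by linarith
  then have "B-lipschitz_on {0..\<rho>} (mass (u t))"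
    using mass_lipschitz[OF integrable_slice[OF assms] B] by (intro lipschitz_onI) (auto simp: dist_real_def)
  then show ?thesis by (rule lipschitz_on_continuous_on)
qed

lemma mass_derivative: "0 \<le> t \<Longrightarrow> 0 < \<rho> \<Longrightarrow> (mass (u t) has_real_derivative u t (point \<rho>)) (at \<rho>)"
  by (rule mass_has_derivative[OF integrable_slice radial continuous_slice])

text \<open>Writes the mass as a one-dimensional integral over a compact interval, so that it can be
  differentiated in time under the integral sign.\<close>

lemma mass_has_integral:
  assumes "0 \<le> t" "0 \<le> \<rho>"
  shows "((\<lambda>\<sigma>. u t (point \<sigma>)) has_integral mass (u t) \<rho>) {0..\<rho>}"
  using fundamental_theorem_of_calculus_interior[OF assms(2) continuous_on_mass[OF assms(1)],
      of "\<lambda>\<sigma>. u t (point \<sigma>)"] mass_derivative[OF assms(1)]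
  by (simp add: mass_zero has_real_derivative_iff_has_vector_derivative[symmetric])

lemma equation_at:
  assumes "0 < t"
  obtains D L where "\<forall>x. has_divergence (newton_grad (u t)) (- u t x) x"
    "\<forall>x. has_divergence (\<lambda>y. (\<epsilon> + max (u t y) 0) powr \<alpha> *\<^sub>R newton_grad (u t) y) (D x) x"
    "\<forall>x. has_laplacian (u t) (L x) x"
    "\<forall>x. ((\<lambda>s. u s x) has_real_derivative (D x + \<epsilon> * L x)) (at t)"
proof -
  obtain v where v: "newtonian_potential (u t) (v t)"
    and e: "\<forall>x. has_laplacian (v t) (- u t x) x \<and>
             (\<exists>D L. has_divergence
                      (\<lambda>y. (\<epsilon> + max (u t y) 0) powr \<alpha> *\<^sub>R newton_grad (u t) y) D x \<and>
                    has_laplacian (u t) L x \<and>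
                    ((\<lambda>s. u s x) has_real_derivative (D + \<epsilon> * L)) (at t))"
    using sol assms unfolding classical_solution_def regularised_equation_def by blast
  have 1: "has_divergence (newton_grad (u t)) (- u t x) x" for x
    by (rule has_laplacian_divergence[of "v t"]) (use v e in \<open>auto simp: newtonian_potential_def\<close>)
  have "\<forall>x. \<exists>D L. has_divergence
                      (\<lambda>y. (\<epsilon> + max (u t y) 0) powr \<alpha> *\<^sub>R newton_grad (u t) y) D x \<and>
                    has_laplacian (u t) L x \<and>
                    ((\<lambda>s. u s x) has_real_derivative (D + \<epsilon> * L)) (at t)"
    using e by blast
  then obtain D L where "\<forall>x. has_divergence
                      (\<lambda>y. (\<epsilon> + max (u t y) 0) powr \<alpha> *\<^sub>R newton_grad (u t) y) (D x) x \<and>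
                    has_laplacian (u t) (L x) x \<and>
                    ((\<lambda>s. u s x) has_real_derivative (D x + \<epsilon> * L x)) (at t)"
    unfolding choice_iff by blast
  then show thesis using that[of D L] 1 by blast
qed

text \<open>Newton's shell theorem, read off from \<open>- \<Delta>v = u\<close>: the flux of \<open>\<nabla>v\<close> and the negative mass
  have the same derivative and both vanish at \<open>0\<close>.\<close>

lemma newton_grad_properties:
  assumes "0 < t"
  shows "radial_field (newton_grad (u t))" "continuous_on UNIV (newton_grad (u t))"
    "0 \<le> \<rho> \<Longrightarrow> flux (newton_grad (u t)) \<rho> = - mass (u t) \<rho>"
proof -
  have e: "has_divergence (newton_grad (u t)) (- u t x) x" for x
    by (rule equation_at[OF assms]) blast
  show r: "radial_field (newton_grad (u t))"
    by (rule radial_field_newton_grad)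
       (use assms radial continuous_slice in \<open>auto intro: borel_measurable_continuous_onI\<close>)
  \<comment> \<open>Continuity of the Newtonian field is read off from its differentiability in the
    equation instead of from kernel estimates.\<close>
  show c: "continuous_on UNIV (newton_grad (u t))"
    unfolding continuous_on_eq_continuous_at[OF open_UNIV] using has_divergence_isCont[OF e] by blast
  show "flux (newton_grad (u t)) \<rho> = - mass (u t) \<rho>" if "0 \<le> \<rho>"
  proof (cases "\<rho> = 0")
    case True
    then show ?thesis by (simp add: mass_zero flux_zero[OF r])
  next
    case False
    then have "0 < \<rho>" using that by simp
    define \<phi> where "\<phi> = (\<lambda>\<rho>. flux (newton_grad (u t)) \<rho> + mass (u t) \<rho>)"
    have "(\<phi> has_real_derivative 0) (at \<sigma>)" if "0 < \<sigma>" for \<sigma>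
      using DERIV_add[OF flux_has_derivative[OF r e that] mass_derivative[of t \<sigma>]] assms that
      by (simp add: \<phi>_def)
    moreover have "continuous_on {0..\<rho>} \<phi>"
      unfolding \<phi>_def using assms by (intro continuous_on_add continuous_on_flux[OF c] continuous_on_mass) auto
    ultimately have "\<phi> \<rho> = \<phi> 0" using DERIV_isconst_end[OF \<open>0 < \<rho>\<close>] by blast
    then show ?thesis by (simp add: \<phi>_def mass_zero flux_zero[OF r])
  qed
qed

text \<open>The equation integrated over a ball: the time derivative of the mass is the total flux
  through the sphere. On the sphere the nonlinear factor is constant, so the drift flux is this
  factor times - m by the shell theorem; the diffusive flux is the area times the radial derivative
  of u, that is, the squared area times A.\<close>

lemma mass_equation:
  assumes t: "0 < t" and \<rho>: "0 < \<rho>"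
  obtains A where "((\<lambda>\<sigma>. u t (point \<sigma>)) has_real_derivative A) (at \<rho>)"
    "((\<lambda>s. mass (u s) \<rho>) has_real_derivative
        \<epsilon> * (area TYPE('a) \<rho>)\<^sup>2 * A - (\<epsilon> + max (u t (point \<rho>)) 0) powr \<alpha> * mass (u t) \<rho>) (at t)"
proof -
  let ?V = "newton_grad (u t)"
  note V = newton_grad_properties[OF t]
  obtain D L where "\<forall>x. has_divergence ?V (- u t x) x" and
    eqD: "\<forall>x. has_divergence (\<lambda>y. (\<epsilon> + max (u t y) 0) powr \<alpha> *\<^sub>R ?V y) (D x) x" and
    eqL: "\<forall>x. has_laplacian (u t) (L x) x" and
    eqt: "\<forall>x. ((\<lambda>s. u s x) has_real_derivative (D x + \<epsilon> * L x)) (at t)"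
    by (rule equation_at[OF t])
  have "C2_in_space u" "C1_in_time u" using sol by (simp_all add: classical_solution_def)
  then obtain G H u' where
    G: "\<forall>t>0. \<forall>x. GDERIV (u t) x :> G t x" and
    H: "\<forall>t>0. \<forall>x. (G t has_derivative blinfun_apply (H t x)) (at x)" and
    u': "\<forall>t>0. \<forall>x. ((\<lambda>s. u s x) has_real_derivative u' t x) (at t)" and
    cu': "continuous_on ({0<..} \<times> UNIV) (\<lambda>(t, x). u' t x)"
    unfolding C2_in_space_def C1_in_time_def by blast
  have Gt: "GDERIV (u t) x :> G t x" for x using G t by blast
  have rG: "radial_field (G t)" by (rule radial_field_gradient[OF radial Gt]) (use t in simp)
  have cG: "continuous_on UNIV (G t)"
    unfolding continuous_on_eq_continuous_at[OF open_UNIV] using H t has_derivative_continuous by blast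
  have divG: "has_divergence (G t) (L x) x" for x by (rule has_laplacian_divergence[OF eqL[rule_format] Gt])
  define F where "F = (\<lambda>y. (\<epsilon> + max (u t y) 0) powr \<alpha> *\<^sub>R ?V y)"
  have divF: "has_divergence F (D x) x" for x unfolding F_def using eqD by blast
  have cF: "continuous_on UNIV F"
    unfolding continuous_on_eq_continuous_at[OF open_UNIV] using has_divergence_isCont[OF divF] by blast
  have rF: "radial_field F"
    unfolding radial_field_def
  proof (intro allI impI)
    fix R :: "'a \<Rightarrow> 'a" and x assume R: "involutive_isometry R"
    then have lin: "linear R" by (simp add: involutive_isometry_def)
    have "?V (R x) = R (?V x)" using V(1) R unfolding radial_field_def by blast
    moreover have "u t (R x) = u t x" using radial_involutive_isometry[OF radial R] t by simp
    ultimately show "F (R x) = R (F x)" unfolding F_def by (simp only: linear_scale[OF lin])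
  qed
  \<comment> \<open>The derivative of u in the volume variable: the radial derivative divided by the
    area.\<close>
  define A where "A = (G t (point \<rho>) \<bullet> unit_vec) / area TYPE('a) \<rho>"
  have area: "0 < area TYPE('a) \<rho>" by (rule area_pos[OF \<rho>])
  have "(radius TYPE('a) has_derivative (*) (1 / area TYPE('a) \<rho>)) (at \<rho>)"
    using radius_has_derivative[OF \<rho>, where 'a='a] unfolding has_field_derivative_def .
  from has_derivative_scaleR_left[OF this, of unit_vec]
  have pd: "((point :: real \<Rightarrow> 'a) has_derivative (\<lambda>h. (1 / area TYPE('a) \<rho> * h) *\<^sub>R unit_vec)) (at \<rho>)"
    by (simp add: point_def[abs_def])
  have "((\<lambda>\<sigma>. u t (point \<sigma>)) has_derivative (\<lambda>h. ((1 / area TYPE('a) \<rho> * h) *\<^sub>R unit_vec) \<bullet> G t (point \<rho>))) (at \<rho>)"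
    by (rule has_derivative_compose[OF pd Gt[unfolded gderiv_def]])
  moreover have "(\<lambda>h. ((1 / area TYPE('a) \<rho> * h) *\<^sub>R unit_vec) \<bullet> G t (point \<rho>)) = (*) A"
    by (auto simp: A_def inner_commute)
  ultimately have dA: "((\<lambda>\<sigma>. u t (point \<sigma>)) has_real_derivative A) (at \<rho>)"
    by (simp add: has_field_derivative_def)
  define \<Phi> where "\<Phi> = (\<lambda>\<sigma>. flux F \<sigma> + \<epsilon> * flux (G t) \<sigma>)"
  have d\<Phi>: "(\<Phi> has_real_derivative u' t (point \<sigma>)) (at \<sigma>)" if "0 < \<sigma>" for \<sigma>
  proof -
    have "u' t (point \<sigma>) = D (point \<sigma>) + \<epsilon> * L (point \<sigma>)"
      by (rule DERIV_unique[OF _ eqt[rule_format]]) (use u' t in blast)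
    then show ?thesis
      unfolding \<Phi>_def
      using DERIV_add[OF flux_has_derivative[OF rF divF that] DERIV_cmult[OF flux_has_derivative[OF rG divG that], of \<epsilon>]]
      by simp
  qed
  have c\<Phi>: "continuous_on {0..\<rho>} \<Phi>"
    unfolding \<Phi>_def by (intro continuous_intros continuous_on_flux cF cG)
  \<comment> \<open>The fundamental theorem is used in its interior form, as the radius need not be
    differentiable at volume 0; \<Phi> is continuous and vanishes there.\<close>
  have "((\<lambda>\<sigma>. u' t (point \<sigma>)) has_integral \<Phi> \<rho> - \<Phi> 0) {0..\<rho>}"
    by (rule fundamental_theorem_of_calculus_interior[OF less_imp_le[OF \<rho>] c\<Phi>])
       (use d\<Phi> in \<open>simp add: has_real_derivative_iff_has_vector_derivative[symmetric]\<close>)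
  then have int\<Phi>: "integral {0..\<rho>} (\<lambda>\<sigma>. u' t (point \<sigma>)) = \<Phi> \<rho>"
    by (auto simp: \<Phi>_def flux_zero[OF rF] flux_zero[OF rG] dest: integral_unique)
  have "((\<lambda>s. integral (cbox 0 \<rho>) (\<lambda>\<sigma>. u s (point \<sigma>))) has_field_derivative
      integral (cbox 0 \<rho>) (\<lambda>\<sigma>. u' t (point \<sigma>))) (at t within {0<..})"
  proof (rule leibniz_rule_field_derivative)
    show "((\<lambda>s. u s (point \<sigma>)) has_real_derivative u' s (point \<sigma>)) (at s within {0<..})"
      if "s \<in> {0<..}" for s \<sigma>
      using u' that by (auto intro: has_field_derivative_at_within)
    show "(\<lambda>\<sigma>. u s (point \<sigma>)) integrable_on cbox 0 \<rho>" if "s \<in> {0<..}" for s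
      using mass_has_integral[of s \<rho>] that \<rho> by (auto simp: has_integral_integrable)
    have cp: "continuous_on ({0<..} \<times> cbox 0 \<rho>) (\<lambda>x. (fst x, point (snd x) :: 'a))"
      by (intro continuous_intros continuous_on_compose2[OF continuous_on_point[of UNIV]]) auto
    have "continuous_on ({0<..} \<times> cbox 0 \<rho>) (\<lambda>x. case (fst x, point (snd x) :: 'a) of (t, x) \<Rightarrow> u' t x)"
      by (rule continuous_on_compose2[OF cu' cp]) auto
    then show "continuous_on ({0<..} \<times> cbox 0 \<rho>) (\<lambda>(s, \<sigma>). u' s (point \<sigma>))"
      by (simp add: case_prod_beta)
  qed (use t in auto)
  then have "((\<lambda>s. integral {0..\<rho>} (\<lambda>\<sigma>. u s (point \<sigma>))) has_real_derivative \<Phi> \<rho>) (at t)"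
    using t by (simp add: at_within_open[of t "{0<..}"] int\<Phi>)
  then have "((\<lambda>s. mass (u s) \<rho>) has_real_derivative \<Phi> \<rho>) (at t)"
    by (rule has_field_derivative_transform_within_open[where S = "{0<..}"])
       (use t \<rho> mass_has_integral in \<open>auto intro!: integral_unique\<close>)
  moreover have "flux F \<rho> = - ((\<epsilon> + max (u t (point \<rho>)) 0) powr \<alpha> * mass (u t) \<rho>)"
  proof -
    have "flux F \<rho> = (\<epsilon> + max (u t (point \<rho>)) 0) powr \<alpha> * flux ?V \<rho>"
      by (simp add: flux_def F_def)
    then show ?thesis using V(3)[of \<rho>] \<rho> by simp
  qed
  moreover have "flux (G t) \<rho> = (area TYPE('a) \<rho>)\<^sup>2 * A"
    using area by (simp add: flux_def A_def power2_eq_square)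
  ultimately show thesis using that[OF dA] by (simp add: \<Phi>_def mult.assoc)
qed

section \<open>Continuity and local boundedness of the mass, from continuity in L^1\<close>

lemma L1_norm_diff:
  assumes "0 \<le> t" "0 < e"
  obtains d where "0 < d" "\<And>s. 0 \<le> s \<Longrightarrow> \<bar>s - t\<bar> < d \<Longrightarrow> (LINT x|lborel. \<bar>u s x - u t x\<bar>) < e"
proof -
  have "((\<lambda>s. LINT x | lborel. \<bar>u s x - u t x\<bar>) \<longlongrightarrow> 0) (at t within {0..})"
    using sol assms unfolding classical_solution_def continuous_in_L1_def by blast
  from tendstoD[OF this assms(2)] obtain d where d: "d > 0"
    "\<And>s. s \<in> {0..} \<Longrightarrow> s \<noteq> t \<Longrightarrow> dist s t < d \<Longrightarrow> dist (LINT x | lborel. \<bar>u s x - u t x\<bar>) 0 < e"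
    unfolding eventually_at by blast
  show thesis
  proof (rule that[OF d(1)])
    fix s assume "0 \<le> s" "\<bar>s - t\<bar> < d"
    then show "(LINT x|lborel. \<bar>u s x - u t x\<bar>) < e"
      using d(2)[of s] assms(2) by (cases "s = t") (auto simp: dist_real_def)
  qed
qed

text \<open>A change of time costs at most the distance in L^1, whatever the volume; a change of
  volume at the fixed time t costs the Lipschitz constant of that slice.\<close>

lemma continuous_mass: "continuous_on quadrant (\<lambda>(t, \<rho>). mass (u t) \<rho>)"
  unfolding continuous_on_iff
proof (intro ballI allI impI)
  fix X :: "real \<times> real" and e :: real assume X: "X \<in> quadrant" and e: "0 < e"
  obtain t \<rho> where X': "X = (t, \<rho>)" "0 \<le> t" "0 \<le> \<rho>" using X by (cases X) auto
  obtain B where B: "\<And>x. \<bar>u t x\<bar> \<le> B" using bounded_slice[OF X'(2)] by blast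
  have "0 \<le> B" using B[of 0] by linarith
  obtain d where d: "0 < d" "\<And>s. 0 \<le> s \<Longrightarrow> \<bar>s - t\<bar> < d \<Longrightarrow> (LINT x|lborel. \<bar>u s x - u t x\<bar>) < e / 2"
    using L1_norm_diff[OF X'(2), of "e / 2"] e by auto
  define d' where "d' = min d (e / (2 * (B + 1)))"
  have d': "0 < d'" "d' \<le> d" "d' \<le> e / (2 * (B + 1))" using d(1) e \<open>0 \<le> B\<close> by (auto simp: d'_def)
  show "\<exists>d>0. \<forall>Y\<in>quadrant. dist Y X < d \<longrightarrow>
      dist (case Y of (t, \<rho>) \<Rightarrow> mass (u t) \<rho>) (case X of (t, \<rho>) \<Rightarrow> mass (u t) \<rho>) < e"
  proof (intro exI[of _ d'] conjI d' ballI impI)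
    fix Y assume Y: "Y \<in> quadrant" "dist Y X < d'"
    obtain s \<sigma> where Y': "Y = (s, \<sigma>)" "0 \<le> s" "0 \<le> \<sigma>" using Y by (cases Y) auto
    have dist: "\<bar>s - t\<bar> < d'" "\<bar>\<sigma> - \<rho>\<bar> < d'"
      using Y(2) dist_fst_le[of Y X] dist_snd_le[of Y X] by (auto simp: X' Y' dist_real_def)
    have "mass (u s) \<sigma> - mass (u t) \<sigma> = mass (\<lambda>x. u s x - u t x) \<sigma>"
      by (rule mass_diff) (use integrable_slice X' Y' in auto)
    then have "\<bar>mass (u s) \<sigma> - mass (u t) \<sigma>\<bar> \<le> (LINT x|lborel. \<bar>u s x - u t x\<bar>)"
      using mass_abs_le[of "\<lambda>x. u s x - u t x" \<sigma>] integrable_slice X' Y' by auto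
    moreover have "(LINT x|lborel. \<bar>u s x - u t x\<bar>) < e / 2" using d(2)[of s] dist d' Y' by auto
    moreover have "\<bar>mass (u t) \<sigma> - mass (u t) \<rho>\<bar> \<le> B * \<bar>\<sigma> - \<rho>\<bar>"
      by (rule mass_lipschitz[OF integrable_slice B]) (use X' Y' in auto)
    moreover have "B * \<bar>\<sigma> - \<rho>\<bar> \<le> (B + 1) * (e / (2 * (B + 1)))"
      using dist(2) d'(3) \<open>0 \<le> B\<close> by (intro mult_mono) auto
    moreover have "(B + 1) * (e / (2 * (B + 1))) = e / 2"
    proof -
      have "k * (e / (2 * k)) = e / 2" if "k \<noteq> 0" for k using that by simp
      then show ?thesis using \<open>0 \<le> B\<close> by (metis add_nonneg_pos less_irrefl zero_less_one)
    qed
    ultimately have "\<bar>mass (u s) \<sigma> - mass (u t) \<rho>\<bar> < e" by linarith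
    then show "dist (case Y of (t, \<rho>) \<Rightarrow> mass (u t) \<rho>) (case X of (t, \<rho>) \<Rightarrow> mass (u t) \<rho>) < e"
      by (simp add: X' Y' dist_real_def)
  qed
qed

text \<open>The norm in L^1 dominates the mass at every volume and is continuous in time, hence
  bounded on a compact interval.\<close>

lemma mass_locally_bounded: "\<exists>N. \<forall>t\<in>{0..T}. \<forall>\<rho>\<ge>0. \<bar>mass (u t) \<rho>\<bar> \<le> N"
proof -
  define n where "n = (\<lambda>t. LINT x|lborel. \<bar>u t x\<bar>)"
  have diff: "\<bar>n s - n t\<bar> \<le> (LINT x|lborel. \<bar>u s x - u t x\<bar>)" if "0 \<le> s" "0 \<le> t" for s t
  proof -
    have i: "integrable lborel (\<lambda>x. \<bar>u s x\<bar>)" "integrable lborel (\<lambda>x. \<bar>u t x\<bar>)"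
      "integrable lborel (\<lambda>x. \<bar>u s x - u t x\<bar>)" using integrable_slice that by auto
    have "n s - n t = (LINT x|lborel. \<bar>u s x\<bar> - \<bar>u t x\<bar>)" using i by (simp add: n_def)
    moreover have "norm (LINT x|lborel. \<bar>u s x\<bar> - \<bar>u t x\<bar>) \<le> (LINT x|lborel. \<bar>u s x - u t x\<bar>)"
      by (rule norm_integral_le) (use i in auto)
    ultimately show ?thesis by simp
  qed
  have "continuous_on {0..T} n"
    unfolding continuous_on_iff
  proof (intro ballI allI impI)
    fix t e :: real assume t: "t \<in> {0..T}" and e: "0 < e"
    then have t0: "0 \<le> t" by simp
    obtain d where d: "0 < d" "\<And>s. 0 \<le> s \<Longrightarrow> \<bar>s - t\<bar> < d \<Longrightarrow> (LINT x|lborel. \<bar>u s x - u t x\<bar>) < e"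
      using L1_norm_diff[OF t0 e] by metis
    show "\<exists>d>0. \<forall>s\<in>{0..T}. dist s t < d \<longrightarrow> dist (n s) (n t) < e"
      using d(1) by (intro exI[of _ d]) (auto simp: dist_real_def intro!: le_less_trans[OF diff d(2)] t0)
  qed
  then have "bounded (n ` {0..T})"
    by (intro compact_imp_bounded compact_continuous_image) auto
  then obtain N where N: "\<forall>y\<in>n ` {0..T}. norm y \<le> N" unfolding bounded_iff by blast
  show ?thesis
  proof (intro exI[of _ N] ballI allI impI)
    fix t \<rho> :: real assume t: "t \<in> {0..T}" "0 \<le> \<rho>"
    have "\<bar>mass (u t) \<rho>\<bar> \<le> n t" unfolding n_def using t by (intro mass_abs_le integrable_slice) auto
    also have "n t \<le> N" using N t by force
    finally show "\<bar>mass (u t) \<rho>\<bar> \<le> N" .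
  qed
qed

lemma regularised_mass:
  assumes \<alpha>: "0 < \<alpha>" "\<alpha> \<le> 1" and u0: "\<And>x. 0 \<le> u\<^sub>0 x" "\<And>x. u\<^sub>0 x \<le> L"
  shows "regularised_mass \<alpha> (\<lambda>\<rho>. (area TYPE('a) \<rho>)\<^sup>2) L (LINT x|lborel. \<bar>u\<^sub>0 x\<bar>) \<epsilon> (\<lambda>t. mass (u t))"
proof
  have u_0: "u 0 = u\<^sub>0" using sol by (auto simp: classical_solution_def)
  then have int0: "integrable lborel u\<^sub>0" using integrable_slice[of 0] by simp
  have eq: "\<exists>p g A. ((\<lambda>s. mass (u s) \<rho>) has_real_derivative p) (at t) \<and>
     (\<forall>\<^sub>F r in nhds \<rho>. (mass (u t) has_real_derivative g r) (at r)) \<and>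
     (g has_real_derivative A) (at \<rho>) \<and>
     p + (\<epsilon> + max (g \<rho>) 0) powr \<alpha> * mass (u t) \<rho> = \<epsilon> * (area TYPE('a) \<rho>)\<^sup>2 * A"
    if t: "0 < t" "0 < \<rho>" for t \<rho>
  proof -
    obtain A where A: "((\<lambda>\<sigma>. u t (point \<sigma>)) has_real_derivative A) (at \<rho>)"
    "((\<lambda>s. mass (u s) \<rho>) has_real_derivative
        \<epsilon> * (area TYPE('a) \<rho>)\<^sup>2 * A - (\<epsilon> + max (u t (point \<rho>)) 0) powr \<alpha> * mass (u t) \<rho>) (at t)"
      using mass_equation[OF t] by blast
    have "\<forall>\<^sub>F r in nhds \<rho>. r \<in> {0<..}" using t by (intro eventually_nhds_in_open) auto
    then have "\<forall>\<^sub>F r in nhds \<rho>. (mass (u t) has_real_derivative u t (point r)) (at r)"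
      by eventually_elim (use mass_derivative t in auto)
    with A show ?thesis
      by (intro exI[of _ "\<epsilon> * (area TYPE('a) \<rho>)\<^sup>2 * A - (\<epsilon> + max (u t (point \<rho>)) 0) powr \<alpha> * mass (u t) \<rho>"]
          exI[of _ "\<lambda>\<sigma>. u t (point \<sigma>)"] exI[of _ A]) simp
  qed
  show "classical_sub (\<lambda>\<rho>. (area TYPE('a) \<rho>)\<^sup>2) \<epsilon> (hamiltonian \<alpha> \<epsilon> 1) (\<lambda>t. mass (u t))"
    unfolding classical_sub_def hamiltonian_def
  proof (intro allI impI)
    fix t \<rho> :: real assume t: "0 < t" "0 < \<rho>"
    obtain p g A where *: "((\<lambda>s. mass (u s) \<rho>) has_real_derivative p) (at t)"
     "\<forall>\<^sub>F r in nhds \<rho>. (mass (u t) has_real_derivative g r) (at r)"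
     "(g has_real_derivative A) (at \<rho>)"
     "p + (\<epsilon> + max (g \<rho>) 0) powr \<alpha> * mass (u t) \<rho> = \<epsilon> * (area TYPE('a) \<rho>)\<^sup>2 * A"
      using eq[OF t] by blast
    then show "\<exists>p g A. ((\<lambda>s. mass (u s) \<rho>) has_real_derivative p) (at t) \<and>
     (\<forall>\<^sub>F r in nhds \<rho>. (mass (u t) has_real_derivative g r) (at r)) \<and>
     (g has_real_derivative A) (at \<rho>) \<and>
     p + (\<epsilon> + max (1 * g \<rho>) 0) powr \<alpha> * mass (u t) \<rho> \<le> \<epsilon> * (area TYPE('a) \<rho>)\<^sup>2 * A"
      by (intro exI[of _ p] exI[of _ g] exI[of _ A]) simp
  qed
  show "classical_sub (\<lambda>\<rho>. (area TYPE('a) \<rho>)\<^sup>2) \<epsilon> (hamiltonian \<alpha> \<epsilon> (- 1)) (\<lambda>t r. - mass (u t) r)"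
    unfolding classical_sub_def hamiltonian_def
  proof (intro allI impI)
    fix t \<rho> :: real assume t: "0 < t" "0 < \<rho>"
    obtain p g A where *: "((\<lambda>s. mass (u s) \<rho>) has_real_derivative p) (at t)"
     "\<forall>\<^sub>F r in nhds \<rho>. (mass (u t) has_real_derivative g r) (at r)"
     "(g has_real_derivative A) (at \<rho>)"
     "p + (\<epsilon> + max (g \<rho>) 0) powr \<alpha> * mass (u t) \<rho> = \<epsilon> * (area TYPE('a) \<rho>)\<^sup>2 * A"
      using eq[OF t] by blast
    have "\<forall>\<^sub>F r in nhds \<rho>. ((\<lambda>r. - mass (u t) r) has_real_derivative - g r) (at r)"
      using *(2) by eventually_elim (rule DERIV_minus)
    with DERIV_minus[OF *(1)] DERIV_minus[OF *(3)] *(4)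
    show "\<exists>p g A. ((\<lambda>s. - mass (u s) \<rho>) has_real_derivative p) (at t) \<and>
     (\<forall>\<^sub>F r in nhds \<rho>. ((\<lambda>r. - mass (u t) r) has_real_derivative g r) (at r)) \<and>
     (g has_real_derivative A) (at \<rho>) \<and>
     p + (\<epsilon> + max (- 1 * g \<rho>) 0) powr \<alpha> * - mass (u t) \<rho> \<le> \<epsilon> * (area TYPE('a) \<rho>)\<^sup>2 * A"
      by (intro exI[of _ "- p"] exI[of _ "\<lambda>r. - g r"] exI[of _ "- A"]) auto
  qed
  show "mass (u 0) r - mass (u 0) q \<le> L * max (r - q) 0" if "0 \<le> r" "0 \<le> q" for r q
  proof (cases "q \<le> r")
    case True
    have "\<bar>mass u\<^sub>0 r - mass u\<^sub>0 q\<bar> \<le> L * \<bar>r - q\<bar>"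
      by (rule mass_lipschitz[OF int0]) (use u0 that in auto)
    then show ?thesis using True by (simp add: u_0)
  next
    case False
    \<comment> \<open>The condition 0 \<le> u0 \<le> L centred at L / 2: the shell estimate with
      this centre has lower end exactly 0, which is monotonicity.\<close>
    have "\<bar>u\<^sub>0 x - L / 2\<bar> \<le> L / 2" for x using u0(1)[of x] u0(2)[of x] by linarith
    then have "\<bar>mass u\<^sub>0 q - mass u\<^sub>0 r - L / 2 * (q - r)\<bar> \<le> L / 2 * (q - r)"
      using False that by (intro mass_diff_le[OF int0]) auto
    then have "0 \<le> mass u\<^sub>0 q - mass u\<^sub>0 r" by linarith
    then show ?thesis using False by (simp add: u_0)
  qed
  show "mass (u 0) r \<le> (LINT x|lborel. \<bar>u\<^sub>0 x\<bar>)" for r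
    using mass_abs_le[OF int0, of r] by (simp add: u_0)
  show "0 \<le> (area TYPE('a) r)\<^sup>2 \<and> (area TYPE('a) r)\<^sup>2 \<le> (area TYPE('a) s)\<^sup>2" if "0 \<le> r" "r \<le> s" for r s
    using area_mono[OF that, where 'a='a] by (simp add: power_mono)
  show "0 \<le> L" using u0[of 0] by linarith
qed (use \<alpha> \<epsilon> continuous_mass mass_locally_bounded mass_zero in auto)

end

theorem theorem7p12:
  fixes \<alpha> :: real
    and u\<^sub>0 :: "'a::euclidean_space \<Rightarrow> real"
    and u :: "real \<Rightarrow> real \<Rightarrow> 'a \<Rightarrow> real"
  assumes "0 < \<alpha>" and "\<alpha> < 1"
    and "integrable lborel u\<^sub>0" and "continuous_on UNIV u\<^sub>0" and "bounded (range u\<^sub>0)"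
    and "radial u\<^sub>0" and "\<And>x. u\<^sub>0 x \<ge> 0"
    and "\<And>\<epsilon>. \<epsilon> > 0 \<Longrightarrow> classical_solution \<alpha> \<epsilon> u\<^sub>0 (u \<epsilon>)"
    and "\<And>\<epsilon> t. \<epsilon> > 0 \<Longrightarrow> t \<ge> 0 \<Longrightarrow> radial (u \<epsilon> t)"
  shows "\<exists>m. BUC_viscosity_solution \<alpha> (mass u\<^sub>0) m \<and>
             (\<forall>m'. BUC_viscosity_solution \<alpha> (mass u\<^sub>0) m' \<longrightarrow> (\<forall>X\<in>quadrant. m' X = m X)) \<and>
             (\<forall>K. compact K \<and> K \<subseteq> quadrant \<longrightarrow>
                uniform_limit K (\<lambda>\<epsilon> (t, \<rho>). mass (u \<epsilon> t) \<rho>) m (at_right 0)) \<and>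
             (\<exists>L. \<forall>t\<ge>0. L-lipschitz_on {0..} (\<lambda>\<rho>. m (t, \<rho>)))"
proof -
  obtain L where "\<forall>y\<in>range u\<^sub>0. norm y \<le> L"
    using assms(5) unfolding bounded_iff by blast
  then have L: "u\<^sub>0 x \<le> L" for x by (auto dest: spec[of _ x])
  interpret regularised_family \<alpha> "\<lambda>\<rho>. (area TYPE('a) \<rho>)\<^sup>2" L "LINT x|lborel. \<bar>u\<^sub>0 x\<bar>" "mass u\<^sub>0"
    "\<lambda>\<epsilon> t. mass (u \<epsilon> t)"
  proof (rule regularised_family.intro)
    fix \<epsilon> r :: real assume \<epsilon>: "0 < \<epsilon>"
    interpret radial_classical_solution \<alpha> \<epsilon> u\<^sub>0 "u \<epsilon>"
      using \<epsilon> assms(8,9) by unfold_locales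
    show "regularised_mass \<alpha> (\<lambda>\<rho>. (area TYPE('a) \<rho>)\<^sup>2) L (LINT x|lborel. \<bar>u\<^sub>0 x\<bar>) \<epsilon> (\<lambda>t. mass (u \<epsilon> t))"
      by (rule regularised_mass) (use assms L in auto)
    show "mass (u \<epsilon> 0) r = mass u\<^sub>0 r"
      using assms(8)[OF \<epsilon>] by (simp add: classical_solution_def ext[of "u \<epsilon> 0" u\<^sub>0])
  qed
  show ?thesis by (rule convergence)
qed

end
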